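(* Let $R$ be a reduced Noetherian (commutative) ring with normalization $R^{\mathrm{N}}$, let $\mathfrak{c} = \mathrm{Ann}_R(R^{\mathrm{N}}/R)$ be the conductor, which is an ideal of both $R$ and $R^{\mathrm{N}}$, and let $\sqrt{\mathfrak{c}R}$ and $\sqrt{\mathfrak{c}R^{\mathrm{N}}}$ denote its radicals in $R$ and in $R^{\mathrm{N}}$ respectively. Let $$D = (R/\sqrt{\mathfrak{c}R})^{\mathrm{SN}} \cap \left(R^{\mathrm{N}}/\sqrt{\mathfrak{c}R^{\mathrm{N}}}\right),$$ where the intersection is taken in the total ring of fractions of $R^{\mathrm{N}}/\sqrt{\mathfrak{c}R^{\mathrm{N}}}$ and $(-)^{\mathrm{SN}}$ denotes seminormalization. Let $C$ be the pullback (fiber product of rings) of the diagram $$R^{\mathrm{N}} \twoheadrightarrow R^{\mathrm{N}}/\sqrt{\mathfrak{c}R^{\mathrm{N}}} \hookleftarrow D,$$ that is, $C = \{(x,d) \in R^{\mathrm{N}} \times D : x \bmod \sqrt{\mathfrak{c}R^{\mathrm{N}}} = d\}$, which is identified via the first projection with a subring of $R^{\mathrm{N}}$ containing $R$. Then $C$ is the seminormalization $R^{\mathrm{SN}}$ of $R$.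
   Context: All rings are commutative with $1$. For a reduced ring $R$, the normalization $R^{\mathrm{N}}$ is the integral closure of $R$ in its total ring of fractions. A reduced Noetherian ring $R$ is called seminormal if every finite birational extension $R \subseteq S$ that induces a bijection on prime spectra and isomorphisms of all residue fields is an isomorphism. The seminormalization $R^{\mathrm{SN}}$ of a reduced ring $R$ is the largest intermediate ring $R \subseteq R^{\mathrm{SN}} \subseteq R^{\mathrm{N}}$ such that $R \to R^{\mathrm{SN}}$ induces a bijection on prime spectra and isomorphisms on all residue fields. Seminormalization is functorial: a ring homomorphism $A \to B$ of reduced rings extends uniquely to $A^{\mathrm{SN}} \to B^{\mathrm{SN}}$. Meaning of the intersection defining $D$: put $A = R/\sqrt{\mathfrak{c}R}$ and $B = R^{\mathrm{N}}/\sqrt{\mathfrak{c}R^{\mathrm{N}}}$. The inclusion $R \subseteq R^{\mathrm{N}}$ induces an injection $A \hookrightarrow B$, and by functoriality an injection $A^{\mathrm{SN}} \hookrightarrow B^{\mathrm{SN}}$, where $B^{\mathrm{SN}}$ is contained in the total ring of fractions of $B$. Both $A^{\mathrm{SN}}$ and $B$ are thus regarded as subrings of the total ring of fractions of $B$, and $D = A^{\mathrm{SN}} \cap B$ there. *)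

theory Defs
  imports "HOL-Algebra.Algebra"
begin

section \<open>Reduced rings, radicals, total rings of fractions\<close>

definition reduced_ring :: "('a, 'm) ring_scheme \<Rightarrow> bool" where
  "reduced_ring R \<longleftrightarrow>
     cring R \<and> (\<forall>x\<in>carrier R. \<forall>n::nat. x [^]\<^bsub>R\<^esub> n = \<zero>\<^bsub>R\<^esub> \<longrightarrow> x = \<zero>\<^bsub>R\<^esub>)"

definition radical :: "('a, 'm) ring_scheme \<Rightarrow> 'a set \<Rightarrow> 'a set" where
  "radical R I = {x \<in> carrier R. \<exists>n::nat. n > 0 \<and> x [^]\<^bsub>R\<^esub> n \<in> I}"

definition nonzerodivisors :: "('a, 'm) ring_scheme \<Rightarrow> 'a set" where
  "nonzerodivisors R =
     {s \<in> carrier R. \<forall>a\<in>carrier R. s \<otimes>\<^bsub>R\<^esub> a = \<zero>\<^bsub>R\<^esub> \<longrightarrow> a = \<zero>\<^bsub>R\<^esub>}"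

text \<open>Since denominators are nonzerodivisors, \<open>a/s = b/t\<close> means \<open>a t = b s\<close>; no auxiliary
  multiplier is needed.\<close>

definition frac_rel :: "('a, 'm) ring_scheme \<Rightarrow> (('a \<times> 'a) \<times> ('a \<times> 'a)) set" where
  "frac_rel R = {((a, s), (b, t)).
     a \<in> carrier R \<and> b \<in> carrier R \<and> s \<in> nonzerodivisors R \<and> t \<in> nonzerodivisors R \<and>
     a \<otimes>\<^bsub>R\<^esub> t = b \<otimes>\<^bsub>R\<^esub> s}"

definition fraction :: "('a, 'm) ring_scheme \<Rightarrow> 'a \<Rightarrow> 'a \<Rightarrow> ('a \<times> 'a) set" where
  "fraction R a s = frac_rel R `` {(a, s)}"

definition total_fractions :: "('a, 'm) ring_scheme \<Rightarrow> ('a \<times> 'a) set ring" where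
  "total_fractions R =
     \<lparr>carrier = (carrier R \<times> nonzerodivisors R) // frac_rel R,
      monoid.mult = (\<lambda>U V. \<Union>(a, s)\<in>U. \<Union>(b, t)\<in>V. fraction R (a \<otimes>\<^bsub>R\<^esub> b) (s \<otimes>\<^bsub>R\<^esub> t)),
      one = fraction R \<one>\<^bsub>R\<^esub> \<one>\<^bsub>R\<^esub>,
      ring.zero = fraction R \<zero>\<^bsub>R\<^esub> \<one>\<^bsub>R\<^esub>,
      ring.add = (\<lambda>U V. \<Union>(a, s)\<in>U. \<Union>(b, t)\<in>V.
               fraction R ((a \<otimes>\<^bsub>R\<^esub> t) \<oplus>\<^bsub>R\<^esub> (b \<otimes>\<^bsub>R\<^esub> s)) (s \<otimes>\<^bsub>R\<^esub> t))\<rparr>"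

definition to_frac :: "('a, 'm) ring_scheme \<Rightarrow> 'a \<Rightarrow> ('a \<times> 'a) set" where
  "to_frac R a = fraction R a \<one>\<^bsub>R\<^esub>"


section \<open>Normalization and conductor\<close>

text \<open>\<open>\<one> # p\<close> lists the coefficients of a monic polynomial, leading coefficient first.
  The library predicate \<open>polynomial\<close> is avoided because it forces the leading coefficient to be
  nonzero, which would make the integral closure of the zero ring empty.\<close>

definition integral_over :: "('a, 'm) ring_scheme \<Rightarrow> 'a set \<Rightarrow> 'a \<Rightarrow> bool" where
  "integral_over Q K x \<longleftrightarrow> (\<exists>p. set p \<subseteq> K \<and> ring.eval Q (\<one>\<^bsub>Q\<^esub> # p) x = \<zero>\<^bsub>Q\<^esub>)"

definition normalization :: "('a, 'm) ring_scheme \<Rightarrow> ('a \<times> 'a) set ring" where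
  "normalization R = (total_fractions R)
     \<lparr>carrier := {x \<in> carrier (total_fractions R).
        integral_over (total_fractions R) (to_frac R ` carrier R) x}\<rparr>"

text \<open>The annihilator in \<open>R\<close> of the \<open>R\<close>-module \<open>R\<^sup>N / R\<close>.\<close>

definition conductor :: "('a, 'm) ring_scheme \<Rightarrow> 'a set" where
  "conductor R = {r \<in> carrier R. \<forall>x\<in>carrier (normalization R).
     to_frac R r \<otimes>\<^bsub>normalization R\<^esub> x \<in> to_frac R ` carrier R}"


section \<open>Induced maps on quotients, fractions and residue fields\<close>

text \<open>The map \<open>R/I \<rightarrow> S/J\<close> induced by \<open>f : R \<rightarrow> S\<close>, where \<open>f I \<subseteq> J\<close>.\<close>

definition quot_map ::
  "('b, 'n) ring_scheme \<Rightarrow> 'b set \<Rightarrow> ('a \<Rightarrow> 'b) \<Rightarrow> 'a set \<Rightarrow> 'b set" where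
  "quot_map S J f U = the_elem ((\<lambda>x. J +>\<^bsub>S\<^esub> f x) ` U)"

text \<open>The map \<open>a/s \<mapsto> g a / g s\<close>, where \<open>g\<close> preserves nonzerodivisors.\<close>

definition frac_map ::
  "('b, 'n) ring_scheme \<Rightarrow> ('a \<Rightarrow> 'b) \<Rightarrow> ('a \<times> 'a) set \<Rightarrow> ('b \<times> 'b) set" where
  "frac_map S g U = (\<Union>(a, s)\<in>U. fraction S (g a) (g s))"

definition Spec :: "('a, 'm) ring_scheme \<Rightarrow> 'a set set" where
  "Spec R = {P. primeideal P R}"

definition contract ::
  "('a, 'm) ring_scheme \<Rightarrow> ('a \<Rightarrow> 'b) \<Rightarrow> 'b set \<Rightarrow> 'a set" where
  "contract R f Q = {a \<in> carrier R. f a \<in> Q}"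

text \<open>The fraction field of the domain \<open>R/P\<close>.\<close>

definition residue_field :: "('a, 'm) ring_scheme \<Rightarrow> 'a set \<Rightarrow> ('a set \<times> 'a set) set ring" where
  "residue_field R P = total_fractions (R Quot P)"

definition spec_residue_iso ::
  "('a, 'm) ring_scheme \<Rightarrow> ('b, 'n) ring_scheme \<Rightarrow> ('a \<Rightarrow> 'b) \<Rightarrow> bool" where
  "spec_residue_iso R S f \<longleftrightarrow>
     f \<in> ring_hom R S \<and>
     bij_betw (contract R f) (Spec S) (Spec R) \<and>
     (\<forall>Q\<in>Spec S. frac_map (S Quot Q) (quot_map S Q f)
        \<in> ring_iso (residue_field R (contract R f Q)) (residue_field S Q))"


section \<open>Seminormalization\<close>

definition subintegral_intermediate ::
  "('a, 'm) ring_scheme \<Rightarrow> ('a \<times> 'a) set set \<Rightarrow> bool" where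
  "subintegral_intermediate R S \<longleftrightarrow>
     subring S (normalization R) \<and> to_frac R ` carrier R \<subseteq> S \<and>
     spec_residue_iso R ((normalization R)\<lparr>carrier := S\<rparr>) (to_frac R)"

definition is_seminormalization ::
  "('a, 'm) ring_scheme \<Rightarrow> ('a \<times> 'a) set set \<Rightarrow> bool" where
  "is_seminormalization R S \<longleftrightarrow>
     subintegral_intermediate R S \<and> (\<forall>T. subintegral_intermediate R T \<longrightarrow> T \<subseteq> S)"

definition seminormalization :: "('a, 'm) ring_scheme \<Rightarrow> ('a \<times> 'a) set ring" where
  "seminormalization R =
     (normalization R)\<lparr>carrier := (THE S. is_seminormalization R S)\<rparr>"

lemma seminormalization_eqI:
  assumes "is_seminormalization R S"
  shows "seminormalization R = (normalization R)\<lparr>carrier := S\<rparr>"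
proof -
  have "(THE S. is_seminormalization R S) = S"
    using assms by (intro the_equality) (auto simp: is_seminormalization_def)
  then show ?thesis
    by (simp add: seminormalization_def)
qed

text \<open>Functoriality: the unique ring homomorphism \<open>A\<^sup>S\<^sup>N \<rightarrow> B\<^sup>S\<^sup>N\<close> extending \<open>f : A \<rightarrow> B\<close>.
  It need not be induced by a map of total rings of fractions, since \<open>f\<close> may send
  nonzerodivisors to zero divisors. Extensionality only fixes the values outside \<open>A\<^sup>S\<^sup>N\<close>.\<close>

definition seminormalization_map ::
  "('a, 'm) ring_scheme \<Rightarrow> ('b, 'n) ring_scheme \<Rightarrow> ('a \<Rightarrow> 'b) \<Rightarrow> ('a \<times> 'a) set \<Rightarrow> ('b \<times> 'b) set"
where
  "seminormalization_map A B f =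
     (THE g. g \<in> ring_hom (seminormalization A) (seminormalization B) \<and>
             g \<in> extensional (carrier (seminormalization A)) \<and>
             (\<forall>a\<in>carrier A. g (to_frac A a) = to_frac B (f a)))"


section \<open>Fiber products\<close>

definition fiber_product ::
  "('a, 'm) ring_scheme \<Rightarrow> ('b, 'n) ring_scheme \<Rightarrow> ('a \<Rightarrow> 'c) \<Rightarrow> ('b \<Rightarrow> 'c) \<Rightarrow> ('a \<times> 'b) ring" where
  "fiber_product R S f g =
     (RDirProd R S)\<lparr>carrier := {(x, y) \<in> carrier R \<times> carrier S. f x = g y}\<rparr>"

end

theory Submission
  imports Defs
begin

text \<open>
  The seminormalization \<open>R\<^sup>S\<^sup>N\<close> can be described pointwise.  An element \<open>y\<close> of an integral extension
  \<open>N\<close> of \<open>R\<close> lies in the largest subring with the same spectrum and the same residue fields as \<open>R\<close>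
  iff, for every prime \<open>p\<close> of \<open>R\<close>, it takes at all primes of \<open>N\<close> over \<open>p\<close> one and the same value \<open>a/s\<close>
  in the residue field of \<open>p\<close>.  This closure is a seminormalization for every commutative ring
  (\<open>is_seminormalization_pointwise_closure\<close>); the proof rests on the fact that the integral closure is
  a ring, and on lying over.

  The second ingredient is functoriality.  If \<open>A \<rightarrow> T\<close> is subintegral, then a homomorphism
  \<open>A \<rightarrow> E\<close> to a reduced ring has at most one extension to \<open>T\<close>, because the residue field of \<open>T\<close> at the
  contraction of a prime of \<open>E\<close> is already that of \<open>A\<close> (\<open>extension_unique\<close>).  If \<open>A\<close> is Noetherian and
  \<open>E\<close> is von Neumann regular, then an extension exists: locally on \<open>E\<close> it is a fraction of images of
  elements of \<open>A\<close>, and the local pieces are glued along idempotents (\<open>extension_exists\<close>).  Applied to the total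
  ring of fractions \<open>E\<close> of \<open>B\<close>, this yields \<open>A\<^sup>S\<^sup>N \<rightarrow> B\<^sup>S\<^sup>N\<close> (\<open>seminormalization_map\<close>).

  The total ring of fractions of a reduced Noetherian ring is von Neumann regular.  For
  \<open>B = N / rad c\<close>, with \<open>N\<close> the normalization of \<open>R\<close> and \<open>c\<close> the conductor, more is required, as \<open>N\<close> may
  fail to be Noetherian.  It is a product of two rings: on one of them, multiplication by a suitable
  \<open>r \<in> c\<close> is injective and lands in \<open>R\<close>, so the chain condition is inherited from \<open>R\<close>; on the other
  one \<open>c\<close> vanishes (\<open>complemented_Quot_radical_conductor\<close>).

  The theorem follows by comparing values.  A prime \<open>p\<close> of \<open>R\<close> that does not contain \<open>c\<close> imposes no
  condition, since some \<open>s \<in> c\<close> outside \<open>p\<close> multiplies \<open>N\<close> into \<open>R\<close>.  For a prime \<open>p\<close> containing \<open>c\<close>, the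
  primes of \<open>N\<close> over \<open>p\<close> are primes of \<open>B\<close> over a prime of \<open>A = R / rad c\<close>, so that the condition says that
  the class of the element in \<open>B\<close> has the values of an element of \<open>A\<^sup>S\<^sup>N\<close>.
\<close>

section \<open>Prime ideals\<close>

lemma Spec_iff: "P \<in> Spec R \<longleftrightarrow> primeideal P R"
  by (simp add: Spec_def)

lemma Spec_ideal: "P \<in> Spec R \<Longrightarrow> ideal P R"
  by (simp add: Spec_iff primeideal.axioms(1))

lemma Spec_zero: "P \<in> Spec R \<Longrightarrow> \<zero>\<^bsub>R\<^esub> \<in> P"
  by (intro additive_subgroup.zero_closed ideal.axioms(1) Spec_ideal)

lemma Spec_one_notin: "P \<in> Spec R \<Longrightarrow> \<one>\<^bsub>R\<^esub> \<notin> P"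
  using primeideal.I_notcarr ideal.one_imp_carrier Spec_ideal unfolding Spec_iff by metis

lemma Spec_mult_notin:
  assumes "P \<in> Spec R" "s \<in> carrier R" "t \<in> carrier R" "s \<notin> P" "t \<notin> P"
  shows "s \<otimes>\<^bsub>R\<^esub> t \<notin> P"
  using assms primeideal.I_prime[of P R s t] by (auto simp: Spec_iff)

lemma (in cring) ideal_adjoin:
  assumes "ideal P R" "a \<in> carrier R"
  shows "ideal {p \<oplus> t \<otimes> a | p t. p \<in> P \<and> t \<in> carrier R} R"
proof -
  have "{p \<oplus> t \<otimes> a | p t. p \<in> P \<and> t \<in> carrier R} = P <+> PIdl a"
    unfolding set_add_def' cgenideal_def by blast
  then show ?thesis
    using add_ideals[OF assms(1) cgenideal_ideal[OF assms(2)]] by simp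
qed

lemma (in cring) ideal_minus_closed:
  assumes "ideal I R" "x \<in> I" "y \<in> I"
  shows "x \<ominus> y \<in> I"
proof -
  interpret ideal I R by fact
  show ?thesis
    using assms by (simp add: a_minus_def)
qed

lemma (in cring) ideal_criterion:
  assumes "I \<subseteq> carrier R" "\<zero> \<in> I" "\<And>x y. x \<in> I \<Longrightarrow> y \<in> I \<Longrightarrow> x \<oplus> y \<in> I"
    and mult: "\<And>a x. a \<in> carrier R \<Longrightarrow> x \<in> I \<Longrightarrow> a \<otimes> x \<in> I"
  shows "ideal I R"
proof (rule idealI[OF ring_axioms])
  have "\<ominus> x \<in> I" if "x \<in> I" for x
    using mult[of "\<ominus> \<one>" x] that assms(1) by (auto simp: l_minus)
  then show "subgroup I (add_monoid R)"
    using assms by (intro add.subgroupI) (auto simp: a_inv_def)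
  fix x a assume xa: "x \<in> I" "a \<in> carrier R"
  then show "a \<otimes> x \<in> I" by (intro mult)
  moreover have "x \<otimes> a = a \<otimes> x" using xa assms(1) by (intro m_comm) auto
  ultimately show "x \<otimes> a \<in> I" by simp
qed

text \<open>The congruence \<open>s x - a \<in> P\<close> says that \<open>x\<close> has the value \<open>a/s\<close> at \<open>P\<close>.  Values at a fixed
  prime are added and multiplied like fractions.\<close>

lemma (in cring) congruent_fraction_add:
  assumes P: "ideal P R" and c: "s \<in> carrier R" "t \<in> carrier R" "a \<in> carrier R" "b \<in> carrier R"
      "x \<in> carrier R" "y \<in> carrier R"
    and sx: "s \<otimes> x \<ominus> a \<in> P" and ty: "t \<otimes> y \<ominus> b \<in> P"
  shows "(s \<otimes> t) \<otimes> (x \<oplus> y) \<ominus> (t \<otimes> a \<oplus> s \<otimes> b) \<in> P"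
proof -
  interpret P: ideal P R by fact
  have "(s \<otimes> t) \<otimes> (x \<oplus> y) \<ominus> (t \<otimes> a \<oplus> s \<otimes> b) = t \<otimes> (s \<otimes> x \<ominus> a) \<oplus> s \<otimes> (t \<otimes> y \<ominus> b)"
    using c by algebra
  then show ?thesis
    using P.a_closed[OF P.I_l_closed[OF sx c(2)] P.I_l_closed[OF ty c(1)]] by simp
qed

lemma (in cring) congruent_fraction_mult:
  assumes P: "ideal P R" and c: "s \<in> carrier R" "t \<in> carrier R" "a \<in> carrier R" "b \<in> carrier R"
      "x \<in> carrier R" "y \<in> carrier R"
    and sx: "s \<otimes> x \<ominus> a \<in> P" and ty: "t \<otimes> y \<ominus> b \<in> P"
  shows "(s \<otimes> t) \<otimes> (x \<otimes> y) \<ominus> a \<otimes> b \<in> P"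
proof -
  interpret P: ideal P R by fact
  have "(s \<otimes> t) \<otimes> (x \<otimes> y) \<ominus> a \<otimes> b = (t \<otimes> y) \<otimes> (s \<otimes> x \<ominus> a) \<oplus> a \<otimes> (t \<otimes> y \<ominus> b)"
    using c by algebra
  then show ?thesis
    using P.a_closed[OF P.I_l_closed[OF sx m_closed[OF c(2,6)]] P.I_l_closed[OF ty c(3)]] by simp
qed

lemma (in ring_hom_cring) hom_minus:
  "x \<in> carrier R \<Longrightarrow> y \<in> carrier R \<Longrightarrow> h (x \<ominus> y) = h x \<ominus>\<^bsub>S\<^esub> h y"
  by (simp add: a_minus_def)

lemma (in ring_hom_cring) image_subring: "subring (h ` carrier R) S"
  by (rule S.ring_incl_imp_subring[OF _ ring.img_is_ring]) auto

text \<open>An ideal that is maximal among those disjoint from a multiplicative set is prime.  Its maximality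
  enters twice, for its primality and for lying over, each time through the ideal generated by
  \<open>P\<close> and one more element; the last conclusion records it in this form.\<close>

lemma (in cring) prime_avoiding:
  assumes I: "ideal I R"
    and S: "S \<subseteq> carrier R" "\<one> \<in> S" "\<And>a b. a \<in> S \<Longrightarrow> b \<in> S \<Longrightarrow> a \<otimes> b \<in> S"
    and disj: "I \<inter> S = {}"
  obtains P where "primeideal P R" "I \<subseteq> P" "P \<inter> S = {}"
    "\<And>a. a \<in> carrier R \<Longrightarrow> a \<notin> P \<Longrightarrow> \<exists>q\<in>P. \<exists>t\<in>carrier R. q \<oplus> t \<otimes> a \<in> S"
proof -
  let ?F = "{K. ideal K R \<and> I \<subseteq> K \<and> K \<inter> S = {}}"
  have "\<exists>M\<in>?F. \<forall>K\<in>?F. M \<subseteq> K \<longrightarrow> K = M"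
  proof (rule subset_Zorn_nonempty)
    show "?F \<noteq> {}" using I disj by blast
  next
    fix C assume C: "C \<noteq> {}" "subset.chain ?F C"
    then have "subset.chain {I. ideal I R} C" "C \<subseteq> ?F"
      by (auto simp: pred_on.chain_def)
    then have "ideal (\<Union>C) R"
      using chain_Union_is_ideal[of C] C(1) by simp
    moreover have "I \<subseteq> \<Union>C"
      using \<open>C \<subseteq> ?F\<close> C(1) by auto
    moreover have "\<Union>C \<inter> S = {}"
      using \<open>C \<subseteq> ?F\<close> by auto
    ultimately show "\<Union>C \<in> ?F" by simp
  qed
  then obtain P where *: "P \<in> ?F" "\<forall>K\<in>?F. P \<subseteq> K \<longrightarrow> K = P"
    by (rule bexE)
  then have P: "ideal P R" "I \<subseteq> P" "P \<inter> S = {}"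
    by simp_all
  have max: "K = P" if "ideal K R" "P \<subseteq> K" "K \<inter> S = {}" for K
    using *(2) that subset_trans[OF P(2) that(2)] by simp
  interpret P: ideal P R by fact
  have meets: "\<exists>q\<in>P. \<exists>t\<in>carrier R. q \<oplus> t \<otimes> a \<in> S" if a: "a \<in> carrier R" "a \<notin> P" for a
  proof -
    let ?K = "{p \<oplus> t \<otimes> a | p t. p \<in> P \<and> t \<in> carrier R}"
    have "P \<subseteq> ?K"
    proof
      fix p assume "p \<in> P"
      then show "p \<in> ?K"
        using a by (intro CollectI exI[of _ p] exI[of _ \<zero>]) (auto dest: P.Icarr)
    qed
    moreover have "a \<in> ?K"
      using a by (intro CollectI exI[of _ \<zero>] exI[of _ \<one>]) (auto simp: P.zero_closed)
    ultimately have "?K \<inter> S \<noteq> {}"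
      using max[OF ideal_adjoin[OF P(1) a(1)]] a(2) by blast
    then show ?thesis by blast
  qed
  have "primeideal P R"
  proof (rule primeidealI)
    show "ideal P R" by fact
    show "cring R" by (rule is_cring)
    show "carrier R \<noteq> P" using P(3) S(2) by auto
    fix a b assume a: "a \<in> carrier R" and b: "b \<in> carrier R" and ab: "a \<otimes> b \<in> P"
    show "a \<in> P \<or> b \<in> P"
    proof (rule ccontr)
      assume "\<not> (a \<in> P \<or> b \<in> P)"
      then obtain p t q u where pt: "p \<in> P" "t \<in> carrier R" "p \<oplus> t \<otimes> a \<in> S"
        and qu: "q \<in> P" "u \<in> carrier R" "q \<oplus> u \<otimes> b \<in> S"
        using meets a b by meson
      note c = P.Icarr[OF pt(1)] P.Icarr[OF qu(1)] a b pt(2) qu(2)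
      have "(p \<oplus> t \<otimes> a) \<otimes> (q \<oplus> u \<otimes> b)
          = (q \<oplus> u \<otimes> b) \<otimes> p \<oplus> ((t \<otimes> a) \<otimes> q \<oplus> (t \<otimes> u) \<otimes> (a \<otimes> b))"
        using c by algebra
      also have "\<dots> \<in> P"
        using P.I_l_closed[OF pt(1), of "q \<oplus> u \<otimes> b"] P.I_l_closed[OF qu(1), of "t \<otimes> a"]
          P.I_l_closed[OF ab, of "t \<otimes> u"] c by simp
      finally show False
        using S(3)[OF pt(3) qu(3)] P(3) by blast
    qed
  qed
  with P meets show ?thesis by (intro that)
qed

lemma (in cring) pow_mem_primeideal:
  assumes "primeideal P R" "x \<in> carrier R" "x [^] (n::nat) \<in> P"
  shows "x \<in> P"
proof -
  interpret P: primeideal P R by fact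
  have "\<one> \<notin> P" using P.I_notcarr P.one_imp_carrier by blast
  with assms(3) show ?thesis
  proof (induction n)
    case (Suc n)
    then have "x [^] n \<in> P \<or> x \<in> P"
      using assms(2) by (intro P.I_prime) auto
    with Suc show ?case by blast
  qed auto
qed

lemma reduced_ring_zeroI:
  assumes E: "reduced_ring E" and x: "x \<in> carrier E" "\<And>P. P \<in> Spec E \<Longrightarrow> x \<in> P"
  shows "x = \<zero>\<^bsub>E\<^esub>"
proof (rule ccontr)
  assume nz: "x \<noteq> \<zero>\<^bsub>E\<^esub>"
  interpret E: cring E using E by (simp add: reduced_ring_def)
  let ?S = "{x [^]\<^bsub>E\<^esub> (n::nat) | n. True}"
  have "?S \<subseteq> carrier E" using x by auto
  moreover have "\<one>\<^bsub>E\<^esub> \<in> ?S" by (metis (mono_tags) CollectI E.nat_pow_0)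
  moreover have "a \<otimes>\<^bsub>E\<^esub> b \<in> ?S" if "a \<in> ?S" "b \<in> ?S" for a b
    using that E.nat_pow_mult[OF x(1)] by blast
  moreover have "{\<zero>\<^bsub>E\<^esub>} \<inter> ?S = {}"
  proof -
    have "x [^]\<^bsub>E\<^esub> n \<noteq> \<zero>\<^bsub>E\<^esub>" for n :: nat
      using E x(1) nz unfolding reduced_ring_def by blast
    then have "\<zero>\<^bsub>E\<^esub> \<notin> ?S" by force
    then show ?thesis by blast
  qed
  ultimately obtain P where "primeideal P E" "P \<inter> ?S = {}"
    by (rule E.prime_avoiding[OF E.zeroideal])
  moreover have "x \<in> ?S" using x(1) by (metis (mono_tags) CollectI E.nat_pow_eone)
  ultimately show False
    using x(2) by (auto simp: Spec_iff)
qed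

lemma reduced_ring_mult_self_zero:
  assumes "reduced_ring E" "x \<in> carrier E" "x \<otimes>\<^bsub>E\<^esub> x = \<zero>\<^bsub>E\<^esub>"
  shows "x = \<zero>\<^bsub>E\<^esub>"
proof -
  interpret E: cring E using assms(1) by (simp add: reduced_ring_def)
  have "x [^]\<^bsub>E\<^esub> (2::nat) = \<zero>\<^bsub>E\<^esub>"
    using assms(2,3) by (simp add: numeral_2_eq_2)
  then show ?thesis
    using assms(1,2) unfolding reduced_ring_def by blast
qed

lemma contract_Spec:
  assumes "ring_hom_cring A T f" "Q \<in> Spec T"
  shows "contract A f Q \<in> Spec A"
proof -
  interpret ring_hom_cring A T f by fact
  interpret Q: primeideal Q T using assms(2) by (simp add: Spec_iff)
  have I: "ideal (contract A f Q) A"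
    unfolding contract_def by (rule ring.ideal_vimage) (rule Q.is_ideal)
  have "\<one>\<^bsub>T\<^esub> \<notin> Q" using Q.I_notcarr Q.one_imp_carrier by blast
  then have "carrier A \<noteq> contract A f Q"
    unfolding contract_def using R.one_closed hom_one by force
  then show ?thesis
    unfolding Spec_iff using I Q.I_prime
    by (intro primeidealI) (auto simp: contract_def R.is_cring)
qed

lemma contract_comp:
  assumes "f ` carrier A \<subseteq> carrier T"
  shows "contract A f (contract T g Q) = contract A (g \<circ> f) Q"
  using assms by (auto simp: contract_def)

lemma contract_cong:
  "(\<And>a. a \<in> carrier A \<Longrightarrow> f a = g a) \<Longrightarrow> contract A f Q = contract A g Q"
  by (auto simp: contract_def)

lemma primeideal_cancel:
  assumes "Q \<in> Spec T" "s \<in> carrier T" "x \<in> carrier T" "s \<otimes>\<^bsub>T\<^esub> x \<in> Q" "s \<notin> Q"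
  shows "x \<in> Q"
  using assms primeideal.I_prime[of Q T s x] by (auto simp: Spec_iff)

section \<open>Total rings of fractions\<close>

lemma (in cring) nonzerodivisors_closed:
  "s \<in> nonzerodivisors R \<Longrightarrow> s \<in> carrier R"
  by (simp add: nonzerodivisors_def)

lemma (in cring) nonzerodivisors_one: "\<one> \<in> nonzerodivisors R"
  by (simp add: nonzerodivisors_def)

lemma (in cring) nonzerodivisors_mult:
  assumes "s \<in> nonzerodivisors R" "t \<in> nonzerodivisors R"
  shows "s \<otimes> t \<in> nonzerodivisors R"
proof -
  have c: "s \<in> carrier R" "t \<in> carrier R" using assms by (auto simp: nonzerodivisors_def)
  have "a = \<zero>" if "a \<in> carrier R" "s \<otimes> t \<otimes> a = \<zero>" for a
  proof -
    have "s \<otimes> (t \<otimes> a) = \<zero>" using that c by (simp add: m_assoc)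
    then have "t \<otimes> a = \<zero>" using assms(1) that(1) c unfolding nonzerodivisors_def by simp
    then show ?thesis using assms(2) that(1) unfolding nonzerodivisors_def by simp
  qed
  then show ?thesis using c unfolding nonzerodivisors_def by simp
qed

lemma (in cring) nonzerodivisors_cancel:
  assumes "s \<in> nonzerodivisors R" "x \<in> carrier R" "y \<in> carrier R" "s \<otimes> x = s \<otimes> y"
  shows "x = y"
proof -
  have s: "s \<in> carrier R" using assms(1) by (rule nonzerodivisors_closed)
  have "s \<otimes> (x \<ominus> y) = s \<otimes> x \<ominus> s \<otimes> y"
    using s assms(2,3) by (simp add: a_minus_def r_distr r_minus)
  also have "\<dots> = \<zero>" using assms s by simp
  finally have "x \<ominus> y = \<zero>" using assms by (simp add: nonzerodivisors_def)
  then show ?thesis using assms(2,3) by simp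
qed

lemma (in cring) equiv_frac_rel:
  "equiv (carrier R \<times> nonzerodivisors R) (frac_rel R)"
proof (rule equivI)
  show "frac_rel R \<subseteq> (carrier R \<times> nonzerodivisors R) \<times> (carrier R \<times> nonzerodivisors R)"
    by (auto simp: frac_rel_def)
  show "refl_on (carrier R \<times> nonzerodivisors R) (frac_rel R)"
    by (rule refl_onI) (auto simp: frac_rel_def)
  show "sym (frac_rel R)"
    by (rule symI) (auto simp: frac_rel_def)
  show "trans (frac_rel R)"
  proof (rule transI, clarify)
    fix a s b t c u
    assume 1: "((a, s), (b, t)) \<in> frac_rel R" and 2: "((b, t), (c, u)) \<in> frac_rel R"
    then have c: "a \<in> carrier R" "b \<in> carrier R" "c \<in> carrier R"
      "s \<in> carrier R" "t \<in> carrier R" "u \<in> carrier R"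
      and t: "t \<in> nonzerodivisors R" "a \<otimes> t = b \<otimes> s" "b \<otimes> u = c \<otimes> t"
      by (auto simp: frac_rel_def nonzerodivisors_closed)
    have "t \<otimes> (a \<otimes> u) = (a \<otimes> t) \<otimes> u" using c by algebra
    also have "\<dots> = (b \<otimes> u) \<otimes> s" using c unfolding t(2) by algebra
    also have "\<dots> = t \<otimes> (c \<otimes> s)" using c unfolding t(3) by algebra
    finally have "a \<otimes> u = c \<otimes> s"
      using nonzerodivisors_cancel[OF t(1)] c by simp
    with 1 2 show "((a, s), (c, u)) \<in> frac_rel R"
      by (auto simp: frac_rel_def)
  qed
qed

lemma (in cring) fraction_eq_iff:
  assumes "a \<in> carrier R" "s \<in> nonzerodivisors R" "b \<in> carrier R" "t \<in> nonzerodivisors R"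
  shows "fraction R a s = fraction R b t \<longleftrightarrow> a \<otimes> t = b \<otimes> s"
proof -
  have "fraction R a s = fraction R b t \<longleftrightarrow> ((a, s), (b, t)) \<in> frac_rel R"
    unfolding fraction_def by (rule eq_equiv_class_iff[OF equiv_frac_rel]) (use assms in auto)
  then show ?thesis
    using assms by (auto simp: frac_rel_def)
qed

lemma (in cring) fraction_closed:
  assumes "a \<in> carrier R" "s \<in> nonzerodivisors R"
  shows "fraction R a s \<in> carrier (total_fractions R)"
  unfolding total_fractions_def fraction_def using assms by (auto intro: quotientI)

lemma (in cring) fraction_cases:
  assumes "x \<in> carrier (total_fractions R)"
  obtains a s where "a \<in> carrier R" "s \<in> nonzerodivisors R" "x = fraction R a s"
  using assms unfolding total_fractions_def fraction_def by (auto elim!: quotientE)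

lemma (in cring) mem_fraction:
  assumes "a \<in> carrier R" "s \<in> nonzerodivisors R" "(b, t) \<in> fraction R a s"
  shows "b \<in> carrier R" "t \<in> nonzerodivisors R" "fraction R b t = fraction R a s"
proof -
  have *: "((a, s), (b, t)) \<in> frac_rel R" using assms(3) by (simp add: fraction_def)
  then show "b \<in> carrier R" "t \<in> nonzerodivisors R" by (auto simp: frac_rel_def)
  show "fraction R b t = fraction R a s"
    using equiv_class_eq[OF equiv_frac_rel *] by (simp add: fraction_def)
qed

lemma (in cring) fraction_self:
  assumes "a \<in> carrier R" "s \<in> nonzerodivisors R"
  shows "(a, s) \<in> fraction R a s"
  using assms by (auto simp: fraction_def frac_rel_def)

text \<open>The operations of \<open>total_fractions\<close> are unions over all representatives; they are evaluated
  by showing that all representatives contribute the same class.\<close>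

lemma UN_const_eqI:
  assumes "p \<in> A" "\<And>q. q \<in> A \<Longrightarrow> f q = c"
  shows "(\<Union>q\<in>A. f q) = c"
  using assms by auto

lemma (in cring) fraction_mult:
  assumes a: "a \<in> carrier R" "s \<in> nonzerodivisors R" and b: "b \<in> carrier R" "t \<in> nonzerodivisors R"
  shows "fraction R a s \<otimes>\<^bsub>total_fractions R\<^esub> fraction R b t = fraction R (a \<otimes> b) (s \<otimes> t)"
proof -
  have "fraction R (a' \<otimes> b') (s' \<otimes> t') = fraction R (a \<otimes> b) (s \<otimes> t)"
    if "(a', s') \<in> fraction R a s" "(b', t') \<in> fraction R b t" for a' s' b' t'
  proof -
    note 1 = mem_fraction[OF a that(1)] and 2 = mem_fraction[OF b that(2)]
    note c = a b 1(1,2) 2(1,2)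
    have e: "a' \<otimes> s = a \<otimes> s'" "b' \<otimes> t = b \<otimes> t'"
      using 1(3) 2(3) c by (simp_all add: fraction_eq_iff)
    have "(a' \<otimes> b') \<otimes> (s \<otimes> t) = (a' \<otimes> s) \<otimes> (b' \<otimes> t)"
      using c by (simp add: m_ac nonzerodivisors_closed)
    also have "\<dots> = (a \<otimes> b) \<otimes> (s' \<otimes> t')"
      unfolding e using c by (simp add: m_ac nonzerodivisors_closed)
    finally show ?thesis
      using c by (simp add: fraction_eq_iff nonzerodivisors_mult)
  qed
  then show ?thesis
    unfolding total_fractions_def
    by (auto intro!: UN_const_eqI[OF fraction_self[OF a]] UN_const_eqI[OF fraction_self[OF b]])
qed

lemma (in cring) fraction_add:
  assumes a: "a \<in> carrier R" "s \<in> nonzerodivisors R" and b: "b \<in> carrier R" "t \<in> nonzerodivisors R"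
  shows "fraction R a s \<oplus>\<^bsub>total_fractions R\<^esub> fraction R b t
    = fraction R (a \<otimes> t \<oplus> b \<otimes> s) (s \<otimes> t)"
proof -
  have "fraction R (a' \<otimes> t' \<oplus> b' \<otimes> s') (s' \<otimes> t') = fraction R (a \<otimes> t \<oplus> b \<otimes> s) (s \<otimes> t)"
    if "(a', s') \<in> fraction R a s" "(b', t') \<in> fraction R b t" for a' s' b' t'
  proof -
    note 1 = mem_fraction[OF a that(1)] and 2 = mem_fraction[OF b that(2)]
    note c = a b 1(1,2) 2(1,2)
    note cc = a(1) b(1) 1(1) 2(1) nonzerodivisors_closed[OF a(2)] nonzerodivisors_closed[OF b(2)]
      nonzerodivisors_closed[OF 1(2)] nonzerodivisors_closed[OF 2(2)]
    have e: "a' \<otimes> s = a \<otimes> s'" "b' \<otimes> t = b \<otimes> t'"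
      using 1(3) 2(3) c by (simp_all add: fraction_eq_iff)
    have "(a' \<otimes> t' \<oplus> b' \<otimes> s') \<otimes> (s \<otimes> t) = (a' \<otimes> s) \<otimes> (t' \<otimes> t) \<oplus> (b' \<otimes> t) \<otimes> (s' \<otimes> s)"
      using cc by algebra
    also have "\<dots> = (a \<otimes> t \<oplus> b \<otimes> s) \<otimes> (s' \<otimes> t')"
      unfolding e using cc by algebra
    finally show ?thesis
      using c cc by (simp add: fraction_eq_iff nonzerodivisors_mult)
  qed
  then show ?thesis
    unfolding total_fractions_def
    by (auto intro!: UN_const_eqI[OF fraction_self[OF a]] UN_const_eqI[OF fraction_self[OF b]])
qed

lemma total_fractions_one: "\<one>\<^bsub>total_fractions R\<^esub> = fraction R \<one>\<^bsub>R\<^esub> \<one>\<^bsub>R\<^esub>"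
  and total_fractions_zero: "\<zero>\<^bsub>total_fractions R\<^esub> = fraction R \<zero>\<^bsub>R\<^esub> \<one>\<^bsub>R\<^esub>"
  by (simp_all add: total_fractions_def)

lemma (in cring) total_fractions_cring: "cring (total_fractions R)"
proof -
  let ?Q = "total_fractions R"
  note simps = fraction_mult fraction_add fraction_closed fraction_eq_iff
    nonzerodivisors_mult nonzerodivisors_one total_fractions_one total_fractions_zero
    nonzerodivisors_closed
  note closed = nonzerodivisors_closed
  show ?thesis
  proof (rule cringI)
    show "abelian_group ?Q"
    proof (rule abelian_groupI)
      fix x y assume "x \<in> carrier ?Q" "y \<in> carrier ?Q"
      then obtain a s b t where *: "a \<in> carrier R" "s \<in> nonzerodivisors R" "x = fraction R a s"
        "b \<in> carrier R" "t \<in> nonzerodivisors R" "y = fraction R b t"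
        by (metis fraction_cases)
      note c = *(1,4) *(2,5)[THEN closed]
      show "x \<oplus>\<^bsub>?Q\<^esub> y \<in> carrier ?Q"
        using * by (simp add: simps)
      have "a \<otimes> t \<oplus> b \<otimes> s = b \<otimes> s \<oplus> a \<otimes> t" "s \<otimes> t = t \<otimes> s" using c by algebra+
      then show "x \<oplus>\<^bsub>?Q\<^esub> y = y \<oplus>\<^bsub>?Q\<^esub> x"
        using * by (simp add: simps)
      fix z assume "z \<in> carrier ?Q"
      then obtain d u where z: "d \<in> carrier R" "u \<in> nonzerodivisors R" "z = fraction R d u"
        by (metis fraction_cases)
      have "((a \<otimes> t \<oplus> b \<otimes> s) \<otimes> u \<oplus> d \<otimes> (s \<otimes> t)) = (a \<otimes> (t \<otimes> u) \<oplus> (b \<otimes> u \<oplus> d \<otimes> t) \<otimes> s)"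
        "s \<otimes> t \<otimes> u = s \<otimes> (t \<otimes> u)"
        using c z(1) closed[OF z(2)] by algebra+
      then show "x \<oplus>\<^bsub>?Q\<^esub> y \<oplus>\<^bsub>?Q\<^esub> z = x \<oplus>\<^bsub>?Q\<^esub> (y \<oplus>\<^bsub>?Q\<^esub> z)"
        using * z by (simp add: simps)
    next
      show "\<zero>\<^bsub>?Q\<^esub> \<in> carrier ?Q" by (simp add: simps)
    next
      fix x assume "x \<in> carrier ?Q"
      then obtain a s where *: "a \<in> carrier R" "s \<in> nonzerodivisors R" "x = fraction R a s"
        by (metis fraction_cases)
      note c = *(1) *(2)[THEN closed]
      show "\<zero>\<^bsub>?Q\<^esub> \<oplus>\<^bsub>?Q\<^esub> x = x"
        using * c by (simp add: simps)
      have "fraction R (\<ominus> a) s \<oplus>\<^bsub>?Q\<^esub> x = \<zero>\<^bsub>?Q\<^esub>"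
        using * c by (simp add: simps l_minus l_neg)
      then show "\<exists>y\<in>carrier ?Q. y \<oplus>\<^bsub>?Q\<^esub> x = \<zero>\<^bsub>?Q\<^esub>"
        using * by (intro bexI[of _ "fraction R (\<ominus> a) s"]) (simp_all add: simps)
    qed
    show "Group.comm_monoid ?Q"
    proof (rule comm_monoidI)
      fix x y assume "x \<in> carrier ?Q" "y \<in> carrier ?Q"
      then obtain a s b t where *: "a \<in> carrier R" "s \<in> nonzerodivisors R" "x = fraction R a s"
        "b \<in> carrier R" "t \<in> nonzerodivisors R" "y = fraction R b t"
        by (metis fraction_cases)
      note c = *(1,4) *(2,5)[THEN closed]
      show "x \<otimes>\<^bsub>?Q\<^esub> y \<in> carrier ?Q"
        using * by (simp add: simps)
      show "x \<otimes>\<^bsub>?Q\<^esub> y = y \<otimes>\<^bsub>?Q\<^esub> x"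
        using * c by (simp add: simps m_ac)
      fix z assume "z \<in> carrier ?Q"
      then obtain d u where z: "d \<in> carrier R" "u \<in> nonzerodivisors R" "z = fraction R d u"
        by (metis fraction_cases)
      show "x \<otimes>\<^bsub>?Q\<^esub> y \<otimes>\<^bsub>?Q\<^esub> z = x \<otimes>\<^bsub>?Q\<^esub> (y \<otimes>\<^bsub>?Q\<^esub> z)"
        using * z by (simp add: simps m_ac)
    next
      show "\<one>\<^bsub>?Q\<^esub> \<in> carrier ?Q" by (simp add: simps)
    next
      fix x assume "x \<in> carrier ?Q"
      then obtain a s where *: "a \<in> carrier R" "s \<in> nonzerodivisors R" "x = fraction R a s"
        by (metis fraction_cases)
      then show "\<one>\<^bsub>?Q\<^esub> \<otimes>\<^bsub>?Q\<^esub> x = x"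
        by (simp add: simps)
    qed
    fix x y z assume "x \<in> carrier ?Q" "y \<in> carrier ?Q" "z \<in> carrier ?Q"
    then obtain a s b t d u where *: "a \<in> carrier R" "s \<in> nonzerodivisors R" "x = fraction R a s"
        "b \<in> carrier R" "t \<in> nonzerodivisors R" "y = fraction R b t"
        "d \<in> carrier R" "u \<in> nonzerodivisors R" "z = fraction R d u"
      by (metis fraction_cases)
    note c = *(1,4,7) *(2,5,8)[THEN closed]
    have "(a \<otimes> t \<oplus> b \<otimes> s) \<otimes> d \<otimes> (s \<otimes> u \<otimes> (t \<otimes> u))
      = ((a \<otimes> d) \<otimes> (t \<otimes> u) \<oplus> (b \<otimes> d) \<otimes> (s \<otimes> u)) \<otimes> (s \<otimes> t \<otimes> u)"
      using c by algebra
    then show "(x \<oplus>\<^bsub>?Q\<^esub> y) \<otimes>\<^bsub>?Q\<^esub> z = x \<otimes>\<^bsub>?Q\<^esub> z \<oplus>\<^bsub>?Q\<^esub> y \<otimes>\<^bsub>?Q\<^esub> z"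
      using * by (simp add: simps)
  qed
qed

lemma (in cring) to_frac_hom: "ring_hom_cring R (total_fractions R) (to_frac R)"
proof -
  interpret Q: cring "total_fractions R" by (rule total_fractions_cring)
  show ?thesis
    by unfold_locales (auto intro!: ring_hom_memI
        simp: to_frac_def fraction_mult fraction_add fraction_closed nonzerodivisors_one total_fractions_one)
qed

lemma (in cring) to_frac_inj: "inj_on (to_frac R) (carrier R)"
  by (rule inj_onI) (simp add: to_frac_def fraction_eq_iff nonzerodivisors_one)

lemma (in cring) to_frac_zero_iff:
  "a \<in> carrier R \<Longrightarrow> to_frac R a = \<zero>\<^bsub>total_fractions R\<^esub> \<longleftrightarrow> a = \<zero>"
  by (simp add: to_frac_def fraction_eq_iff nonzerodivisors_one total_fractions_zero)

lemma (in cring) to_frac_mult_fraction: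
  assumes "a \<in> carrier R" "s \<in> nonzerodivisors R"
  shows "to_frac R s \<otimes>\<^bsub>total_fractions R\<^esub> fraction R a s = to_frac R a"
  using assms by (simp add: to_frac_def fraction_mult nonzerodivisors_one nonzerodivisors_closed
      fraction_eq_iff m_ac)

lemma reduced_total_fractions:
  fixes R (structure)
  assumes "reduced_ring R"
  shows "reduced_ring (total_fractions R)"
proof -
  interpret cring R using assms by (simp add: reduced_ring_def)
  let ?Q = "total_fractions R"
  interpret Q: ring_hom_cring R ?Q "to_frac R" by (rule to_frac_hom)
  have "x = \<zero>\<^bsub>?Q\<^esub>" if x: "x \<in> carrier ?Q" "x [^]\<^bsub>?Q\<^esub> (n::nat) = \<zero>\<^bsub>?Q\<^esub>" for x n
  proof -
    obtain a s where *: "a \<in> carrier R" "s \<in> nonzerodivisors R" "x = fraction R a s"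
      using x(1) by (rule fraction_cases)
    have a: "to_frac R a = to_frac R s \<otimes>\<^bsub>?Q\<^esub> x"
      using * by (simp add: to_frac_mult_fraction)
    have "to_frac R (a [^] n) = to_frac R s [^]\<^bsub>?Q\<^esub> n \<otimes>\<^bsub>?Q\<^esub> x [^]\<^bsub>?Q\<^esub> n"
      using * x by (simp add: Q.ring.hom_nat_pow a Q.S.nat_pow_distrib nonzerodivisors_closed)
    then have "a [^] n = \<zero>"
      using x * to_frac_zero_iff[of "a [^] n"] by (simp del: Q.ring.hom_nat_pow add: nonzerodivisors_closed)
    then have "a = \<zero>" using assms * by (auto simp: reduced_ring_def)
    then show ?thesis
      using * by (simp add: fraction_eq_iff total_fractions_zero nonzerodivisors_one nonzerodivisors_closed)
  qed
  then show ?thesis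
    using total_fractions_cring by (auto simp: reduced_ring_def)
qed

section \<open>Integral elements\<close>

locale cring_with_subring = cring +
  fixes K
  assumes K: "subring K R"
begin

lemmas K_subset = subringE(1)[OF K]
  and K_zero = subringE(2)[OF K]
  and K_one = subringE(3)[OF K]
  and K_neg = subringE(5)[OF K]
  and K_mult = subringE(6)[OF K]
  and K_add = subringE(7)[OF K]

lemma K_carrier: "a \<in> K \<Longrightarrow> a \<in> carrier R"
  using K_subset by blast

definition lincombs :: "'i set \<Rightarrow> ('i \<Rightarrow> 'a) \<Rightarrow> 'a set" where
  "lincombs I m = {\<Oplus>i\<in>I. c i \<otimes> m i | c. c \<in> I \<rightarrow> K}"

context
  fixes I :: "'i set" and m
  assumes I: "finite I" and m: "m \<in> I \<rightarrow> carrier R"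
begin

lemma lincombs_carrier: "u \<in> lincombs I m \<Longrightarrow> u \<in> carrier R"
  using m K_carrier by (auto simp: lincombs_def Pi_iff intro!: finsum_closed)

lemma lincombs_add:
  assumes "u \<in> lincombs I m" "v \<in> lincombs I m"
  shows "u \<oplus> v \<in> lincombs I m"
proof -
  obtain c d where c: "c \<in> I \<rightarrow> K" "u = (\<Oplus>i\<in>I. c i \<otimes> m i)"
    and d: "d \<in> I \<rightarrow> K" "v = (\<Oplus>i\<in>I. d i \<otimes> m i)"
    using assms by (auto simp: lincombs_def)
  have "u \<oplus> v = (\<Oplus>i\<in>I. c i \<otimes> m i \<oplus> d i \<otimes> m i)"
    unfolding c d using c(1) d(1) m K_carrier by (intro finsum_addf[symmetric]) (auto simp: Pi_iff)
  also have "\<dots> = (\<Oplus>i\<in>I. (c i \<oplus> d i) \<otimes> m i)"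
    using c(1) d(1) m K_carrier by (intro finsum_cong') (auto simp: Pi_iff l_distr)
  finally show ?thesis
    using c(1) d(1) K_add unfolding lincombs_def by (intro CollectI exI[of _ "\<lambda>i. c i \<oplus> d i"]) auto
qed

lemma lincombs_smult:
  assumes "a \<in> K" "u \<in> lincombs I m"
  shows "a \<otimes> u \<in> lincombs I m"
proof -
  obtain c where c: "c \<in> I \<rightarrow> K" "u = (\<Oplus>i\<in>I. c i \<otimes> m i)"
    using assms by (auto simp: lincombs_def)
  have "a \<otimes> u = (\<Oplus>i\<in>I. a \<otimes> (c i \<otimes> m i))"
    unfolding c using c(1) m K_carrier assms(1) I by (intro finsum_rdistr) (auto simp: Pi_iff)
  also have "\<dots> = (\<Oplus>i\<in>I. (a \<otimes> c i) \<otimes> m i)"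
    using c(1) m K_carrier assms(1) by (intro finsum_cong') (auto simp: Pi_iff m_assoc)
  finally show ?thesis
    using c(1) assms(1) K_mult unfolding lincombs_def
    by (intro CollectI exI[of _ "\<lambda>i. a \<otimes> c i"]) auto
qed

lemma lincombs_zero: "\<zero> \<in> lincombs I m"
proof -
  have "(\<Oplus>i\<in>I. \<zero> \<otimes> m i) = (\<Oplus>i\<in>I. \<zero>)"
    using m by (intro finsum_cong') (auto simp: Pi_iff)
  then show ?thesis
    unfolding lincombs_def using K_zero by (intro CollectI exI[of _ "\<lambda>_. \<zero>"]) auto
qed

lemma lincombs_gen:
  assumes "k \<in> I"
  shows "m k \<in> lincombs I m"
proof -
  have "(\<Oplus>i\<in>I. (if k = i then \<one> else \<zero>) \<otimes> m i) = (\<Oplus>i\<in>I. if k = i then m i else \<zero>)"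
    using m by (intro finsum_cong') (auto simp: Pi_iff)
  also have "\<dots> = m k"
    using assms I m by (intro add.finprod_singleton) auto
  finally show ?thesis
    unfolding lincombs_def using K_zero K_one
    by (intro CollectI exI[of _ "\<lambda>i. if k = i then \<one> else \<zero>"]) auto
qed

lemma lincombs_finsum:
  assumes "finite A" "f \<in> A \<rightarrow> lincombs I m"
  shows "(\<Oplus>i\<in>A. f i) \<in> lincombs I m"
  using assms
proof (induction A rule: finite_induct)
  case (insert k A)
  then have "(\<Oplus>i\<in>insert k A. f i) = f k \<oplus> (\<Oplus>i\<in>A. f i)"
    using lincombs_carrier by (intro finsum_insert) (auto simp: Pi_iff)
  then show ?case using insert lincombs_add by auto
qed (simp add: lincombs_zero)

lemma lincombs_neg:
  assumes "u \<in> lincombs I m"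
  shows "\<ominus> u \<in> lincombs I m"
proof -
  have "\<ominus> u = (\<ominus> \<one>) \<otimes> u" using lincombs_carrier[OF assms] by (simp add: l_minus)
  then show ?thesis using lincombs_smult[OF K_neg[OF K_one] assms] by simp
qed

end

text \<open>Products of linear combinations are controlled by products of generators.  This gives both the
  degree bounds for polynomial values and the stability of the module spanned by monomials in two
  integral elements.\<close>

lemma lincombs_mult_mem:
  assumes I: "finite I" "m \<in> I \<rightarrow> carrier R" and I': "finite I'" "m' \<in> I' \<rightarrow> carrier R"
    and z: "z \<in> carrier R" "\<And>i. i \<in> I \<Longrightarrow> z \<otimes> m i \<in> lincombs I' m'"
    and u: "u \<in> lincombs I m"
  shows "z \<otimes> u \<in> lincombs I' m'"
proof -
  obtain c where c: "c \<in> I \<rightarrow> K" "u = (\<Oplus>i\<in>I. c i \<otimes> m i)"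
    using u by (auto simp: lincombs_def)
  have "z \<otimes> u = (\<Oplus>i\<in>I. z \<otimes> (c i \<otimes> m i))"
    unfolding c using c(1) I K_carrier z(1) by (intro finsum_rdistr) (auto simp: Pi_iff)
  also have "\<dots> = (\<Oplus>i\<in>I. c i \<otimes> (z \<otimes> m i))"
    using c(1) I K_carrier z(1) by (intro finsum_cong') (auto simp: Pi_iff m_lcomm)
  also have "\<dots> \<in> lincombs I' m'"
    using c(1) z(2) lincombs_smult[OF I'] by (intro lincombs_finsum[OF I' I(1)]) (auto simp: Pi_iff)
  finally show ?thesis .
qed

text \<open>Values at \<open>x\<close> of polynomials of degree below \<open>d\<close> with coefficients in \<open>K\<close>, and of monic
  polynomials of degree \<open>d\<close>.\<close>

definition poly_values :: "'a \<Rightarrow> nat \<Rightarrow> 'a set" where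
  "poly_values x d = lincombs {..<d} (\<lambda>i. x [^] i)"

definition monic_values :: "'a \<Rightarrow> nat \<Rightarrow> 'a set" where
  "monic_values x d = {x [^] d \<oplus> v | v. v \<in> poly_values x d}"

context
  fixes x assumes x: "x \<in> carrier R"
begin

lemma powers_Pi: "(\<lambda>i::nat. x [^] i) \<in> I \<rightarrow> carrier R"
  using x by simp

lemmas poly_values_carrier = lincombs_carrier[OF finite_lessThan powers_Pi, folded poly_values_def]
  and poly_values_zero = lincombs_zero[OF finite_lessThan powers_Pi, folded poly_values_def]
  and poly_values_add = lincombs_add[OF finite_lessThan powers_Pi, folded poly_values_def]
  and poly_values_smult = lincombs_smult[OF finite_lessThan powers_Pi, folded poly_values_def]
  and poly_values_neg = lincombs_neg[OF finite_lessThan powers_Pi, folded poly_values_def]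

lemma poly_values_pow: "i < d \<Longrightarrow> x [^] i \<in> poly_values x d"
  unfolding poly_values_def using lincombs_gen[OF finite_lessThan powers_Pi, of i d] by simp

lemma poly_values_mult_mem:
  assumes "finite I" "m \<in> I \<rightarrow> carrier R" "z \<in> carrier R"
    and "\<And>i. i < d \<Longrightarrow> z \<otimes> x [^] i \<in> lincombs I m" and "u \<in> poly_values x d"
  shows "z \<otimes> u \<in> lincombs I m"
  by (rule lincombs_mult_mem[OF finite_lessThan powers_Pi assms(1-3) _ assms(5)[unfolded poly_values_def]])
    (simp add: assms(4))

lemma poly_values_mult_pow:
  assumes "u \<in> poly_values x d" "n + d \<le> e"
  shows "x [^] n \<otimes> u \<in> poly_values x e"
  unfolding poly_values_def
proof (rule poly_values_mult_mem[OF finite_lessThan powers_Pi _ _ assms(1)])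
  fix i assume "i < d"
  then show "x [^] n \<otimes> x [^] i \<in> lincombs {..<e} (\<lambda>i. x [^] i)"
    using poly_values_pow[of "n + i" e] assms(2) x by (simp add: nat_pow_mult poly_values_def)
qed (use x in simp)

lemma poly_values_mult:
  assumes u: "u \<in> poly_values x d" and v: "v \<in> poly_values x e"
  shows "u \<otimes> v \<in> poly_values x (d + e)"
  unfolding poly_values_def
proof (rule poly_values_mult_mem[OF finite_lessThan powers_Pi _ _ v])
  fix i assume "i < e"
  then show "u \<otimes> x [^] i \<in> lincombs {..<d + e} (\<lambda>i. x [^] i)"
    using poly_values_mult_pow[OF u, of i "d + e"] poly_values_carrier[OF u] x
    by (simp add: m_comm poly_values_def)
qed (use u poly_values_carrier in simp)

lemma eval_in_poly_values: "set p \<subseteq> K \<Longrightarrow> eval p x \<in> poly_values x (length p)"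
proof (induction p)
  case (Cons a p)
  then have a: "a \<in> K" and IH: "eval p x \<in> poly_values x (length p)" by auto
  have "a \<otimes> x [^] length p \<oplus> eval p x \<in> poly_values x (length (a # p))"
    using poly_values_mult_pow[OF IH, of 0 "Suc (length p)"] poly_values_carrier[OF IH]
    by (intro poly_values_add poly_values_smult[OF a] poly_values_pow) simp_all
  then show ?case by simp
qed (use poly_values_zero in simp)

lemma poly_values_eval: "u \<in> poly_values x d \<Longrightarrow> \<exists>p. set p \<subseteq> K \<and> length p = d \<and> u = eval p x"
proof (induction d arbitrary: u)
  case 0
  then show ?case by (auto simp: poly_values_def lincombs_def)
next
  case (Suc d)
  then obtain c where c: "c \<in> {..<Suc d} \<rightarrow> K" "u = (\<Oplus>i\<in>{..<Suc d}. c i \<otimes> x [^] i)"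
    by (auto simp: poly_values_def lincombs_def)
  let ?v = "\<Oplus>i\<in>{..<d}. c i \<otimes> x [^] i"
  have cK: "c \<in> {..<d} \<rightarrow> K" "c d \<in> K" using c(1) by (auto simp: Pi_iff)
  then have "?v \<in> poly_values x d" by (auto simp: poly_values_def lincombs_def)
  from Suc.IH[OF this] obtain p where p: "set p \<subseteq> K" "length p = d" "?v = eval p x" by blast
  have "u = c d \<otimes> x [^] d \<oplus> ?v"
    unfolding c(2) lessThan_Suc using cK K_carrier x by (intro finsum_insert) (auto simp: Pi_iff)
  then show ?case using p cK(2) by (intro exI[of _ "c d # p"]) simp
qed

lemma integral_over_iff: "integral_over R K x \<longleftrightarrow> (\<exists>d. \<zero> \<in> monic_values x d)"
proof
  assume "integral_over R K x"
  then obtain p where "set p \<subseteq> K" "x [^] length p \<oplus> eval p x = \<zero>"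
    using x by (auto simp: integral_over_def)
  then have "\<zero> \<in> monic_values x (length p)"
    unfolding monic_values_def using eval_in_poly_values[of p]
    by (intro CollectI exI[of _ "eval p x"]) simp
  then show "\<exists>d. \<zero> \<in> monic_values x d" by blast
next
  assume "\<exists>d. \<zero> \<in> monic_values x d"
  then obtain d v where v: "v \<in> poly_values x d" "\<zero> = x [^] d \<oplus> v" by (auto simp: monic_values_def)
  obtain p where "set p \<subseteq> K" "length p = d" "v = eval p x" using poly_values_eval[OF v(1)] by blast
  then show "integral_over R K x"
    unfolding integral_over_def using v(2) x by (intro exI[of _ p]) simp
qed

lemma monic_values_carrier: "u \<in> monic_values x d \<Longrightarrow> u \<in> carrier R"
  using x poly_values_carrier by (auto simp: monic_values_def)

lemma monic_values_mult_poly_values: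
  assumes "u \<in> monic_values x d" "v \<in> poly_values x e"
  shows "u \<otimes> v \<in> poly_values x (d + e)"
proof -
  obtain w where w: "w \<in> poly_values x d" "u = x [^] d \<oplus> w"
    using assms(1) by (auto simp: monic_values_def)
  have "u \<otimes> v = x [^] d \<otimes> v \<oplus> w \<otimes> v"
    using w x poly_values_carrier assms(2) by (simp add: l_distr)
  then show ?thesis
    using poly_values_add poly_values_mult_pow[OF assms(2), of d] poly_values_mult w(1) assms(2) by simp
qed

lemma monic_values_add_poly_values:
  assumes "u \<in> monic_values x d" "v \<in> poly_values x d"
  shows "u \<oplus> v \<in> monic_values x d"
proof -
  obtain w where w: "w \<in> poly_values x d" "u = x [^] d \<oplus> w"
    using assms(1) by (auto simp: monic_values_def)
  have "u \<oplus> v = x [^] d \<oplus> (w \<oplus> v)"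
    using w x poly_values_carrier assms(2) by (simp add: a_assoc)
  then show ?thesis
    using poly_values_add[OF w(1) assms(2)] by (auto simp: monic_values_def)
qed

lemma monic_values_mult:
  assumes "u \<in> monic_values x d" "v \<in> monic_values x e"
  shows "u \<otimes> v \<in> monic_values x (d + e)"
proof -
  obtain w where w: "w \<in> poly_values x e" "v = x [^] e \<oplus> w"
    using assms(2) by (auto simp: monic_values_def)
  obtain t where t: "t \<in> poly_values x d" "u = x [^] d \<oplus> t"
    using assms(1) by (auto simp: monic_values_def)
  have "u \<otimes> v = (x [^] (d + e) \<oplus> x [^] e \<otimes> t) \<oplus> u \<otimes> w"
    using w t x monic_values_carrier[OF assms(1)] poly_values_carrier[OF t(1)] poly_values_carrier[OF w(1)]
    by (simp add: l_distr r_distr nat_pow_mult[symmetric] m_ac a_ac)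
  moreover have "x [^] (d + e) \<oplus> x [^] e \<otimes> t \<in> monic_values x (d + e)"
    using poly_values_mult_pow[OF t(1), of e "d + e"] by (auto simp: monic_values_def add.commute)
  ultimately show ?thesis
    using monic_values_add_poly_values monic_values_mult_poly_values[OF assms(1) w(1)] by simp
qed

text \<open>Gaussian elimination without division, in place of the determinant of the Cayley--Hamilton
  argument.  A homogeneous linear system whose diagonal entries are values of monic polynomials of
  degree \<open>d\<close> and whose other entries have smaller degree keeps this shape when an unknown is
  eliminated by cross-multiplication, with \<open>d + d\<close> in place of \<open>d\<close>.\<close>

lemma monic_system_annihilator:
  assumes "finite I" "m \<in> I \<rightarrow> carrier R"
    and "\<And>i. i \<in> I \<Longrightarrow> P i i \<in> monic_values x d"
    and "\<And>i j. i \<in> I \<Longrightarrow> j \<in> I \<Longrightarrow> i \<noteq> j \<Longrightarrow> P i j \<in> poly_values x d"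
    and "\<And>i. i \<in> I \<Longrightarrow> (\<Oplus>j\<in>I. P i j \<otimes> m j) = \<zero>"
  shows "\<exists>e. \<exists>w\<in>monic_values x e. \<forall>i\<in>I. w \<otimes> m i = \<zero>"
  using assms
proof (induction I arbitrary: P d rule: finite_induct)
  case empty
  have "x [^] (0::nat) \<oplus> \<zero> \<in> monic_values x 0"
    unfolding monic_values_def using poly_values_zero by blast
  then show ?case by blast
next
  case (insert k I)
  note m = insert.prems(1) and diag = insert.prems(2) and off = insert.prems(3)
    and eq = insert.prems(4)
  have mk: "m k \<in> carrier R" and mI: "m \<in> I \<rightarrow> carrier R" using m by auto
  have Pc: "P i j \<in> carrier R" if "i \<in> insert k I" "j \<in> insert k I" for i j
    using that diag[of i] off[of i j] monic_values_carrier poly_values_carrier by (cases "i = j") auto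
  define s where "s i = (\<Oplus>j\<in>I. P i j \<otimes> m j)" for i
  have sc: "s i \<in> carrier R" if "i \<in> insert k I" for i
    unfolding s_def using that Pc mI by (intro finsum_closed) auto
  have s: "P i k \<otimes> m k \<oplus> s i = \<zero>" if "i \<in> insert k I" for i
    using eq[OF that] insert.hyps that Pc mI mk unfolding s_def
    by (subst (asm) finsum_insert) (auto simp: Pi_iff)
  define P' where "P' i j = P k k \<otimes> P i j \<ominus> P i k \<otimes> P k j" for i j
  have P'c: "P' i j \<in> carrier R" if "i \<in> I" "j \<in> I" for i j
    using that Pc unfolding P'_def by simp
  have "\<exists>e. \<exists>w\<in>monic_values x e. \<forall>i\<in>I. w \<otimes> m i = \<zero>"
  proof (rule insert.IH[of P' "d + d"])
    show "m \<in> I \<rightarrow> carrier R" by fact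
  next
    fix i assume i: "i \<in> I"
    then have "i \<noteq> k" using insert.hyps by blast
    then have "P i k \<otimes> P k i \<in> poly_values x (d + d)"
      using i off by (intro poly_values_mult) auto
    then show "P' i i \<in> monic_values x (d + d)"
      unfolding P'_def a_minus_def using i diag
      by (intro monic_values_add_poly_values monic_values_mult poly_values_neg) auto
  next
    fix i j assume ij: "i \<in> I" "j \<in> I" "i \<noteq> j"
    then have "i \<noteq> k" "j \<noteq> k" using insert.hyps by blast+
    then have "P i k \<otimes> P k j \<in> poly_values x (d + d)"
      using ij off by (intro poly_values_mult) auto
    then show "P' i j \<in> poly_values x (d + d)"
      unfolding P'_def a_minus_def
      using ij monic_values_mult_poly_values[OF diag[of k] off[of i j]]
      by (intro poly_values_add poly_values_neg) auto
  next
    fix i assume i: "i \<in> I"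
    have "(\<Oplus>j\<in>I. P' i j \<otimes> m j)
        = (\<Oplus>j\<in>I. P k k \<otimes> (P i j \<otimes> m j) \<oplus> (\<ominus> P i k) \<otimes> (P k j \<otimes> m j))"
    proof (rule finsum_cong')
      fix j assume j: "j \<in> I"
      then have c: "P k k \<in> carrier R" "P i j \<in> carrier R" "P i k \<in> carrier R" "P k j \<in> carrier R" "m j \<in> carrier R"
        using i Pc mI by auto
      then show "P' i j \<otimes> m j = P k k \<otimes> (P i j \<otimes> m j) \<oplus> (\<ominus> P i k) \<otimes> (P k j \<otimes> m j)"
        unfolding P'_def by algebra
    qed (use i Pc mI in \<open>auto simp: Pi_iff\<close>)
    also have "\<dots> = (\<Oplus>j\<in>I. P k k \<otimes> (P i j \<otimes> m j)) \<oplus> (\<Oplus>j\<in>I. (\<ominus> P i k) \<otimes> (P k j \<otimes> m j))"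
      using i Pc mI by (intro finsum_addf) (auto simp: Pi_iff)
    also have "(\<Oplus>j\<in>I. P k k \<otimes> (P i j \<otimes> m j)) = P k k \<otimes> s i"
      unfolding s_def using i Pc mI insert.hyps by (intro finsum_rdistr[symmetric]) (auto simp: Pi_iff)
    also have "(\<Oplus>j\<in>I. (\<ominus> P i k) \<otimes> (P k j \<otimes> m j)) = (\<ominus> P i k) \<otimes> s k"
      unfolding s_def using i Pc mI insert.hyps by (intro finsum_rdistr[symmetric]) (auto simp: Pi_iff)
    also have "P k k \<otimes> s i \<oplus> (\<ominus> P i k) \<otimes> s k
        = P k k \<otimes> (P i k \<otimes> m k \<oplus> s i) \<ominus> P i k \<otimes> (P k k \<otimes> m k \<oplus> s k)"
    proof -
      have "P k k \<in> carrier R" "P i k \<in> carrier R" "s i \<in> carrier R" "s k \<in> carrier R" 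
        using i Pc sc by auto
      with mk show ?thesis by algebra
    qed
    also have "\<dots> = \<zero>"
      using s i Pc by simp
    finally show "(\<Oplus>j\<in>I. P' i j \<otimes> m j) = \<zero>" .
  qed
  then obtain e w where w: "w \<in> monic_values x e" "\<And>i. i \<in> I \<Longrightarrow> w \<otimes> m i = \<zero>"
    by blast
  have wc: "w \<in> carrier R" using w(1) by (rule monic_values_carrier)
  have kk: "P k k \<in> carrier R" using Pc by simp
  have "w \<otimes> s k = (\<Oplus>j\<in>I. w \<otimes> (P k j \<otimes> m j))"
    unfolding s_def using Pc mI insert.hyps wc by (intro finsum_rdistr) auto
  also have "\<dots> = (\<Oplus>j\<in>I. \<zero>)"
  proof (rule finsum_cong')
    fix j assume j: "j \<in> I"
    then have "w \<otimes> (P k j \<otimes> m j) = P k j \<otimes> (w \<otimes> m j)"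
      using wc Pc mI by (intro m_lcomm) auto
    then show "w \<otimes> (P k j \<otimes> m j) = \<zero>" using w(2)[OF j] Pc j by simp
  qed auto
  finally have ws: "w \<otimes> s k = \<zero>" by simp
  have "(w \<otimes> P k k) \<otimes> m k = w \<otimes> (P k k \<otimes> m k \<oplus> s k) \<ominus> w \<otimes> s k"
    using wc kk mk sc[OF insertI1] by algebra
  then have "(w \<otimes> P k k) \<otimes> m k = \<zero>"
    using s[of k] ws wc by simp
  moreover have "(w \<otimes> P k k) \<otimes> m i = \<zero>" if "i \<in> I" for i
  proof -
    have "(w \<otimes> P k k) \<otimes> m i = P k k \<otimes> (w \<otimes> m i)"
      using wc kk mI that by (auto simp: m_ac Pi_iff)
    then show ?thesis using w(2)[OF that] kk by simp
  qed
  moreover have "w \<otimes> P k k \<in> monic_values x (e + d)"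
    using w(1) diag by (intro monic_values_mult) auto
  ultimately show ?case by blast
qed

end

text \<open>The relations \<open>z m\<^sub>i = \<Sum> a\<^sub>i\<^sub>j m\<^sub>j\<close> form a system of the above shape with \<open>d = 1\<close>, so a monic
  polynomial in \<open>z\<close> annihilates all generators, in particular \<open>1\<close>.\<close>

lemma integral_overI_lincombs:
  fixes I :: "'i set"
  assumes I: "finite I" and m: "m \<in> I \<rightarrow> carrier R"
    and z: "z \<in> carrier R" "\<And>i. i \<in> I \<Longrightarrow> z \<otimes> m i \<in> lincombs I m"
    and k: "k \<in> I" "m k = \<one>"
  shows "integral_over R K z"
proof -
  have "\<forall>i\<in>I. \<exists>c. c \<in> I \<rightarrow> K \<and> z \<otimes> m i = (\<Oplus>j\<in>I. c j \<otimes> m j)"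
    using z(2) by (simp add: lincombs_def) blast
  then obtain a where a: "\<And>i. i \<in> I \<Longrightarrow> a i \<in> I \<rightarrow> K"
    "\<And>i. i \<in> I \<Longrightarrow> z \<otimes> m i = (\<Oplus>j\<in>I. a i j \<otimes> m j)"
    by metis
  have aK: "a i j \<in> K" if "i \<in> I" "j \<in> I" for i j using a(1)[OF that(1)] that(2) by auto
  have ac: "a i j \<in> carrier R" if "i \<in> I" "j \<in> I" for i j using aK[OF that] by (rule K_carrier)
  define P where "P i j = (if i = j then z else \<zero>) \<ominus> a i j" for i j
  have pv: "b \<in> poly_values z 1" if "b \<in> K" for b
    using poly_values_smult[OF z(1) that poly_values_pow[OF z(1), of 0 1]] K_carrier[OF that] by simp
  have "\<exists>e. \<exists>w\<in>monic_values z e. \<forall>i\<in>I. w \<otimes> m i = \<zero>"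
  proof (rule monic_system_annihilator[OF z(1) I m, where P = P and d = 1])
    fix i assume i: "i \<in> I"
    have "P i i = z [^] (1::nat) \<oplus> (\<ominus> a i i)" unfolding P_def a_minus_def using z(1) by simp
    then show "P i i \<in> monic_values z 1"
      unfolding monic_values_def using pv[OF K_neg[OF aK[OF i i]]] by blast
    have "(\<Oplus>j\<in>I. P i j \<otimes> m j)
        = (\<Oplus>j\<in>I. (if i = j then z \<otimes> m j else \<zero>) \<oplus> (\<ominus> \<one>) \<otimes> (a i j \<otimes> m j))"
      using i z(1) m ac unfolding P_def
      by (intro finsum_cong') (auto simp: Pi_iff a_minus_def l_distr l_minus)
    also have "\<dots> = (\<Oplus>j\<in>I. if i = j then z \<otimes> m j else \<zero>) \<oplus> (\<Oplus>j\<in>I. (\<ominus> \<one>) \<otimes> (a i j \<otimes> m j))"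
      using i z(1) m ac by (intro finsum_addf) (auto simp: Pi_iff)
    also have "(\<Oplus>j\<in>I. if i = j then z \<otimes> m j else \<zero>) = z \<otimes> m i"
      using i z(1) m I by (intro add.finprod_singleton) auto
    also have "(\<Oplus>j\<in>I. (\<ominus> \<one>) \<otimes> (a i j \<otimes> m j)) = (\<ominus> \<one>) \<otimes> (z \<otimes> m i)"
      unfolding a(2)[OF i] using i m ac I by (intro finsum_rdistr[symmetric]) (auto simp: Pi_iff)
    also have "z \<otimes> m i \<oplus> (\<ominus> \<one>) \<otimes> (z \<otimes> m i) = \<zero>"
      using z(1) m i by (auto simp: Pi_iff l_minus r_neg)
    finally show "(\<Oplus>j\<in>I. P i j \<otimes> m j) = \<zero>" .
  next
    fix i j assume ij: "i \<in> I" "j \<in> I" "i \<noteq> j"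
    then have "P i j = \<ominus> a i j" unfolding P_def a_minus_def using ac by simp
    then show "P i j \<in> poly_values z 1" using pv[OF K_neg[OF aK[OF ij(1,2)]]] by simp
  qed
  then obtain e w where "w \<in> monic_values z e" "w \<otimes> m k = \<zero>"
    using k(1) by blast
  then have "\<zero> \<in> monic_values z e"
    using monic_values_carrier[OF z(1)] k(2) by auto
  then show ?thesis
    using integral_over_iff[OF z(1)] by blast
qed

lemma integral_over_K:
  assumes "a \<in> K"
  shows "integral_over R K a"
  unfolding integral_over_def
  using assms K_neg[OF assms] K_carrier[OF assms] by (intro exI[of _ "[\<ominus> a]"]) (simp add: r_neg)

text \<open>The monomials \<open>x\<^sup>i y\<^sup>j\<close> with \<open>i < d\<close> and \<open>j < e\<close> span a module that is stable under \<open>x\<close> and \<open>y\<close>.\<close>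

lemma integral_over_add_mult:
  assumes x: "x \<in> carrier R" "integral_over R K x" and y: "y \<in> carrier R" "integral_over R K y"
  shows "integral_over R K (x \<oplus> y)" "integral_over R K (x \<otimes> y)"
proof -
  \<comment> \<open>Positive degrees make \<open>1\<close> one of the monomials.\<close>
  have deg: "\<exists>d>0. \<zero> \<in> monic_values x d" if x: "x \<in> carrier R" "integral_over R K x" for x
  proof -
    obtain d where d: "\<zero> \<in> monic_values x d"
      using x(2) unfolding integral_over_iff[OF x(1)] by (rule exE)
    have "x [^] (1::nat) \<oplus> \<zero> \<in> monic_values x 1"
      unfolding monic_values_def using poly_values_zero[OF that(1)] by blast
    then have "x \<in> monic_values x 1" using that(1) by simp
    from monic_values_mult[OF that(1) this d] that(1) show ?thesis
      by (intro exI[of _ "1 + d"]) simp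
  qed
  obtain d e where d: "d > 0" "\<zero> \<in> monic_values x d" and e: "e > 0" "\<zero> \<in> monic_values y e"
    using deg[OF x] deg[OF y] by blast
  define I where "I = {..<d} \<times> {..<e}"
  define m where "m = (\<lambda>(i, j). x [^] (i::nat) \<otimes> y [^] (j::nat))"
  have I: "finite I" unfolding I_def by simp
  have m: "m \<in> I \<rightarrow> carrier R" unfolding m_def using x y by auto
  let ?M = "lincombs I m"
  note add = lincombs_add[OF I m] and gen = lincombs_gen[OF I m]
  have px: "u \<otimes> y [^] j \<in> ?M" if "u \<in> poly_values x d" "j < e" for u j
  proof -
    have "y [^] j \<otimes> u \<in> ?M"
    proof (rule poly_values_mult_mem[OF x(1) I m _ _ that(1)])
      fix i assume "i < d"
      then show "y [^] j \<otimes> x [^] i \<in> ?M"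
        using gen[of "(i, j)"] that(2) x y by (simp add: I_def m_def m_comm)
    qed (use y in simp)
    then show ?thesis using poly_values_carrier[OF x(1) that(1)] y by (simp add: m_comm)
  qed
  have py: "x [^] i \<otimes> u \<in> ?M" if "u \<in> poly_values y e" "i < d" for u i
  proof (rule poly_values_mult_mem[OF y(1) I m _ _ that(1)])
    fix j assume "j < e"
    then show "x [^] i \<otimes> y [^] j \<in> ?M"
      using gen[of "(i, j)"] that(2) by (simp add: I_def m_def)
  qed (use x in simp)
  have pow: "t [^] d \<in> poly_values t d" if t: "t \<in> carrier R" "\<zero> \<in> monic_values t d" for t d
  proof -
    obtain v where v: "v \<in> poly_values t d" "\<zero> = t [^] d \<oplus> v"
      using t(2) by (auto simp: monic_values_def)
    then have "t [^] d = \<ominus> v"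
      using t poly_values_carrier[OF t(1) v(1)] by (metis minus_equality nat_pow_closed)
    then show ?thesis using poly_values_neg[OF t(1) v(1)] by (simp only:)
  qed
  have xm: "x \<otimes> m p \<in> ?M" if p: "p \<in> I" for p
  proof -
    obtain i j where ij: "p = (i, j)" "i < d" "j < e" using p by (auto simp: I_def)
    have xp: "x \<otimes> m p = x [^] Suc i \<otimes> y [^] j"
      unfolding ij m_def using x y by (simp add: m_ac)
    show ?thesis
    proof (cases "Suc i < d")
      case True
      then have "m (Suc i, j) \<in> ?M" using ij by (intro gen) (auto simp: I_def)
      moreover have "x \<otimes> m p = m (Suc i, j)" by (subst xp) (simp add: m_def)
      ultimately show ?thesis by simp
    next
      case False
      then have "Suc i = d" using ij by simp
      then show ?thesis using px[OF pow[OF x(1) d(2)] ij(3)] xp by simp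
    qed
  qed
  have ym: "y \<otimes> m p \<in> ?M" if p: "p \<in> I" for p
  proof -
    obtain i j where ij: "p = (i, j)" "i < d" "j < e" using p by (auto simp: I_def)
    have xp: "y \<otimes> m p = x [^] i \<otimes> y [^] Suc j"
      unfolding ij m_def using x y by (simp add: m_ac)
    show ?thesis
    proof (cases "Suc j < e")
      case True
      then have "m (i, Suc j) \<in> ?M" using ij by (intro gen) (auto simp: I_def)
      moreover have "y \<otimes> m p = m (i, Suc j)" by (subst xp) (simp add: m_def)
      ultimately show ?thesis by simp
    next
      case False
      then have "Suc j = e" using ij by simp
      then show ?thesis using py[OF pow[OF y(1) e(2)] ij(2)] xp by simp
    qed
  qed
  have one: "(0, 0) \<in> I" "m (0, 0) = \<one>"
    using d(1) e(1) by (simp_all add: I_def m_def)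
  have mc: "m p \<in> carrier R" if "p \<in> I" for p using m that by auto
  show "integral_over R K (x \<oplus> y)"
    using x y xm ym add mc
    by (intro integral_overI_lincombs[OF I m _ _ one]) (auto simp: l_distr)
  show "integral_over R K (x \<otimes> y)"
    using x y lincombs_mult_mem[OF I m I m x(1) xm ym] mc
    by (intro integral_overI_lincombs[OF I m _ _ one]) (auto simp: m_assoc)
qed

lemma integral_closure_subring: "subring {x \<in> carrier R. integral_over R K x} R"
proof (rule subringI)
  fix h assume h: "h \<in> {x \<in> carrier R. integral_over R K x}"
  have "\<ominus> h = (\<ominus> \<one>) \<otimes> h" using h by (simp add: l_minus)
  then show "\<ominus> h \<in> {x \<in> carrier R. integral_over R K x}"
    using h integral_over_add_mult(2)[of "\<ominus> \<one>" h] integral_over_K[OF K_neg[OF K_one]] by simp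
qed (use integral_over_add_mult integral_over_K[OF K_one] in auto)

text \<open>An integral equation of \<open>t\<close>, multiplied by \<open>a\<^sup>n\<close>, becomes an equation for \<open>a t\<close> all of
  whose coefficients below the leading one are divisible by \<open>a\<close>; modulo \<open>P\<close> it is an equation for
  \<open>s\<close>.\<close>

lemma integral_over_mod_ideal:
  assumes P: "ideal P R" and t: "t \<in> carrier R" "integral_over R K t" and a: "a \<in> K" and s: "s \<in> K"
    and ts: "t \<otimes> a \<ominus> s \<in> P"
  shows "\<exists>n::nat. \<exists>b\<in>K. s [^] n \<oplus> a \<otimes> b \<in> P"
proof -
  interpret P: ideal P R by fact
  have c: "a \<in> carrier R" "s \<in> carrier R" using a s K_carrier by blast+
  have pow: "a [^] n \<otimes> t [^] n \<ominus> s [^] n \<in> P" for n :: nat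
  proof (induction n)
    case 0
    then show ?case by (simp add: r_neg a_minus_def P.zero_closed)
  next
    case (Suc n)
    define u v where "u = a [^] n \<otimes> t [^] n" and "v = s [^] n"
    have uv: "u \<in> carrier R" "v \<in> carrier R" using c t(1) by (auto simp: u_def v_def)
    have "a [^] Suc n \<otimes> t [^] Suc n \<ominus> s [^] Suc n = u \<otimes> (t \<otimes> a) \<ominus> v \<otimes> s"
      using t(1) c by (simp add: u_def v_def m_ac)
    also have "\<dots> = (u \<ominus> v) \<otimes> (t \<otimes> a) \<oplus> v \<otimes> (t \<otimes> a \<ominus> s)"
      using uv c t(1) by algebra
    also have "\<dots> \<in> P"
      using P.I_r_closed[OF Suc[folded u_def v_def], of "t \<otimes> a"] P.I_l_closed[OF ts uv(2)] t(1) c by simp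
    finally show ?case .
  qed
  have sK: "s [^] n \<in> K" for n :: nat
    by (induction n) (use s K_one K_mult in auto)
  have ev: "\<exists>b\<in>K. a [^] length l \<otimes> eval l t \<ominus> a \<otimes> b \<in> P" if "set l \<subseteq> K" for l
    using that
  proof (induction l)
    case Nil
    then show ?case
      using c K_zero by (intro bexI[of _ \<zero>]) (auto simp: a_minus_def P.zero_closed)
  next
    case (Cons d l)
    then obtain b where b: "b \<in> K" "a [^] length l \<otimes> eval l t \<ominus> a \<otimes> b \<in> P" by auto
    define n where "n = length l"
    have d: "d \<in> K" using Cons.prems by simp
    have E: "eval l t \<in> carrier R" using Cons.prems t(1) K_subset by (intro eval_in_carrier) auto
    let ?A = "a [^] n" and ?T = "t [^] n" and ?V = "s [^] n"
    let ?b = "d \<otimes> ?V \<oplus> a \<otimes> b"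
    have cc: "?A \<in> carrier R" "?T \<in> carrier R" "?V \<in> carrier R" "d \<in> carrier R" "b \<in> carrier R"
      using d b(1) c t(1) K_carrier by auto
    have "a [^] length (d # l) \<otimes> eval (d # l) t \<ominus> a \<otimes> ?b
        = (?A \<otimes> a) \<otimes> (d \<otimes> ?T \<oplus> eval l t) \<ominus> a \<otimes> (d \<otimes> ?V \<oplus> a \<otimes> b)"
      by (simp add: n_def)
    also have "\<dots> = (a \<otimes> d) \<otimes> (?A \<otimes> ?T \<ominus> ?V) \<oplus> a \<otimes> (?A \<otimes> eval l t \<ominus> a \<otimes> b)"
      using cc E c by algebra
    also have "\<dots> \<in> P"
      using pow[of n] b(2) cc c unfolding n_def by (intro P.a_closed P.I_l_closed) auto
    finally show ?case
      using K_add[OF K_mult[OF d sK] K_mult[OF a b(1)]] by blast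
  qed
  obtain l where l: "set l \<subseteq> K" "eval (\<one> # l) t = \<zero>"
    using t(2) by (auto simp: integral_over_def)
  obtain b where b: "b \<in> K" "a [^] length l \<otimes> eval l t \<ominus> a \<otimes> b \<in> P"
    using ev[OF l(1)] by blast
  define n where "n = length l"
  have E: "eval l t \<in> carrier R" using l(1) t(1) K_subset by (intro eval_in_carrier) auto
  let ?A = "a [^] n" and ?T = "t [^] n" and ?V = "s [^] n"
  have cc: "?A \<in> carrier R" "?T \<in> carrier R" "?V \<in> carrier R" "b \<in> carrier R"
    using b(1) c t(1) K_carrier by auto
  have z: "?T \<oplus> eval l t = \<zero>" using l(2) t(1) by (simp add: n_def)
  have "?V \<oplus> a \<otimes> b
      = ?A \<otimes> (?T \<oplus> eval l t) \<ominus> ((?A \<otimes> ?T \<ominus> ?V) \<oplus> (?A \<otimes> eval l t \<ominus> a \<otimes> b))"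
    using cc E c by algebra
  also have "\<dots> \<in> P"
    using ideal_minus_closed[OF P P.zero_closed P.a_closed[OF pow[of n] b(2)[folded n_def]]] cc(1) z
    by simp
  finally show ?thesis using b(1) by blast
qed

end

lemma eval_subring:
  assumes "ring R" "subring S R"
  shows "ring.eval (R\<lparr>carrier := S\<rparr>) p x = ring.eval R p x"
proof -
  interpret R: ring R by fact
  interpret S: ring "R\<lparr>carrier := S\<rparr>" using assms(2) by (rule R.subring_is_ring)
  show ?thesis
    by (induction p) (simp_all add: R.nat_pow_consistent[symmetric])
qed

lemma integral_over_subring:
  assumes "ring R" "subring S R"
  shows "integral_over (R\<lparr>carrier := S\<rparr>) K x \<longleftrightarrow> integral_over R K x"
  by (simp add: integral_over_def eval_subring[OF assms])

lemma (in ring_hom_cring) integral_over_image: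
  assumes "K \<subseteq> carrier R" "x \<in> carrier R" "integral_over R K x"
  shows "integral_over S (h ` K) (h x)"
proof -
  obtain p where p: "set p \<subseteq> K" "R.eval (\<one> # p) x = \<zero>"
    using assms(3) by (auto simp: integral_over_def)
  have "S.eval (map h (\<one> # p)) (h x) = h (R.eval (\<one> # p) x)"
    using p(1) assms(1,2) by (intro ring.eval_hom'[symmetric]) auto
  then have "S.eval (\<one>\<^bsub>S\<^esub> # map h p) (h x) = \<zero>\<^bsub>S\<^esub>"
    using p(2) by simp
  then show ?thesis
    unfolding integral_over_def using p(1) by (intro exI[of _ "map h p"]) auto
qed

text \<open>Lying over and going up at once.  Take \<open>P\<close> maximal among the ideals above \<open>I\<close> that avoid
  the image of the complement of \<open>p\<close>.  If some \<open>a \<in> p\<close> were not mapped into \<open>P\<close>, then modulo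
  \<open>P\<close> some \<open>s \<notin> p\<close> would be a multiple \<open>t a\<close>, and integrality of \<open>t\<close> would put a power of \<open>s\<close>
  into \<open>p\<close>.\<close>

lemma (in ring_hom_cring) lying_over:
  assumes int: "\<And>t. t \<in> carrier S \<Longrightarrow> integral_over S (h ` carrier R) t"
    and I: "ideal I S" and p: "p \<in> Spec R" and Ip: "contract R h I \<subseteq> p"
  obtains P where "P \<in> Spec S" "I \<subseteq> P" "contract R h P = p"
proof -
  interpret p: primeideal p R using p by (simp add: Spec_iff)
  let ?U = "h ` (carrier R - p)"
  have U1: "?U \<subseteq> carrier S" by auto
  have U2: "\<one>\<^bsub>S\<^esub> \<in> ?U"
    using p.I_notcarr p.one_imp_carrier by (intro image_eqI[of _ _ "\<one>"]) auto
  have U3: "a \<otimes>\<^bsub>S\<^esub> b \<in> ?U" if ab: "a \<in> ?U" "b \<in> ?U" for a b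
  proof -
    obtain a' b' where *: "a = h a'" "b = h b'" "a' \<in> carrier R" "b' \<in> carrier R" "a' \<notin> p" "b' \<notin> p"
      using ab by blast
    then have "a' \<otimes> b' \<notin> p" using p.I_prime by blast
    then show ?thesis using * by (intro image_eqI[of _ _ "a' \<otimes> b'"]) auto
  qed
  have U4: "I \<inter> ?U = {}"
    using Ip by (auto simp: contract_def)
  obtain P where P: "primeideal P S" "I \<subseteq> P" "P \<inter> ?U = {}"
    and meets: "\<And>a. a \<in> carrier S \<Longrightarrow> a \<notin> P \<Longrightarrow> \<exists>q\<in>P. \<exists>t\<in>carrier S. q \<oplus>\<^bsub>S\<^esub> t \<otimes>\<^bsub>S\<^esub> a \<in> ?U"
    by (rule S.prime_avoiding[OF I U1 U2 U3 U4], assumption+, rule that)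
  interpret P: primeideal P S by fact
  have "contract R h P \<subseteq> p"
    using P(3) by (auto simp: contract_def)
  moreover have "h a \<in> P" if a: "a \<in> p" for a
  proof (rule ccontr)
    assume haP: "h a \<notin> P"
    have aR: "a \<in> carrier R" using a by (rule p.Icarr)
    obtain q t where qt: "q \<in> P" "t \<in> carrier S" "q \<oplus>\<^bsub>S\<^esub> t \<otimes>\<^bsub>S\<^esub> h a \<in> ?U"
      using meets[OF hom_closed[OF aR] haP] by blast
    obtain s where s: "q \<oplus>\<^bsub>S\<^esub> t \<otimes>\<^bsub>S\<^esub> h a = h s" "s \<in> carrier R" "s \<notin> p"
      using qt(3) by (elim imageE DiffE)
    have c: "q \<in> carrier S" "h a \<in> carrier S" using P.Icarr[OF qt(1)] aR by auto
    have "t \<otimes>\<^bsub>S\<^esub> h a \<ominus>\<^bsub>S\<^esub> h s = \<ominus>\<^bsub>S\<^esub> q"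
      unfolding s(1)[symmetric] using c qt(2) by algebra
    then have ts: "t \<otimes>\<^bsub>S\<^esub> h a \<ominus>\<^bsub>S\<^esub> h s \<in> P" using P.a_inv_closed[OF qt(1)] by simp
    interpret K: cring_with_subring S "h ` carrier R"
      by (intro cring_with_subring.intro cring_with_subring_axioms.intro S.is_cring image_subring)
    obtain n :: nat and b where b: "b \<in> carrier R" "h s [^]\<^bsub>S\<^esub> n \<oplus>\<^bsub>S\<^esub> h a \<otimes>\<^bsub>S\<^esub> h b \<in> P"
      using K.integral_over_mod_ideal[OF P.is_ideal qt(2) int[OF qt(2)] imageI[OF aR] imageI[OF s(2)] ts]
      by blast
    then have "s [^] n \<oplus> a \<otimes> b \<in> contract R h P"
      using s(2) aR by (simp add: contract_def ring.hom_nat_pow)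
    then have "s [^] n \<oplus> a \<otimes> b \<in> p"
      using \<open>contract R h P \<subseteq> p\<close> by blast
    then have "(s [^] n \<oplus> a \<otimes> b) \<ominus> a \<otimes> b \<in> p"
      using a b(1) by (intro R.ideal_minus_closed[OF p.is_ideal] p.I_r_closed) auto
    moreover have "(s [^] n \<oplus> a \<otimes> b) \<ominus> a \<otimes> b = s [^] n"
    proof -
      have "s [^] n \<in> carrier R" using s(2) by simp
      then show ?thesis using aR b(1) by algebra
    qed
    ultimately show False
      using R.pow_mem_primeideal[OF p.primeideal s(2)] s(3) by simp
  qed
  then have "p \<subseteq> contract R h P"
    using p.Icarr by (auto simp: contract_def)
  ultimately show ?thesis
    using that P by (auto simp: Spec_iff)
qed

section \<open>Induced maps on quotients and residue fields\<close>

lemma carrier_Quot: "carrier (R Quot I) = (\<lambda>x. I +>\<^bsub>R\<^esub> x) ` carrier R"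
  by (auto simp: FactRing_def A_RCOSETS_def')

lemma (in ring) coset_eq_iff:
  assumes "ideal I R" "a \<in> carrier R" "b \<in> carrier R"
  shows "I +> a = I +> b \<longleftrightarrow> a \<ominus> b \<in> I"
  using quotient_eq_iff_same_a_r_cos[OF assms] by simp

lemma (in ring) coset_zero_iff:
  assumes "ideal I R" "a \<in> carrier R"
  shows "I +> a = \<zero>\<^bsub>R Quot I\<^esub> \<longleftrightarrow> a \<in> I"
proof -
  have "I +> a = I \<longleftrightarrow> a \<in> I"
    using a_rcos_zero[OF assms(1)] ideal.rcos_const_imp_mem[OF assms(1,2)] by blast
  then show ?thesis by (simp add: FactRing_def)
qed

lemma image_const_eqI:
  assumes "a \<in> A" "\<And>x. x \<in> A \<Longrightarrow> f x = c"
  shows "f ` A = {c}"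
  using assms by auto

lemma (in ring_hom_cring) quot_map_coset:
  assumes I: "ideal I R" and J: "ideal J S" and IJ: "h ` I \<subseteq> J" and a: "a \<in> carrier R"
  shows "quot_map S J h (I +> a) = J +>\<^bsub>S\<^esub> h a"
proof -
  interpret I: ideal I R by fact
  interpret J: ideal J S by fact
  have "J +>\<^bsub>S\<^esub> h x = J +>\<^bsub>S\<^esub> h a" if x: "x \<in> I +> a" for x
  proof -
    obtain i where i: "i \<in> I" "x = i \<oplus> a"
      using x by (auto simp: a_r_coset_def')
    then have iR: "i \<in> carrier R" by (simp add: I.Icarr)
    have "h x \<ominus>\<^bsub>S\<^esub> h a = h i"
    proof -
      have "h i \<in> carrier S" "h a \<in> carrier S" using iR a by auto
      then have "(h i \<oplus>\<^bsub>S\<^esub> h a) \<ominus>\<^bsub>S\<^esub> h a = h i" by algebra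
      then show ?thesis using i iR a by simp
    qed
    then show ?thesis
      using i(1) IJ S.coset_eq_iff[OF J hom_closed hom_closed[OF a], of x] i(2) iR a
      by (metis R.add.m_closed image_subset_iff)
  qed
  moreover have "a \<in> I +> a" by (rule I.a_rcos_self[OF a])
  ultimately have "(\<lambda>x. J +>\<^bsub>S\<^esub> h x) ` (I +> a) = {J +>\<^bsub>S\<^esub> h a}"
    by (intro image_const_eqI)
  then show ?thesis by (simp add: quot_map_def)
qed

lemma (in ring_hom_cring) quot_map_hom:
  assumes I: "ideal I R" and J: "ideal J S" and IJ: "h ` I \<subseteq> J"
  shows "ring_hom_cring (R Quot I) (S Quot J) (quot_map S J h)"
proof -
  interpret I: ring_hom_cring R "R Quot I" "(+>) I"
    by (rule ideal.rcos_ring_hom_cring[OF I R.is_cring])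
  interpret J: ring_hom_cring S "S Quot J" "(+>\<^bsub>S\<^esub>) J"
    by (rule ideal.rcos_ring_hom_cring[OF J S.is_cring])
  note q = quot_map_coset[OF assms]
  show ?thesis
  proof (unfold_locales, rule ring_hom_memI)
    fix x assume "x \<in> carrier (R Quot I)"
    then obtain a where a: "a \<in> carrier R" "x = I +> a" by (auto simp: carrier_Quot)
    then show "quot_map S J h x \<in> carrier (S Quot J)" by (simp add: q)
    fix y assume "y \<in> carrier (R Quot I)"
    then obtain b where b: "b \<in> carrier R" "y = I +> b" by (auto simp: carrier_Quot)
    show "quot_map S J h (x \<otimes>\<^bsub>R Quot I\<^esub> y) = quot_map S J h x \<otimes>\<^bsub>S Quot J\<^esub> quot_map S J h y"
      using a b q[of "a \<otimes> b"] by (simp add: q)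
    show "quot_map S J h (x \<oplus>\<^bsub>R Quot I\<^esub> y) = quot_map S J h x \<oplus>\<^bsub>S Quot J\<^esub> quot_map S J h y"
      using a b q[of "a \<oplus> b"] by (simp add: q)
  next
    show "quot_map S J h \<one>\<^bsub>R Quot I\<^esub> = \<one>\<^bsub>S Quot J\<^esub>"
      using q[of "\<one>"] by simp
  qed
qed

lemma (in ring_hom_cring) frac_map_fraction:
  assumes nzd: "\<And>s. s \<in> nonzerodivisors R \<Longrightarrow> h s \<in> nonzerodivisors S"
    and a: "a \<in> carrier R" "s \<in> nonzerodivisors R"
  shows "frac_map S h (fraction R a s) = fraction S (h a) (h s)"
proof -
  have "fraction S (h b) (h t) = fraction S (h a) (h s)" if "(b, t) \<in> fraction R a s" for b t
  proof -
    note b = R.mem_fraction[OF a that]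
    then have "b \<otimes> s = a \<otimes> t"
      using a by (simp add: R.fraction_eq_iff)
    then have "h b \<otimes>\<^bsub>S\<^esub> h s = h a \<otimes>\<^bsub>S\<^esub> h t"
      using a b R.nonzerodivisors_closed by (metis hom_mult)
    then show ?thesis
      using a b nzd by (simp add: S.fraction_eq_iff)
  qed
  then show ?thesis
    unfolding frac_map_def by (auto intro!: UN_const_eqI[OF R.fraction_self[OF a]])
qed

text \<open>Only surjectivity is at stake, and a fraction is in the image as soon as its numerator and its
  denominator are.\<close>

lemma (in ring_hom_cring) frac_map_iso_iff:
  assumes nzd: "\<And>s. s \<in> nonzerodivisors R \<Longrightarrow> h s \<in> nonzerodivisors S"
    and inj: "inj_on h (carrier R)" and dom: "domain S"
  shows "frac_map S h \<in> ring_iso (total_fractions R) (total_fractions S) \<longleftrightarrow>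
    (\<forall>x\<in>carrier S. \<exists>s\<in>nonzerodivisors R. \<exists>a\<in>carrier R. h s \<otimes>\<^bsub>S\<^esub> x = h a)"
proof -
  let ?g = "frac_map S h"
  note fr = frac_map_fraction[OF nzd] and closed = R.nonzerodivisors_closed
  interpret domain S by fact
  have hom: "?g \<in> ring_hom (total_fractions R) (total_fractions S)"
  proof (rule ring_hom_memI)
    fix x assume "x \<in> carrier (total_fractions R)"
    then obtain a s where a: "a \<in> carrier R" "s \<in> nonzerodivisors R" "x = fraction R a s"
      by (rule R.fraction_cases)
    then show "?g x \<in> carrier (total_fractions S)" by (simp add: fr S.fraction_closed nzd)
    fix y assume "y \<in> carrier (total_fractions R)"
    then obtain b t where b: "b \<in> carrier R" "t \<in> nonzerodivisors R" "y = fraction R b t"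
      by (rule R.fraction_cases)
    show "?g (x \<otimes>\<^bsub>total_fractions R\<^esub> y) = ?g x \<otimes>\<^bsub>total_fractions S\<^esub> ?g y"
      using a b by (simp add: R.fraction_mult S.fraction_mult fr nzd R.nonzerodivisors_mult closed)
    show "?g (x \<oplus>\<^bsub>total_fractions R\<^esub> y) = ?g x \<oplus>\<^bsub>total_fractions S\<^esub> ?g y"
      using a b by (simp add: R.fraction_add S.fraction_add fr nzd R.nonzerodivisors_mult closed)
  next
    show "?g \<one>\<^bsub>total_fractions R\<^esub> = \<one>\<^bsub>total_fractions S\<^esub>"
      by (simp add: total_fractions_one fr R.nonzerodivisors_one)
  qed
  have inj': "inj_on ?g (carrier (total_fractions R))"
  proof (rule inj_onI)
    fix x y assume "x \<in> carrier (total_fractions R)" "y \<in> carrier (total_fractions R)" and e: "?g x = ?g y"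
    then obtain a s b t where a: "a \<in> carrier R" "s \<in> nonzerodivisors R" "x = fraction R a s"
      and b: "b \<in> carrier R" "t \<in> nonzerodivisors R" "y = fraction R b t"
      by (metis R.fraction_cases)
    then have "h (a \<otimes> t) = h (b \<otimes> s)"
      using e by (simp add: fr S.fraction_eq_iff nzd closed)
    then have "a \<otimes> t = b \<otimes> s"
      using inj_onD[OF inj, of "a \<otimes> t" "b \<otimes> s"] a b closed by simp
    then show "x = y" using a b by (simp add: R.fraction_eq_iff)
  qed
  have "?g \<in> ring_iso (total_fractions R) (total_fractions S) \<longleftrightarrow>
      carrier (total_fractions S) \<subseteq> ?g ` carrier (total_fractions R)"
    using hom inj' ring_hom_closed[OF hom] by (auto simp: ring_iso_def bij_betw_def)
  also have "\<dots> \<longleftrightarrow> (\<forall>x\<in>carrier S. \<exists>s\<in>nonzerodivisors R. \<exists>a\<in>carrier R. h s \<otimes>\<^bsub>S\<^esub> x = h a)"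
    (is "?L \<longleftrightarrow> ?R")
  proof
    assume L: ?L
    show ?R
    proof
      fix x assume x: "x \<in> carrier S"
      then have "to_frac S x \<in> ?g ` carrier (total_fractions R)"
        using L S.fraction_closed[OF x S.nonzerodivisors_one] by (auto simp: to_frac_def)
      then obtain a s where a: "a \<in> carrier R" "s \<in> nonzerodivisors R" "to_frac S x = ?g (fraction R a s)"
        by (auto elim!: R.fraction_cases)
      then have "x \<otimes>\<^bsub>S\<^esub> h s = h a"
        using x by (simp add: to_frac_def fr S.fraction_eq_iff nzd S.nonzerodivisors_one)
      then show "\<exists>s\<in>nonzerodivisors R. \<exists>a\<in>carrier R. h s \<otimes>\<^bsub>S\<^esub> x = h a"
        using a x closed by (auto simp: S.m_comm)
    qed
  next
    assume R: ?R
    show ?L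
    proof
      fix z assume "z \<in> carrier (total_fractions S)"
      then obtain x y where xy: "x \<in> carrier S" "y \<in> nonzerodivisors S" "z = fraction S x y"
        by (rule S.fraction_cases)
      have yS: "y \<in> carrier S" using xy(2) by (rule S.nonzerodivisors_closed)
      obtain s a where s: "s \<in> nonzerodivisors R" "a \<in> carrier R" "h s \<otimes>\<^bsub>S\<^esub> x = h a"
        using R xy by blast
      obtain t b where t: "t \<in> nonzerodivisors R" "b \<in> carrier R" "h t \<otimes>\<^bsub>S\<^esub> y = h b"
        using R yS by blast
      have c: "s \<in> carrier R" "t \<in> carrier R" using s t closed by auto
      have bn: "b \<in> nonzerodivisors R"
      proof -
        have hb: "h b \<in> nonzerodivisors S" using t(3) S.nonzerodivisors_mult[OF nzd[OF t(1)] xy(2)] by simp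
        have "e = \<zero>" if e: "e \<in> carrier R" "b \<otimes> e = \<zero>" for e
        proof -
          have "h b \<otimes>\<^bsub>S\<^esub> h e = \<zero>\<^bsub>S\<^esub>" using e t(2) by (metis hom_mult hom_zero)
          then have "h e = h \<zero>" using hb e by (simp add: nonzerodivisors_def)
          then show ?thesis using inj_onD[OF inj, of e "\<zero>"] e by simp
        qed
        then show ?thesis using t(2) by (simp add: nonzerodivisors_def)
      qed
      have "x \<otimes>\<^bsub>S\<^esub> (h s \<otimes>\<^bsub>S\<^esub> h b) = (h s \<otimes>\<^bsub>S\<^esub> x) \<otimes>\<^bsub>S\<^esub> h b"
        using xy c t(2) by (simp add: S.m_ac)
      also have "\<dots> = h a \<otimes>\<^bsub>S\<^esub> (h t \<otimes>\<^bsub>S\<^esub> y)" using s(3) t(3) by simp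
      also have "\<dots> = (h a \<otimes>\<^bsub>S\<^esub> h t) \<otimes>\<^bsub>S\<^esub> y" using s(2) c yS by (simp add: S.m_assoc)
      finally have "z = fraction S (h (a \<otimes> t)) (h (s \<otimes> b))"
        using xy s t c bn nzd[of "s \<otimes> b"] by (simp add: S.fraction_eq_iff R.nonzerodivisors_mult)
      also have "\<dots> = ?g (fraction R (a \<otimes> t) (s \<otimes> b))"
        using s t c bn by (intro fr[symmetric]) (auto simp: R.nonzerodivisors_mult)
      finally show "z \<in> ?g ` carrier (total_fractions R)"
        using s t c bn by (auto intro!: R.fraction_closed R.nonzerodivisors_mult)
    qed
  qed
  finally show ?thesis .
qed

text \<open>Triviality of the residue field extension at \<open>Q\<close>, expressed in the upper ring itself: every
  element has at \<open>Q\<close> a value \<open>a/s\<close> coming from the lower ring.\<close>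

definition residually_trivial ::
  "('a, 'm) ring_scheme \<Rightarrow> ('b, 'n) ring_scheme \<Rightarrow> ('a \<Rightarrow> 'b) \<Rightarrow> 'b set \<Rightarrow> bool" where
  "residually_trivial A T f Q \<longleftrightarrow> (\<forall>x\<in>carrier T. \<exists>s\<in>carrier A. \<exists>a\<in>carrier A.
     f s \<notin> Q \<and> f s \<otimes>\<^bsub>T\<^esub> x \<ominus>\<^bsub>T\<^esub> f a \<in> Q)"

lemma nonzerodivisors_domain:
  assumes "domain D"
  shows "nonzerodivisors D = carrier D - {\<zero>\<^bsub>D\<^esub>}"
proof -
  interpret domain D by fact
  have "\<zero>\<^bsub>D\<^esub> \<notin> nonzerodivisors D"
  proof
    assume "\<zero>\<^bsub>D\<^esub> \<in> nonzerodivisors D"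
    then have "\<zero>\<^bsub>D\<^esub> \<otimes>\<^bsub>D\<^esub> \<one>\<^bsub>D\<^esub> = \<zero>\<^bsub>D\<^esub> \<longrightarrow> \<one>\<^bsub>D\<^esub> = \<zero>\<^bsub>D\<^esub>"
      using one_closed unfolding nonzerodivisors_def by blast
    then show False using one_not_zero by simp
  qed
  moreover have "s \<in> nonzerodivisors D" if "s \<in> carrier D" "s \<noteq> \<zero>\<^bsub>D\<^esub>" for s
    using integral[OF _ that(1)] that unfolding nonzerodivisors_def by simp
  ultimately show ?thesis
    using nonzerodivisors_closed by blast
qed

lemma (in ring_hom_cring) frac_map_residue_iso_iff:
  assumes Q: "Q \<in> Spec S"
  shows "frac_map (S Quot Q) (quot_map S Q h)
      \<in> ring_iso (residue_field R (contract R h Q)) (residue_field S Q) \<longleftrightarrow> residually_trivial R S h Q"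
proof -
  let ?P = "contract R h Q" and ?g = "quot_map S Q h"
  have PQ: "h ` ?P \<subseteq> Q" unfolding contract_def by (rule image_subsetI) (erule CollectE conjE)+
  have "?P \<in> Spec R" by (rule contract_Spec[OF ring_hom_cring_axioms Q])
  then interpret P: primeideal ?P R by (simp add: Spec_iff)
  interpret Q: primeideal Q S using Q by (simp add: Spec_iff)
  note q = quot_map_coset[OF P.is_ideal Q.is_ideal PQ]
  interpret g: ring_hom_cring "R Quot ?P" "S Quot Q" ?g
    by (rule quot_map_hom[OF P.is_ideal Q.is_ideal PQ])
  interpret p: ring_hom_cring R "R Quot ?P" "(+>) ?P" by (rule P.rcos_ring_hom_cring)
  interpret q: ring_hom_cring S "S Quot Q" "(+>\<^bsub>S\<^esub>) Q" by (rule Q.rcos_ring_hom_cring)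
  note dR = P.quotient_is_domain and dS = Q.quotient_is_domain
  have inj: "inj_on ?g (carrier (R Quot ?P))"
  proof (rule inj_onI)
    fix x y assume "x \<in> carrier (R Quot ?P)" "y \<in> carrier (R Quot ?P)" and e: "?g x = ?g y"
    then obtain a b where ab: "a \<in> carrier R" "b \<in> carrier R" "x = ?P +> a" "y = ?P +> b"
      by (auto simp: carrier_Quot)
    then have "h a \<ominus>\<^bsub>S\<^esub> h b \<in> Q"
      using e unfolding ab(3,4) q[OF ab(1)] q[OF ab(2)]
      using S.coset_eq_iff[OF Q.is_ideal hom_closed[OF ab(1)] hom_closed[OF ab(2)]] by blast
    then have "h (a \<ominus> b) \<in> Q"
      using ab by (simp add: a_minus_def)
    then have "a \<ominus> b \<in> ?P"
      unfolding contract_def using ab(1,2) by blast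
    then show "x = y" unfolding ab(3,4) using R.coset_eq_iff[OF P.is_ideal ab(1,2)] by blast
  qed
  have nz: "?P +> s \<in> nonzerodivisors (R Quot ?P) \<longleftrightarrow> h s \<notin> Q" if "s \<in> carrier R" for s
  proof -
    have "s \<in> ?P \<longleftrightarrow> h s \<in> Q" unfolding contract_def using that by blast
    then show ?thesis
      unfolding nonzerodivisors_domain[OF dR] Diff_iff singleton_iff R.coset_zero_iff[OF P.is_ideal that]
      using p.hom_closed[OF that] by blast
  qed
  have nzd: "?g x \<in> nonzerodivisors (S Quot Q)" if "x \<in> nonzerodivisors (R Quot ?P)" for x
  proof -
    have "x \<in> carrier (R Quot ?P)" using that by (simp add: nonzerodivisors_def)
    then obtain a where a: "a \<in> carrier R" "x = ?P +> a" by (auto simp: carrier_Quot)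
    then have "h a \<notin> Q" using that nz by simp
    then show ?thesis
      using a unfolding nonzerodivisors_domain[OF dS]
      by (simp add: q S.coset_zero_iff[OF Q.is_ideal])
  qed
  have "(\<forall>x\<in>carrier (S Quot Q). \<exists>s\<in>nonzerodivisors (R Quot ?P). \<exists>a\<in>carrier (R Quot ?P).
      ?g s \<otimes>\<^bsub>S Quot Q\<^esub> x = ?g a) \<longleftrightarrow> residually_trivial R S h Q" (is "?L \<longleftrightarrow> _")
  proof -
    have eq: "?g (?P +> s) \<otimes>\<^bsub>S Quot Q\<^esub> (Q +>\<^bsub>S\<^esub> x) = ?g (?P +> a)
        \<longleftrightarrow> h s \<otimes>\<^bsub>S\<^esub> x \<ominus>\<^bsub>S\<^esub> h a \<in> Q"
      if "s \<in> carrier R" "a \<in> carrier R" "x \<in> carrier S" for s a x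
    proof -
      have "?g (?P +> s) \<otimes>\<^bsub>S Quot Q\<^esub> (Q +>\<^bsub>S\<^esub> x) = Q +>\<^bsub>S\<^esub> (h s \<otimes>\<^bsub>S\<^esub> x)"
        using that by (simp add: q)
      then show ?thesis
        using that S.coset_eq_iff[OF Q.is_ideal, of "h s \<otimes>\<^bsub>S\<^esub> x" "h a"] by (simp add: q)
    qed
    show ?thesis
    proof
      assume L: ?L
      show "residually_trivial R S h Q"
        unfolding residually_trivial_def
      proof
        fix x assume x: "x \<in> carrier S"
        then obtain s' a' where *: "s' \<in> nonzerodivisors (R Quot ?P)" "a' \<in> carrier (R Quot ?P)"
          "?g s' \<otimes>\<^bsub>S Quot Q\<^esub> (Q +>\<^bsub>S\<^esub> x) = ?g a'"
          using L q.hom_closed by blast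
        then obtain s a where "s \<in> carrier R" "a \<in> carrier R" "s' = ?P +> s" "a' = ?P +> a"
          using g.R.nonzerodivisors_closed[OF *(1)] *(2) unfolding carrier_Quot by blast
        then show "\<exists>s\<in>carrier R. \<exists>a\<in>carrier R. h s \<notin> Q \<and> h s \<otimes>\<^bsub>S\<^esub> x \<ominus>\<^bsub>S\<^esub> h a \<in> Q"
          using * nz eq x by metis
      qed
    next
      assume R: "residually_trivial R S h Q"
      show ?L
      proof
        fix x' assume "x' \<in> carrier (S Quot Q)"
        then obtain x where x: "x \<in> carrier S" "x' = Q +>\<^bsub>S\<^esub> x" by (auto simp: carrier_Quot)
        then obtain s a where "s \<in> carrier R" "a \<in> carrier R" "h s \<notin> Q" "h s \<otimes>\<^bsub>S\<^esub> x \<ominus>\<^bsub>S\<^esub> h a \<in> Q"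
          using R unfolding residually_trivial_def by blast
        then show "\<exists>s\<in>nonzerodivisors (R Quot ?P). \<exists>a\<in>carrier (R Quot ?P). ?g s \<otimes>\<^bsub>S Quot Q\<^esub> x' = ?g a"
          using nz eq x p.hom_closed by metis
      qed
    qed
  qed
  with g.frac_map_iso_iff[OF nzd inj dS] show ?thesis
    by (simp add: residue_field_def)
qed

lemma spec_residue_iso_iff:
  assumes "ring_hom_cring A T f"
  shows "spec_residue_iso A T f \<longleftrightarrow> bij_betw (contract A f) (Spec T) (Spec A) \<and>
    (\<forall>Q\<in>Spec T. residually_trivial A T f Q)"
proof -
  interpret ring_hom_cring A T f by fact
  show ?thesis
    unfolding spec_residue_iso_def using homh frac_map_residue_iso_iff by auto
qed

section \<open>Seminormalization inside an integral extension\<close>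

lemma integral_over_mono: "integral_over Q K x \<Longrightarrow> K \<subseteq> L \<Longrightarrow> integral_over Q L x"
  unfolding integral_over_def by (meson subset_trans)

lemma (in cring) subring_cring:
  assumes "subring S R"
  shows "cring (R\<lparr>carrier := S\<rparr>)"
  using subcring_iff[OF subringE(1)[OF assms]] subcringI'[OF assms] by blast

lemma (in cring) subring_inclusion_hom:
  assumes "subring S R"
  shows "ring_hom_cring (R\<lparr>carrier := S\<rparr>) R id"
proof -
  interpret S: cring "R\<lparr>carrier := S\<rparr>" by (rule subring_cring[OF assms])
  show ?thesis
    by unfold_locales (use subringE(1)[OF assms] in \<open>auto intro!: ring_hom_memI\<close>)
qed

lemma (in ring_hom_cring) hom_into_subring:
  assumes "subring B S" "h ` carrier R \<subseteq> B"
  shows "ring_hom_cring R (S\<lparr>carrier := B\<rparr>) h"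
proof -
  interpret B: cring "S\<lparr>carrier := B\<rparr>" by (rule S.subring_cring[OF assms(1)])
  show ?thesis
    by unfold_locales (use assms(2) in \<open>auto intro!: ring_hom_memI\<close>)
qed

lemma (in cring) subring_minus:
  assumes "subring S R" "x \<in> S" "y \<in> S"
  shows "x \<ominus>\<^bsub>R\<lparr>carrier := S\<rparr>\<^esub> y = x \<ominus> y"
proof -
  interpret S: ring_hom_cring "R\<lparr>carrier := S\<rparr>" R id by (rule subring_inclusion_hom[OF assms(1)])
  have "id (\<ominus>\<^bsub>R\<lparr>carrier := S\<rparr>\<^esub> y) = \<ominus> id y"
    using assms(3) by (intro S.hom_a_inv) simp
  then show ?thesis by (simp add: a_minus_def)
qed

text \<open>Traverso's description of the seminormalization of \<open>A\<close> in an integral extension \<open>N\<close>: the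
  elements \<open>y\<close> that lie in \<open>A\<^sub>p\<close> plus the Jacobson radical of \<open>N\<^sub>p\<close>, for all primes \<open>p\<close> of \<open>A\<close>.
  The maximal ideals of \<open>N\<^sub>p\<close> are the primes over \<open>p\<close>, so \<open>y\<close> must have the same value \<open>a/s\<close> at all of them.\<close>

definition pointwise_closure ::
  "('a, 'm) ring_scheme \<Rightarrow> ('b, 'n) ring_scheme \<Rightarrow> ('a \<Rightarrow> 'b) \<Rightarrow> 'b set" where
  "pointwise_closure A N f = {y \<in> carrier N. \<forall>p\<in>Spec A. \<exists>s\<in>carrier A. \<exists>a\<in>carrier A.
     s \<notin> p \<and> (\<forall>Q\<in>Spec N. contract A f Q = p \<longrightarrow> f s \<otimes>\<^bsub>N\<^esub> y \<ominus>\<^bsub>N\<^esub> f a \<in> Q)}"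

context ring_hom_cring
begin

lemma pointwise_closureI:
  assumes "y \<in> carrier S"
    and "\<And>p. p \<in> Spec R \<Longrightarrow> \<exists>s\<in>carrier R. \<exists>a\<in>carrier R. s \<notin> p \<and>
      (\<forall>Q\<in>Spec S. contract R h Q = p \<longrightarrow> h s \<otimes>\<^bsub>S\<^esub> y \<ominus>\<^bsub>S\<^esub> h a \<in> Q)"
  shows "y \<in> pointwise_closure R S h"
  using assms by (simp add: pointwise_closure_def)

lemma pointwise_closureE:
  assumes "y \<in> pointwise_closure R S h" "p \<in> Spec R"
  obtains s a where "s \<in> carrier R" "a \<in> carrier R" "s \<notin> p"
    "\<And>Q. Q \<in> Spec S \<Longrightarrow> contract R h Q = p \<Longrightarrow> h s \<otimes>\<^bsub>S\<^esub> y \<ominus>\<^bsub>S\<^esub> h a \<in> Q"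
proof -
  have "\<exists>s\<in>carrier R. \<exists>a\<in>carrier R. s \<notin> p \<and>
      (\<forall>Q\<in>Spec S. contract R h Q = p \<longrightarrow> h s \<otimes>\<^bsub>S\<^esub> y \<ominus>\<^bsub>S\<^esub> h a \<in> Q)"
    using assms by (simp add: pointwise_closure_def)
  then show ?thesis using that by metis
qed

lemma pointwise_closure_carrier: "y \<in> pointwise_closure R S h \<Longrightarrow> y \<in> carrier S"
  by (simp add: pointwise_closure_def)

lemma image_subset_pointwise_closure: "h ` carrier R \<subseteq> pointwise_closure R S h"
proof
  fix y assume "y \<in> h ` carrier R"
  then obtain b where b: "b \<in> carrier R" "y = h b" by blast
  show "y \<in> pointwise_closure R S h"
  proof (rule pointwise_closureI)
    fix p assume p: "p \<in> Spec R"
    have "h \<one>\<^bsub>R\<^esub> \<otimes>\<^bsub>S\<^esub> y \<ominus>\<^bsub>S\<^esub> h b \<in> Q" if "Q \<in> Spec S" for Q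
    proof -
      interpret Q: primeideal Q S using that by (simp add: Spec_iff)
      show ?thesis using b by (simp add: a_minus_def S.r_neg Q.zero_closed)
    qed
    then show "\<exists>s\<in>carrier R. \<exists>a\<in>carrier R. s \<notin> p \<and>
        (\<forall>Q\<in>Spec S. contract R h Q = p \<longrightarrow> h s \<otimes>\<^bsub>S\<^esub> y \<ominus>\<^bsub>S\<^esub> h a \<in> Q)"
      using Spec_one_notin[OF p] b(1) R.one_closed by blast
  qed (use b in simp)
qed

lemma
  assumes y: "y \<in> pointwise_closure R S h" and z: "z \<in> pointwise_closure R S h"
  shows pointwise_closure_mult: "y \<otimes>\<^bsub>S\<^esub> z \<in> pointwise_closure R S h"
    and pointwise_closure_add: "y \<oplus>\<^bsub>S\<^esub> z \<in> pointwise_closure R S h"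
proof -
  have c: "y \<in> carrier S" "z \<in> carrier S" using y z by (auto dest: pointwise_closure_carrier)
  have both: "\<exists>s\<in>carrier R. \<exists>t\<in>carrier R. \<exists>a\<in>carrier R. \<exists>b\<in>carrier R. s \<otimes> t \<notin> p \<and>
    (\<forall>Q\<in>Spec S. contract R h Q = p \<longrightarrow> h s \<otimes>\<^bsub>S\<^esub> y \<ominus>\<^bsub>S\<^esub> h a \<in> Q \<and> h t \<otimes>\<^bsub>S\<^esub> z \<ominus>\<^bsub>S\<^esub> h b \<in> Q)"
    if p: "p \<in> Spec R" for p
  proof -
    obtain s a where s: "s \<in> carrier R" "a \<in> carrier R" "s \<notin> p"
      "\<And>Q. Q \<in> Spec S \<Longrightarrow> contract R h Q = p \<Longrightarrow> h s \<otimes>\<^bsub>S\<^esub> y \<ominus>\<^bsub>S\<^esub> h a \<in> Q"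
      by (rule pointwise_closureE[OF y p], rule that)
    obtain t b where t: "t \<in> carrier R" "b \<in> carrier R" "t \<notin> p"
      "\<And>Q. Q \<in> Spec S \<Longrightarrow> contract R h Q = p \<Longrightarrow> h t \<otimes>\<^bsub>S\<^esub> z \<ominus>\<^bsub>S\<^esub> h b \<in> Q"
      by (rule pointwise_closureE[OF z p], rule that)
    show ?thesis
      using Spec_mult_notin[OF p s(1) t(1) s(3) t(3)] s t by blast
  qed
  show "y \<otimes>\<^bsub>S\<^esub> z \<in> pointwise_closure R S h"
  proof (rule pointwise_closureI)
    fix p assume "p \<in> Spec R"
    from both[OF this] obtain s t a b where st: "s \<in> carrier R" "t \<in> carrier R" "a \<in> carrier R" "b \<in> carrier R"
      "s \<otimes> t \<notin> p" and Q: "\<And>Q. Q \<in> Spec S \<Longrightarrow> contract R h Q = p \<Longrightarrow> h s \<otimes>\<^bsub>S\<^esub> y \<ominus>\<^bsub>S\<^esub> h a \<in> Q"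
        "\<And>Q. Q \<in> Spec S \<Longrightarrow> contract R h Q = p \<Longrightarrow> h t \<otimes>\<^bsub>S\<^esub> z \<ominus>\<^bsub>S\<^esub> h b \<in> Q" by metis
    have "h (s \<otimes> t) \<otimes>\<^bsub>S\<^esub> (y \<otimes>\<^bsub>S\<^esub> z) \<ominus>\<^bsub>S\<^esub> h (a \<otimes> b) \<in> Q" if "Q \<in> Spec S" "contract R h Q = p" for Q
      using S.congruent_fraction_mult[OF Spec_ideal[OF that(1)] _ _ _ _ c Q[OF that]] st by simp
    with st(5) show "\<exists>s\<in>carrier R. \<exists>a\<in>carrier R. s \<notin> p \<and>
        (\<forall>Q\<in>Spec S. contract R h Q = p \<longrightarrow> h s \<otimes>\<^bsub>S\<^esub> (y \<otimes>\<^bsub>S\<^esub> z) \<ominus>\<^bsub>S\<^esub> h a \<in> Q)"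
      using R.m_closed[OF st(1,2)] R.m_closed[OF st(3,4)] by blast
  qed (use c in simp)
  show "y \<oplus>\<^bsub>S\<^esub> z \<in> pointwise_closure R S h"
  proof (rule pointwise_closureI)
    fix p assume "p \<in> Spec R"
    from both[OF this] obtain s t a b where st: "s \<in> carrier R" "t \<in> carrier R" "a \<in> carrier R" "b \<in> carrier R"
      "s \<otimes> t \<notin> p" and Q: "\<And>Q. Q \<in> Spec S \<Longrightarrow> contract R h Q = p \<Longrightarrow> h s \<otimes>\<^bsub>S\<^esub> y \<ominus>\<^bsub>S\<^esub> h a \<in> Q"
        "\<And>Q. Q \<in> Spec S \<Longrightarrow> contract R h Q = p \<Longrightarrow> h t \<otimes>\<^bsub>S\<^esub> z \<ominus>\<^bsub>S\<^esub> h b \<in> Q" by metis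
    have "h (s \<otimes> t) \<otimes>\<^bsub>S\<^esub> (y \<oplus>\<^bsub>S\<^esub> z) \<ominus>\<^bsub>S\<^esub> h (t \<otimes> a \<oplus> s \<otimes> b) \<in> Q"
      if "Q \<in> Spec S" "contract R h Q = p" for Q
      using S.congruent_fraction_add[OF Spec_ideal[OF that(1)] _ _ _ _ c Q[OF that]] st by simp
    with st(5) show "\<exists>s\<in>carrier R. \<exists>a\<in>carrier R. s \<notin> p \<and>
        (\<forall>Q\<in>Spec S. contract R h Q = p \<longrightarrow> h s \<otimes>\<^bsub>S\<^esub> (y \<oplus>\<^bsub>S\<^esub> z) \<ominus>\<^bsub>S\<^esub> h a \<in> Q)"
      using R.m_closed[OF st(1,2)] R.a_closed[OF R.m_closed[OF st(2,3)] R.m_closed[OF st(1,4)]] by blast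
  qed (use c in simp)
qed

lemma pointwise_closure_subring: "subring (pointwise_closure R S h) S"
proof (rule S.subringI)
  show "pointwise_closure R S h \<subseteq> carrier S" using pointwise_closure_carrier by blast
  show one: "\<one>\<^bsub>S\<^esub> \<in> pointwise_closure R S h"
    using image_subset_pointwise_closure imageI[of "\<one>" "carrier R" h] by auto
  fix y assume y: "y \<in> pointwise_closure R S h"
  have "h (\<ominus> \<one>) \<in> pointwise_closure R S h"
    using image_subset_pointwise_closure imageI[of "\<ominus> \<one>" "carrier R" h] R.a_inv_closed[OF R.one_closed] by blast
  from pointwise_closure_mult[OF this y] show "\<ominus>\<^bsub>S\<^esub> y \<in> pointwise_closure R S h"
    using pointwise_closure_carrier[OF y] by (simp add: S.l_minus)
qed (use pointwise_closure_mult pointwise_closure_add in auto)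

lemma lying_over_zero:
  assumes int: "\<And>t. t \<in> carrier S \<Longrightarrow> integral_over S (h ` carrier R) t"
    and inj: "inj_on h (carrier R)" and p: "p \<in> Spec R"
  obtains P where "P \<in> Spec S" "contract R h P = p"
proof -
  have "contract R h {\<zero>\<^bsub>S\<^esub>} \<subseteq> p"
  proof
    fix a assume "a \<in> contract R h {\<zero>\<^bsub>S\<^esub>}"
    then have a: "a \<in> carrier R" "h a = h \<zero>\<^bsub>R\<^esub>" by (simp_all add: contract_def)
    then have "a = \<zero>\<^bsub>R\<^esub>" using inj_onD[OF inj a(2) a(1)] by simp
    moreover have "additive_subgroup p R"
      using p unfolding Spec_iff by (intro ideal.axioms(1) primeideal.axioms(1))
    ultimately show "a \<in> p" using additive_subgroup.zero_closed by blast
  qed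
  from lying_over[OF int S.zeroideal p this] that show ?thesis by metis
qed

text \<open>The large ring is integral over the intermediate ring \<open>B\<close> as well, so lying over applies to
  the inclusion of \<open>B\<close>.\<close>

lemma Spec_subring_lift:
  assumes int: "\<And>t. t \<in> carrier S \<Longrightarrow> integral_over S (h ` carrier R) t"
    and B: "subring B S" "h ` carrier R \<subseteq> B" and Q: "Q \<in> Spec (S\<lparr>carrier := B\<rparr>)"
  obtains Q' where "Q' \<in> Spec S" "Q = B \<inter> Q'" "contract R h Q' = contract R h Q"
proof -
  interpret B: ring_hom_cring "S\<lparr>carrier := B\<rparr>" S id by (rule S.subring_inclusion_hom[OF B(1)])
  have QB: "Q \<subseteq> B"
    using Q additive_subgroup.a_subset[OF ideal.axioms(1)[OF primeideal.axioms(1)]]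
    by (fastforce simp: Spec_iff)
  have "integral_over S (id ` carrier (S\<lparr>carrier := B\<rparr>)) t" if "t \<in> carrier S" for t
    using integral_over_mono[OF int[OF that]] B(2) by simp
  then obtain Q' where Q': "Q' \<in> Spec S" "contract (S\<lparr>carrier := B\<rparr>) id Q' = Q"
    by (rule B.lying_over_zero) (use Q in \<open>auto simp: inj_on_def\<close>)
  have e: "Q = B \<inter> Q'" using Q'(2) by (auto simp: contract_def)
  have "contract R h Q' = contract R h Q"
    unfolding contract_def e using B(2) by blast
  with Q'(1) e show ?thesis by (rule that)
qed

lemma Spec_subring_restrict:
  assumes B: "subring B S" "h ` carrier R \<subseteq> B" and Q: "Q \<in> Spec S"
  shows "B \<inter> Q \<in> Spec (S\<lparr>carrier := B\<rparr>)" "contract R h (B \<inter> Q) = contract R h Q"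
proof -
  interpret B: ring_hom_cring "S\<lparr>carrier := B\<rparr>" S id by (rule S.subring_inclusion_hom[OF B(1)])
  have "contract (S\<lparr>carrier := B\<rparr>) id Q = B \<inter> Q" by (auto simp: contract_def)
  then show "B \<inter> Q \<in> Spec (S\<lparr>carrier := B\<rparr>)"
    using contract_Spec[OF B.ring_hom_cring_axioms Q] by simp
  show "contract R h (B \<inter> Q) = contract R h Q"
    unfolding contract_def using B(2) by blast
qed

text \<open>An element of the closure has one value \<open>a/s\<close> at all primes over \<open>p\<close>, and it lies in such a prime
  iff \<open>a\<close> lies in \<open>p\<close>; hence the closure has only one prime over \<open>p\<close>, with the residue field of
  \<open>p\<close>.\<close>

theorem spec_residue_iso_pointwise_closure:
  assumes int: "\<And>t. t \<in> carrier S \<Longrightarrow> integral_over S (h ` carrier R) t"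
    and inj: "inj_on h (carrier R)"
  shows "spec_residue_iso R (S\<lparr>carrier := pointwise_closure R S h\<rparr>) h"
proof -
  let ?B = "pointwise_closure R S h"
  let ?T = "S\<lparr>carrier := ?B\<rparr>"
  note B = pointwise_closure_subring image_subset_pointwise_closure
  interpret T: ring_hom_cring R ?T h by (rule hom_into_subring[OF B])
  have int': "integral_over ?T (h ` carrier R) t" if "t \<in> carrier ?T" for t
    using that int pointwise_closure_carrier integral_over_subring[OF S.ring_axioms B(1)] by simp
  have sub: "Q \<subseteq> Q'" if Q: "Q \<in> Spec ?T" "Q' \<in> Spec ?T" "contract R h Q = contract R h Q'" for Q Q'
  proof
    fix x assume x: "x \<in> Q"
    let ?p = "contract R h Q'"
    have p: "?p \<in> Spec R" by (rule contract_Spec[OF T.ring_hom_cring_axioms Q(2)])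
    obtain Q1 where Q1: "Q1 \<in> Spec S" "Q = ?B \<inter> Q1" "contract R h Q1 = ?p"
      using Spec_subring_lift[OF int B Q(1)] unfolding Q(3) .
    obtain Q2 where Q2: "Q2 \<in> Spec S" "Q' = ?B \<inter> Q2" "contract R h Q2 = ?p"
      using Spec_subring_lift[OF int B Q(2)] .
    have xB: "x \<in> ?B" "x \<in> Q1" using x Q1(2) by auto
    have xS: "x \<in> carrier S" using pointwise_closure_carrier[OF xB(1)] .
    obtain s a where s: "s \<in> carrier R" "a \<in> carrier R" "s \<notin> ?p"
      "\<And>Q. Q \<in> Spec S \<Longrightarrow> contract R h Q = ?p \<Longrightarrow> h s \<otimes>\<^bsub>S\<^esub> x \<ominus>\<^bsub>S\<^esub> h a \<in> Q"
      by (rule pointwise_closureE[OF xB(1) p], rule that)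
    have c: "h s \<in> carrier S" "h a \<in> carrier S" using s by auto
    interpret Q1: primeideal Q1 S using Q1(1) by (simp add: Spec_iff)
    interpret Q2: primeideal Q2 S using Q2(1) by (simp add: Spec_iff)
    have "h s \<otimes>\<^bsub>S\<^esub> x \<ominus>\<^bsub>S\<^esub> (h s \<otimes>\<^bsub>S\<^esub> x \<ominus>\<^bsub>S\<^esub> h a) \<in> Q1"
      using S.ideal_minus_closed[OF Q1.is_ideal Q1.I_l_closed[OF xB(2) c(1)] s(4)[OF Q1(1,3)]] .
    moreover have "h s \<otimes>\<^bsub>S\<^esub> x \<ominus>\<^bsub>S\<^esub> (h s \<otimes>\<^bsub>S\<^esub> x \<ominus>\<^bsub>S\<^esub> h a) = h a"
      using c xS by algebra
    ultimately have "a \<in> contract R h Q1" using s(2) by (simp add: contract_def)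
    then have "h a \<in> Q2" unfolding Q1(3) Q2(3)[symmetric] by (simp add: contract_def)
    then have "(h s \<otimes>\<^bsub>S\<^esub> x \<ominus>\<^bsub>S\<^esub> h a) \<oplus>\<^bsub>S\<^esub> h a \<in> Q2"
      using s(4)[OF Q2(1,3)] by simp
    moreover have "(h s \<otimes>\<^bsub>S\<^esub> x \<ominus>\<^bsub>S\<^esub> h a) \<oplus>\<^bsub>S\<^esub> h a = h s \<otimes>\<^bsub>S\<^esub> x"
      using c xS by algebra
    moreover have "h s \<notin> Q2" using s(1,3) unfolding Q2(3)[symmetric] by (simp add: contract_def)
    ultimately have "x \<in> Q2" using primeideal_cancel[OF Q2(1) c(1) xS] by simp
    then show "x \<in> Q'" using Q2(2) xB(1) by simp
  qed
  have "bij_betw (contract R h) (Spec ?T) (Spec R)"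
  proof (rule bij_betw_imageI)
    show "inj_on (contract R h) (Spec ?T)"
      by (rule inj_onI) (use sub in blast)
    show "contract R h ` Spec ?T = Spec R"
    proof
      show "contract R h ` Spec ?T \<subseteq> Spec R" using contract_Spec[OF T.ring_hom_cring_axioms] by blast
      show "Spec R \<subseteq> contract R h ` Spec ?T"
      proof
        fix p assume "p \<in> Spec R"
        then obtain P where "P \<in> Spec ?T" "contract R h P = p"
          using T.lying_over_zero[OF int' inj] by metis
        then show "p \<in> contract R h ` Spec ?T" by blast
      qed
    qed
  qed
  moreover have "residually_trivial R ?T h Q" if Q: "Q \<in> Spec ?T" for Q
    unfolding residually_trivial_def
  proof
    fix x assume "x \<in> carrier ?T"
    then have x: "x \<in> ?B" by simp
    have p: "contract R h Q \<in> Spec R" by (rule contract_Spec[OF T.ring_hom_cring_axioms Q])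
    obtain s a where s: "s \<in> carrier R" "a \<in> carrier R" "s \<notin> contract R h Q"
      "\<And>Q'. Q' \<in> Spec S \<Longrightarrow> contract R h Q' = contract R h Q \<Longrightarrow> h s \<otimes>\<^bsub>S\<^esub> x \<ominus>\<^bsub>S\<^esub> h a \<in> Q'"
      by (rule pointwise_closureE[OF x p], rule that)
    obtain Q' where Q': "Q' \<in> Spec S" "Q = ?B \<inter> Q'" "contract R h Q' = contract R h Q"
      using Spec_subring_lift[OF int B Q] .
    have hB: "h s \<in> ?B" "h a \<in> ?B" using B(2) s(1,2) by auto
    have "h s \<otimes>\<^bsub>S\<^esub> x \<in> ?B" using subringE(6)[OF B(1) hB(1) x] .
    then have "h s \<otimes>\<^bsub>S\<^esub> x \<ominus>\<^bsub>S\<^esub> h a \<in> ?B" "h s \<otimes>\<^bsub>?T\<^esub> x \<ominus>\<^bsub>?T\<^esub> h a = h s \<otimes>\<^bsub>S\<^esub> x \<ominus>\<^bsub>S\<^esub> h a"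
      using subringE(7)[OF B(1) _ subringE(5)[OF B(1) hB(2)]] S.subring_minus[OF B(1) _ hB(2)]
      by (simp_all add: a_minus_def)
    then have "h s \<otimes>\<^bsub>?T\<^esub> x \<ominus>\<^bsub>?T\<^esub> h a \<in> Q"
      using s(4)[OF Q'(1,3)] Q'(2) by simp
    moreover have "h s \<notin> Q" using s(1,3) by (simp add: contract_def)
    ultimately show "\<exists>s\<in>carrier R. \<exists>a\<in>carrier R. h s \<notin> Q \<and> h s \<otimes>\<^bsub>?T\<^esub> x \<ominus>\<^bsub>?T\<^esub> h a \<in> Q"
      using s(1,2) by blast
  qed
  ultimately show ?thesis
    unfolding spec_residue_iso_iff[OF T.ring_hom_cring_axioms] by blast
qed

text \<open>If \<open>B\<close> has only one prime \<open>P\<close> over \<open>p\<close>, then all primes of the large ring over \<open>p\<close> contract to \<open>P\<close>,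
  and a value at \<open>P\<close> is a value at all of them.\<close>

theorem subset_pointwise_closure:
  assumes B: "subring B S" "h ` carrier R \<subseteq> B"
    and iso: "spec_residue_iso R (S\<lparr>carrier := B\<rparr>) h"
  shows "B \<subseteq> pointwise_closure R S h"
proof
  let ?T = "S\<lparr>carrier := B\<rparr>"
  interpret T: ring_hom_cring R ?T h by (rule hom_into_subring[OF B])
  have bij: "bij_betw (contract R h) (Spec ?T) (Spec R)"
    and res: "\<And>Q. Q \<in> Spec ?T \<Longrightarrow> residually_trivial R ?T h Q"
    using iso unfolding spec_residue_iso_iff[OF T.ring_hom_cring_axioms] by blast+
  fix x assume x: "x \<in> B"
  show "x \<in> pointwise_closure R S h"
  proof (rule pointwise_closureI)
    show "x \<in> carrier S" using x subringE(1)[OF B(1)] by blast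
    fix p assume "p \<in> Spec R"
    then have "p \<in> contract R h ` Spec ?T"
      unfolding bij_betw_imp_surj_on[OF bij] .
    then obtain P where P: "P \<in> Spec ?T" "contract R h P = p"
      by (elim imageE) (rule that, simp_all)
    have "x \<in> carrier ?T" using x by simp
    then obtain s a where s: "s \<in> carrier R" "a \<in> carrier R" "h s \<notin> P" "h s \<otimes>\<^bsub>?T\<^esub> x \<ominus>\<^bsub>?T\<^esub> h a \<in> P"
      using res[OF P(1)] unfolding residually_trivial_def by blast
    have hB: "h s \<in> B" "h a \<in> B" using B(2) s(1,2) by auto
    have "h s \<otimes>\<^bsub>S\<^esub> x \<in> B" using subringE(6)[OF B(1) hB(1) x] .
    then have e: "h s \<otimes>\<^bsub>?T\<^esub> x \<ominus>\<^bsub>?T\<^esub> h a = h s \<otimes>\<^bsub>S\<^esub> x \<ominus>\<^bsub>S\<^esub> h a"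
      using S.subring_minus[OF B(1) _ hB(2)] by simp
    have "h s \<otimes>\<^bsub>S\<^esub> x \<ominus>\<^bsub>S\<^esub> h a \<in> Q" if Q: "Q \<in> Spec S" "contract R h Q = p" for Q
    proof -
      have "contract R h (B \<inter> Q) = contract R h P"
        using Spec_subring_restrict(2)[OF B Q(1)] Q(2) P(2) by simp
      then have "B \<inter> Q = P"
        using inj_onD[OF bij_betw_imp_inj_on[OF bij]] Spec_subring_restrict(1)[OF B Q(1)] P(1) by blast
      then show ?thesis using s(4) unfolding e by blast
    qed
    moreover have "s \<notin> p" using s(1,3) P(2) by (auto simp: contract_def)
    ultimately show "\<exists>s\<in>carrier R. \<exists>a\<in>carrier R. s \<notin> p \<and>
        (\<forall>Q\<in>Spec S. contract R h Q = p \<longrightarrow> h s \<otimes>\<^bsub>S\<^esub> x \<ominus>\<^bsub>S\<^esub> h a \<in> Q)"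
      using s(1,2) by blast
  qed
qed

end

section \<open>Normalization and existence of the seminormalization\<close>

lemma (in cring) normalization_subring: "subring (carrier (normalization R)) (total_fractions R)"
proof -
  interpret Q: ring_hom_cring R "total_fractions R" "to_frac R" by (rule to_frac_hom)
  have "subring (to_frac R ` carrier R) (total_fractions R)"
    by (rule Q.S.ring_incl_imp_subring[OF _ Q.ring.img_is_ring]) auto
  then interpret cring_with_subring "total_fractions R" "to_frac R ` carrier R"
    using total_fractions_cring by (intro cring_with_subring.intro cring_with_subring_axioms.intro)
  show ?thesis using integral_closure_subring by (simp add: normalization_def)
qed

lemma normalization_eq:
  "normalization R = (total_fractions R)\<lparr>carrier := carrier (normalization R)\<rparr>"
  by (simp add: normalization_def)

lemma (in cring) normalization_cring: "cring (normalization R)"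
  using cring.subring_cring[OF total_fractions_cring normalization_subring]
  by (simp add: normalization_eq[symmetric])

lemma (in cring) normalization_integral:
  assumes "x \<in> carrier (normalization R)"
  shows "integral_over (normalization R) (to_frac R ` carrier R) x"
  using assms integral_over_subring[OF cring.axioms(1)[OF total_fractions_cring] normalization_subring]
  by (simp add: normalization_eq[symmetric]) (simp add: normalization_def)

lemma (in cring) to_frac_normalization_hom: "ring_hom_cring R (normalization R) (to_frac R)"
proof -
  interpret Q: ring_hom_cring R "total_fractions R" "to_frac R" by (rule to_frac_hom)
  have "subring (to_frac R ` carrier R) (total_fractions R)"
    by (rule Q.S.ring_incl_imp_subring[OF _ Q.ring.img_is_ring]) auto
  then interpret cring_with_subring "total_fractions R" "to_frac R ` carrier R"
    using total_fractions_cring by (intro cring_with_subring.intro cring_with_subring_axioms.intro)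
  have "to_frac R ` carrier R \<subseteq> carrier (normalization R)"
    using integral_over_K K_carrier by (auto simp: normalization_def)
  from Q.hom_into_subring[OF normalization_subring this]
  show ?thesis by (simp add: normalization_eq[symmetric])
qed

theorem (in cring) is_seminormalization_pointwise_closure:
  "is_seminormalization R (pointwise_closure R (normalization R) (to_frac R))"
proof -
  interpret N: ring_hom_cring R "normalization R" "to_frac R" by (rule to_frac_normalization_hom)
  note int = normalization_integral
  show ?thesis
    unfolding is_seminormalization_def subintegral_intermediate_def
    using N.pointwise_closure_subring N.image_subset_pointwise_closure
      N.spec_residue_iso_pointwise_closure[OF int to_frac_inj] N.subset_pointwise_closure by blast
qed

section \<open>Extending homomorphisms along subintegral extensions\<close>

lemma (in noetherian_ring) maximal_in_ideal_family:
  assumes "F \<noteq> {}" "\<And>I. I \<in> F \<Longrightarrow> ideal I R"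
  shows "\<exists>J\<in>F. \<forall>K\<in>F. J \<subseteq> K \<longrightarrow> K = J"
proof (rule subset_Zorn_nonempty[OF assms(1)])
  fix C assume C: "C \<noteq> {}" "subset.chain F C"
  then have CF: "C \<subseteq> F" by (simp add: subset_chain_def)
  then have "C \<subseteq> {I. ideal I R}"
    using assms(2) by (intro subsetI CollectI) (rule assms(2), rule subsetD)
  then have "subset.chain {I. ideal I R} C"
    using C(2) by (simp add: subset_chain_def)
  from ideal_chain_is_trivial[OF C(1) this] show "\<Union>C \<in> F"
    using CF by (rule rev_subsetD)
qed

definition von_neumann_regular :: "('a, 'm) ring_scheme \<Rightarrow> bool" where
  "von_neumann_regular E \<longleftrightarrow> (\<forall>z\<in>carrier E. \<exists>z'\<in>carrier E. z \<otimes>\<^bsub>E\<^esub> z \<otimes>\<^bsub>E\<^esub> z' = z)"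

text \<open>The question for such a pair of homomorphisms \<open>T \<leftarrow> A \<rightarrow> E\<close> is whether \<open>f\<close> extends along \<open>i\<close>.\<close>

locale hom_span = i: ring_hom_cring A T i + f: ring_hom_cring A E f
  for A :: "('a, 'm) ring_scheme" and T :: "('b, 'n) ring_scheme" and i
    and E :: "('c, 'k) ring_scheme" (structure) and f
begin

text \<open>\<open>x\<close> and \<open>y\<close> have the same value \<open>a/s\<close> in the residue field of \<open>A\<close> below \<open>P\<close> and \<open>M\<close>.\<close>

definition agree_at :: "'b set \<Rightarrow> 'c set \<Rightarrow> 'b \<Rightarrow> 'c \<Rightarrow> bool" where
  "agree_at P M x y \<longleftrightarrow> (\<exists>s\<in>carrier A. \<exists>a\<in>carrier A.
     f s \<notin> M \<and> i s \<otimes>\<^bsub>T\<^esub> x \<ominus>\<^bsub>T\<^esub> i a \<in> P \<and> f s \<otimes> y \<ominus> f a \<in> M)"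

lemma agree_atI:
  assumes "s \<in> carrier A" "a \<in> carrier A" "f s \<notin> M" "i s \<otimes>\<^bsub>T\<^esub> x \<ominus>\<^bsub>T\<^esub> i a \<in> P"
    "f s \<otimes> y \<ominus> f a \<in> M"
  shows "agree_at P M x y"
  using assms unfolding agree_at_def by blast

lemma agree_atE:
  assumes "agree_at P M x y"
  obtains s a where "s \<in> carrier A" "a \<in> carrier A" "f s \<notin> M" "i s \<otimes>\<^bsub>T\<^esub> x \<ominus>\<^bsub>T\<^esub> i a \<in> P"
    "f s \<otimes> y \<ominus> f a \<in> M"
  using assms unfolding agree_at_def by blast

context
  fixes P M
  assumes P: "P \<in> Spec T" and M: "M \<in> Spec E" and PM: "contract A i P = contract A f M"
begin

interpretation P: primeideal P T using P by (simp add: Spec_iff)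
interpretation M: primeideal M E using M by (simp add: Spec_iff)

lemma agree_contract: "a \<in> carrier A \<Longrightarrow> i a \<in> P \<longleftrightarrow> f a \<in> M"
  using PM unfolding contract_def by blast

lemma agree_at_mult_notin:
  assumes "s \<in> carrier A" "t \<in> carrier A" "f s \<notin> M" "f t \<notin> M"
  shows "f (s \<otimes>\<^bsub>A\<^esub> t) \<notin> M"
  using assms M.I_prime[of "f s" "f t"] by auto

lemma agree_at_base:
  assumes "a \<in> carrier A"
  shows "agree_at P M (i a) (f a)"
proof (rule agree_atI[of "\<one>\<^bsub>A\<^esub>" a])
  show "f \<one>\<^bsub>A\<^esub> \<notin> M" using M.I_notcarr M.one_imp_carrier by auto
qed (use assms in \<open>auto simp: a_minus_def i.S.r_neg f.S.r_neg P.zero_closed M.zero_closed\<close>)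

lemma agree_at_unique:
  assumes "agree_at P M x y" "agree_at P M x z" and c: "x \<in> carrier T" "y \<in> carrier E" "z \<in> carrier E"
  shows "y \<ominus> z \<in> M"
proof -
  obtain s a where s: "s \<in> carrier A" "a \<in> carrier A" "f s \<notin> M" "i s \<otimes>\<^bsub>T\<^esub> x \<ominus>\<^bsub>T\<^esub> i a \<in> P"
    "f s \<otimes> y \<ominus> f a \<in> M"
    by (rule agree_atE[OF assms(1)], rule that)
  obtain t b where t: "t \<in> carrier A" "b \<in> carrier A" "f t \<notin> M" "i t \<otimes>\<^bsub>T\<^esub> x \<ominus>\<^bsub>T\<^esub> i b \<in> P"
    "f t \<otimes> z \<ominus> f b \<in> M"
    by (rule agree_atE[OF assms(2)], rule that)
  have ci: "i s \<in> carrier T" "i a \<in> carrier T" "i t \<in> carrier T" "i b \<in> carrier T"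
    and cf: "f s \<in> carrier E" "f a \<in> carrier E" "f t \<in> carrier E" "f b \<in> carrier E"
    using s t by auto
  have "i t \<otimes>\<^bsub>T\<^esub> (i s \<otimes>\<^bsub>T\<^esub> x \<ominus>\<^bsub>T\<^esub> i a) \<ominus>\<^bsub>T\<^esub> i s \<otimes>\<^bsub>T\<^esub> (i t \<otimes>\<^bsub>T\<^esub> x \<ominus>\<^bsub>T\<^esub> i b) \<in> P"
    using i.S.ideal_minus_closed[OF P.is_ideal P.I_l_closed[OF s(4) ci(3)] P.I_l_closed[OF t(4) ci(1)]] .
  moreover have "i t \<otimes>\<^bsub>T\<^esub> (i s \<otimes>\<^bsub>T\<^esub> x \<ominus>\<^bsub>T\<^esub> i a) \<ominus>\<^bsub>T\<^esub> i s \<otimes>\<^bsub>T\<^esub> (i t \<otimes>\<^bsub>T\<^esub> x \<ominus>\<^bsub>T\<^esub> i b)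
      = i s \<otimes>\<^bsub>T\<^esub> i b \<ominus>\<^bsub>T\<^esub> i t \<otimes>\<^bsub>T\<^esub> i a"
    using ci c(1) by algebra
  ultimately have "i (s \<otimes>\<^bsub>A\<^esub> b \<ominus>\<^bsub>A\<^esub> t \<otimes>\<^bsub>A\<^esub> a) \<in> P"
    using s(1,2) t(1,2) by (simp add: a_minus_def)
  then have "f (s \<otimes>\<^bsub>A\<^esub> b \<ominus>\<^bsub>A\<^esub> t \<otimes>\<^bsub>A\<^esub> a) \<in> M"
    using agree_contract[of "s \<otimes>\<^bsub>A\<^esub> b \<ominus>\<^bsub>A\<^esub> t \<otimes>\<^bsub>A\<^esub> a"] s(1,2) t(1,2) by simp
  then have 1: "f s \<otimes> f b \<ominus> f t \<otimes> f a \<in> M"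
    using s(1,2) t(1,2) by (simp add: a_minus_def)
  have "(f s \<otimes> f t) \<otimes> (y \<ominus> z)
     = (f t \<otimes> (f s \<otimes> y \<ominus> f a) \<ominus> f s \<otimes> (f t \<otimes> z \<ominus> f b))
       \<ominus> (f s \<otimes> f b \<ominus> f t \<otimes> f a)"
    using cf c(2,3) by algebra
  also have "\<dots> \<in> M"
    using f.S.ideal_minus_closed[OF M.is_ideal f.S.ideal_minus_closed[OF M.is_ideal
        M.I_l_closed[OF s(5) cf(3)] M.I_l_closed[OF t(5) cf(1)]] 1] .
  finally have "f (s \<otimes>\<^bsub>A\<^esub> t) \<otimes> (y \<ominus> z) \<in> M"
    using s(1) t(1) by simp
  with agree_at_mult_notin[OF s(1) t(1) s(3) t(3)] show ?thesis
    using primeideal_cancel[OF M, of "f (s \<otimes>\<^bsub>A\<^esub> t)" "y \<ominus> z"] s(1) t(1) c by simp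
qed

lemma agree_at_cong:
  assumes "agree_at P M x y" "y \<in> carrier E" "z \<in> carrier E" "z \<ominus> y \<in> M"
  shows "agree_at P M x z"
proof -
  obtain s a where s: "s \<in> carrier A" "a \<in> carrier A" "f s \<notin> M" "i s \<otimes>\<^bsub>T\<^esub> x \<ominus>\<^bsub>T\<^esub> i a \<in> P"
    "f s \<otimes> y \<ominus> f a \<in> M"
    by (rule agree_atE[OF assms(1)], rule that)
  have c: "f s \<in> carrier E" "f a \<in> carrier E" using s by auto
  have "f s \<otimes> z \<ominus> f a = (f s \<otimes> y \<ominus> f a) \<oplus> f s \<otimes> (z \<ominus> y)"
    using c assms(2,3) by algebra
  also have "\<dots> \<in> M"
    using M.a_closed[OF s(5) M.I_l_closed[OF assms(4) c(1)]] .
  finally show ?thesis by (rule agree_atI[OF s(1-4)])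
qed

lemma
  assumes 1: "agree_at P M x y" and 2: "agree_at P M x' y'"
    and c: "x \<in> carrier T" "y \<in> carrier E" "x' \<in> carrier T" "y' \<in> carrier E"
  shows agree_at_mult: "agree_at P M (x \<otimes>\<^bsub>T\<^esub> x') (y \<otimes> y')"
    and agree_at_add: "agree_at P M (x \<oplus>\<^bsub>T\<^esub> x') (y \<oplus> y')"
proof -
  obtain s a where s: "s \<in> carrier A" "a \<in> carrier A" "f s \<notin> M" "i s \<otimes>\<^bsub>T\<^esub> x \<ominus>\<^bsub>T\<^esub> i a \<in> P"
    "f s \<otimes> y \<ominus> f a \<in> M"
    by (rule agree_atE[OF 1], rule that)
  obtain t b where t: "t \<in> carrier A" "b \<in> carrier A" "f t \<notin> M" "i t \<otimes>\<^bsub>T\<^esub> x' \<ominus>\<^bsub>T\<^esub> i b \<in> P"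
    "f t \<otimes> y' \<ominus> f b \<in> M"
    by (rule agree_atE[OF 2], rule that)
  note st = agree_at_mult_notin[OF s(1) t(1) s(3) t(3)]
  show "agree_at P M (x \<otimes>\<^bsub>T\<^esub> x') (y \<otimes> y')"
    using i.S.congruent_fraction_mult[OF P.is_ideal _ _ _ _ c(1,3) s(4) t(4)]
      f.S.congruent_fraction_mult[OF M.is_ideal _ _ _ _ c(2,4) s(5) t(5)] s(1,2) t(1,2)
    by (intro agree_atI[OF _ _ st, of "a \<otimes>\<^bsub>A\<^esub> b"]) auto
  show "agree_at P M (x \<oplus>\<^bsub>T\<^esub> x') (y \<oplus> y')"
    using i.S.congruent_fraction_add[OF P.is_ideal _ _ _ _ c(1,3) s(4) t(4)]
      f.S.congruent_fraction_add[OF M.is_ideal _ _ _ _ c(2,4) s(5) t(5)] s(1,2) t(1,2)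
    by (intro agree_atI[OF _ _ st, of "t \<otimes>\<^bsub>A\<^esub> a \<oplus>\<^bsub>A\<^esub> s \<otimes>\<^bsub>A\<^esub> b"]) auto
qed

end

context
  assumes iso: "spec_residue_iso A T i"
begin

lemma iso_bij: "bij_betw (contract A i) (Spec T) (Spec A)"
  and iso_residue: "Q \<in> Spec T \<Longrightarrow> residually_trivial A T i Q"
  using iso unfolding spec_residue_iso_iff[OF i.ring_hom_cring_axioms] by blast+

text \<open>The prime of \<open>T\<close> lying over the same prime of \<open>A\<close> as \<open>M\<close>.\<close>

definition point_over :: "'c set \<Rightarrow> 'b set" where
  "point_over M = inv_into (Spec T) (contract A i) (contract A f M)"

lemma point_over:
  assumes "M \<in> Spec E"
  shows "point_over M \<in> Spec T" "contract A i (point_over M) = contract A f M"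
proof -
  have "contract A f M \<in> contract A i ` Spec T"
    unfolding bij_betw_imp_surj_on[OF iso_bij] by (rule contract_Spec[OF f.ring_hom_cring_axioms assms])
  then show "point_over M \<in> Spec T" "contract A i (point_over M) = contract A f M"
    unfolding point_over_def by (rule inv_into_into, rule f_inv_into_f)
qed

lemma point_over_unique:
  assumes "M \<in> Spec E" "P \<in> Spec T" "contract A i P = contract A f M"
  shows "point_over M = P"
  using inj_onD[OF bij_betw_imp_inj_on[OF iso_bij]] point_over[OF assms(1)] assms(2,3) by metis

abbreviation "agrees M \<equiv> agree_at (point_over M) M"

lemma agrees_extension:
  assumes g: "g \<in> ring_hom T E" "\<And>a. a \<in> carrier A \<Longrightarrow> g (i a) = f a"
    and M: "M \<in> Spec E" and x: "x \<in> carrier T"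
  shows "agrees M x (g x)"
proof -
  interpret g: ring_hom_cring T E g by unfold_locales (rule g(1))
  have P: "contract T g M \<in> Spec T" by (rule contract_Spec[OF g.ring_hom_cring_axioms M])
  have "contract A i (contract T g M) = contract A f M"
    using contract_comp[of i A T g M] contract_cong[of A "g \<circ> i" f] g(2) i.hom_closed by auto
  then have e: "point_over M = contract T g M" by (rule point_over_unique[OF M P])
  obtain s a where s: "s \<in> carrier A" "a \<in> carrier A" "i s \<notin> contract T g M"
    "i s \<otimes>\<^bsub>T\<^esub> x \<ominus>\<^bsub>T\<^esub> i a \<in> contract T g M"
    using iso_residue[OF P] x unfolding residually_trivial_def by blast
  have "g (i s \<otimes>\<^bsub>T\<^esub> x \<ominus>\<^bsub>T\<^esub> i a) \<in> M" using s(4) unfolding contract_def by blast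
  then have "f s \<otimes> g x \<ominus> f a \<in> M"
    using s x by (simp add: a_minus_def g(2))
  moreover have "f s \<notin> M" using s(1,3) g(2) i.hom_closed unfolding contract_def by auto
  ultimately show ?thesis
    unfolding e using s by (intro agree_atI) auto
qed

text \<open>A reduced ring has enough primes, so the values at all primes determine an element.\<close>

lemma agrees_unique:
  assumes red: "reduced_ring E" and c: "x \<in> carrier T" "y \<in> carrier E" "z \<in> carrier E"
    and "\<And>M. M \<in> Spec E \<Longrightarrow> agrees M x y" "\<And>M. M \<in> Spec E \<Longrightarrow> agrees M x z"
  shows "y = z"
proof -
  have "y \<ominus> z = \<zero>"
  proof (rule reduced_ring_zeroI[OF red])
    show "y \<ominus> z \<in> carrier E" using c by simp
    fix M assume M: "M \<in> Spec E"
    show "y \<ominus> z \<in> M"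
      using agree_at_unique[OF point_over(1)[OF M] M point_over(2)[OF M] assms(5,6)[OF M] c] .
  qed
  then show ?thesis using c by simp
qed

theorem extension_unique:
  assumes "reduced_ring E"
    and "g \<in> ring_hom T E" "\<And>a. a \<in> carrier A \<Longrightarrow> g (i a) = f a"
    and "g' \<in> ring_hom T E" "\<And>a. a \<in> carrier A \<Longrightarrow> g' (i a) = f a"
    and x: "x \<in> carrier T"
  shows "g x = g' x"
  by (rule agrees_unique[OF assms(1) x])
    (use assms agrees_extension ring_hom_closed x in auto)

text \<open>Values are compatible with sums and products, so an assignment that respects values at all
  primes is automatically a homomorphism.\<close>

lemma extension_of_agreeing:
  assumes red: "reduced_ring E"
    and ex: "\<And>x. x \<in> carrier T \<Longrightarrow> \<exists>y\<in>carrier E. \<forall>M\<in>Spec E. agrees M x y"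
  shows "\<exists>g\<in>ring_hom T E. \<forall>a\<in>carrier A. g (i a) = f a"
proof -
  obtain g where g: "\<And>x. x \<in> carrier T \<Longrightarrow> g x \<in> carrier E"
    "\<And>x M. x \<in> carrier T \<Longrightarrow> M \<in> Spec E \<Longrightarrow> agrees M x (g x)"
    using ex by metis
  have base: "g (i a) = f a" if "a \<in> carrier A" for a
    using that g point_over agree_at_base by (intro agrees_unique[OF red, of "i a"]) auto
  have "g \<in> ring_hom T E"
  proof (rule ring_hom_memI)
    fix x y assume x: "x \<in> carrier T" and y: "y \<in> carrier T"
    show "g (x \<otimes>\<^bsub>T\<^esub> y) = g x \<otimes> g y"
      using x y g point_over agree_at_mult by (intro agrees_unique[OF red, of "x \<otimes>\<^bsub>T\<^esub> y"]) auto
    show "g (x \<oplus>\<^bsub>T\<^esub> y) = g x \<oplus> g y"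
      using x y g point_over agree_at_add by (intro agrees_unique[OF red, of "x \<oplus>\<^bsub>T\<^esub> y"]) auto
  next
    show "g \<one>\<^bsub>T\<^esub> = \<one>" using base[of "\<one>\<^bsub>A\<^esub>"] by simp
  qed (use g in auto)
  with base show ?thesis by blast
qed

text \<open>Over a von Neumann regular ring, elements can be glued along idempotents.  Suppose that no \<open>y\<close>
  agrees with \<open>x\<close> everywhere, and choose an idempotent \<open>e\<close> on which none exists with
  \<open>I e = {a. f a e = 0}\<close> as large as possible.  Splitting \<open>e\<close> along supports of elements \<open>f a\<close> shows
  that \<open>I e\<close> is a prime \<open>p\<close>.  Let \<open>x\<close> have the value \<open>a/s\<close> at the point over \<open>p\<close>.  By going up,
  \<open>f a / f s\<close> agrees with \<open>x\<close> wherever both \<open>e\<close> and \<open>f s\<close> are nonzero, and the remaining part of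
  \<open>e\<close> has a larger ideal, so that some element agrees with \<open>x\<close> there as well.\<close>

lemma agreeing_element:
  assumes noeth: "noetherian_ring A" and vnr: "von_neumann_regular E"
    and int: "\<And>t. t \<in> carrier T \<Longrightarrow> integral_over T (i ` carrier A) t"
    and x: "x \<in> carrier T"
  shows "\<exists>y\<in>carrier E. \<forall>M\<in>Spec E. agrees M x y"
proof -
  interpret noetherian_ring A by fact
  define idem where "idem e \<longleftrightarrow> e \<in> carrier E \<and> e \<otimes> e = e" for e
  define good where "good e \<longleftrightarrow> (\<exists>y\<in>carrier E. \<forall>M\<in>Spec E. e \<notin> M \<longrightarrow> agrees M x y)" for e
  define I where "I e = {a \<in> carrier A. f a \<otimes> e = \<zero>}" for e
  have I_ideal: "ideal (I e) A" if e: "e \<in> carrier E" for e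
  proof (rule i.R.ideal_criterion)
    fix a b assume ab: "b \<in> carrier A" "a \<in> I e"
    then have "f (b \<otimes>\<^bsub>A\<^esub> a) \<otimes> e = f b \<otimes> (f a \<otimes> e)"
      using e by (simp add: I_def f.S.m_assoc)
    then show "b \<otimes>\<^bsub>A\<^esub> a \<in> I e" using ab by (simp add: I_def)
  qed (use e in \<open>auto simp: I_def f.S.l_distr\<close>)
  have support: "\<exists>z'\<in>carrier E. idem (z \<otimes> z') \<and> z \<otimes> (z \<otimes> z') = z" if z: "z \<in> carrier E" for z
  proof -
    obtain z' where z': "z' \<in> carrier E" "z \<otimes> z \<otimes> z' = z"
      using vnr z unfolding von_neumann_regular_def by blast
    have "(z \<otimes> z') \<otimes> (z \<otimes> z') = (z \<otimes> z \<otimes> z') \<otimes> z'"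
      using z z'(1) by (simp add: f.S.m_ac)
    then show ?thesis
      using z z' by (intro bexI[of _ z']) (simp_all add: idem_def f.S.m_assoc)
  qed
  let ?m = "\<lambda>u. \<one> \<ominus> u"
  have orth: "u \<otimes> ?m u = \<zero>" if "idem u" for u
  proof -
    have "u \<otimes> ?m u = u \<ominus> u \<otimes> u" using that unfolding idem_def by algebra
    then show ?thesis using that unfolding idem_def by simp
  qed
  have idem_m: "idem (?m u)" if "idem u" for u
  proof -
    have "?m u \<otimes> ?m u = ?m u \<ominus> u \<otimes> ?m u" using that unfolding idem_def by algebra
    then show ?thesis using that orth[OF that] unfolding idem_def by (simp add: a_minus_def)
  qed
  have idem_mult: "idem (e \<otimes> u)" if "idem e" "idem u" for e u
  proof -
    have c: "e \<in> carrier E" "u \<in> carrier E" "e \<otimes> e = e" "u \<otimes> u = u"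
      using that by (simp_all add: idem_def)
    have "(e \<otimes> u) \<otimes> (e \<otimes> u) = (e \<otimes> e) \<otimes> (u \<otimes> u)"
      using c(1,2) by (simp add: f.S.m_ac)
    then show ?thesis using c by (simp add: idem_def)
  qed
  \<comment> \<open>At each prime exactly one of \<open>u\<close> and \<open>1 - u\<close> vanishes.\<close>
  have complement: "?m u \<in> M" if "idem u" "M \<in> Spec E" "u \<notin> M" for u M
  proof -
    have c: "u \<in> carrier E" using that(1) by (simp add: idem_def)
    have "u \<otimes> ?m u \<in> M" unfolding orth[OF that(1)] by (rule Spec_zero[OF that(2)])
    then show ?thesis using primeideal_cancel[OF that(2) c _ _ that(3)] c by simp
  qed
  \<comment> \<open>Gluing: \<open>u y + (1 - u) z\<close> equals \<open>y\<close> where \<open>u\<close> is nonzero and \<open>z\<close> elsewhere.\<close>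
  have split: "good e" if e: "idem e" "idem u" and gd: "good (e \<otimes> u)" "good (e \<otimes> ?m u)" for e u
  proof -
    have c: "e \<in> carrier E" "u \<in> carrier E" using e by (simp_all add: idem_def)
    obtain y where y: "y \<in> carrier E" "\<And>M. M \<in> Spec E \<Longrightarrow> e \<otimes> u \<notin> M \<Longrightarrow> agrees M x y"
      using gd(1) unfolding good_def by blast
    obtain z where z: "z \<in> carrier E" "\<And>M. M \<in> Spec E \<Longrightarrow> e \<otimes> ?m u \<notin> M \<Longrightarrow> agrees M x z"
      using gd(2) unfolding good_def by blast
    let ?w = "u \<otimes> y \<oplus> ?m u \<otimes> z"
    have "agrees M x ?w" if M: "M \<in> Spec E" and eM: "e \<notin> M" for M
    proof (cases "u \<in> M")
      case False
      interpret M: primeideal M E using M by (simp add: Spec_iff)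
      have "e \<otimes> u \<notin> M" using M.I_prime[OF c] eM False by blast
      then have a: "agrees M x y" using y(2) M by blast
      have "?w \<ominus> y = ?m u \<otimes> (z \<ominus> y)" using c y(1) z(1) by algebra
      also have "\<dots> \<in> M"
        using M.I_r_closed[OF complement[OF e(2) M False], of "z \<ominus> y"] y(1) z(1) by simp
      finally show ?thesis
        using agree_at_cong[OF point_over(1)[OF M] M point_over(2)[OF M] a y(1), of ?w] c y(1) z(1) by simp
    next
      case True
      interpret M: primeideal M E using M by (simp add: Spec_iff)
      have "?m u \<notin> M"
      proof
        assume "?m u \<in> M"
        then have "?m u \<oplus> u \<in> M" using True by simp
        moreover have "?m u \<oplus> u = \<one>" using c(2) by algebra
        ultimately show False using M.one_imp_carrier M.I_notcarr by simp
      qed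
      then have "e \<otimes> ?m u \<notin> M" using M.I_prime[OF c(1), of "?m u"] c(2) eM by auto
      then have a: "agrees M x z" using z(2) M by blast
      have "?w \<ominus> z = u \<otimes> (y \<ominus> z)" using c y(1) z(1) by algebra
      also have "\<dots> \<in> M" using M.I_r_closed[OF True, of "y \<ominus> z"] y(1) z(1) by simp
      finally show ?thesis
        using agree_at_cong[OF point_over(1)[OF M] M point_over(2)[OF M] a z(1), of ?w] c y(1) z(1) by simp
    qed
    then show ?thesis unfolding good_def using c y(1) z(1) by (intro bexI[of _ ?w]) auto
  qed
  have "good \<one>"
  proof (rule ccontr)
    assume bad1: "\<not> good \<one>"
    let ?F = "I ` {e. idem e \<and> \<not> good e}"
    have "idem \<one>" by (simp add: idem_def)
    then have "?F \<noteq> {}" using bad1 by blast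
    moreover have "ideal J A" if "J \<in> ?F" for J
      using that I_ideal unfolding idem_def by blast
    ultimately obtain J where J: "J \<in> ?F" "\<forall>K\<in>?F. J \<subseteq> K \<longrightarrow> K = J"
      using maximal_in_ideal_family by meson
    from J(1) obtain e where e: "idem e" "\<not> good e" "J = I e" by blast
    have ec: "e \<in> carrier E" "e \<otimes> e = e" using e(1) by (simp_all add: idem_def)
    have larger: "good e'" if "idem e'" "I e \<subseteq> I e'" "b \<in> I e'" "b \<notin> I e" for e' b
      using J(2) e(3) that by blast
    have I_sub: "I e \<subseteq> I (e \<otimes> u)" if "u \<in> carrier E" for u
      unfolding I_def using ec(1) that by (auto simp: f.S.m_assoc[symmetric])
    \<comment> \<open>On the part of \<open>e\<close> outside the support of \<open>f b\<close>, the ideal gains the element \<open>b\<close>.\<close>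
    have small: "good (e \<otimes> ?m (f b \<otimes> z'))"
      if b: "b \<in> carrier A" "b \<notin> I e" and z': "z' \<in> carrier E" "idem (f b \<otimes> z')"
        "f b \<otimes> (f b \<otimes> z') = f b" for b z'
    proof -
      define u where "u = f b \<otimes> z'"
      have uc: "u \<in> carrier E" "f b \<in> carrier E" using b(1) z'(1) by (simp_all add: u_def)
      have "f b \<otimes> (e \<otimes> ?m u) = e \<otimes> (f b \<ominus> f b \<otimes> u)"
        using uc ec(1) by algebra
      also have "\<dots> = \<zero>" using z'(3) ec(1) uc(2) by (simp add: u_def a_minus_def f.S.r_neg)
      finally have "b \<in> I (e \<otimes> ?m u)" using b(1) by (simp add: I_def)
      then show ?thesis
        using larger[of "e \<otimes> ?m u" b] idem_mult[OF e(1) idem_m[OF z'(2)]] I_sub[of "?m u"] b(2) uc(1)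
        by (simp add: u_def)
    qed
    have "primeideal (I e) A"
    proof (rule primeidealI[OF I_ideal[OF ec(1)] i.R.is_cring])
      show "carrier A \<noteq> I e"
      proof
        assume "carrier A = I e"
        then have "\<one>\<^bsub>A\<^esub> \<in> I e" using i.R.one_closed by blast
        then have "e = \<zero>" using ec(1) by (simp add: I_def)
        then have "good e" unfolding good_def using Spec_zero f.S.zero_closed by blast
        with e(2) show False by blast
      qed
    next
      fix a b assume ab: "a \<in> carrier A" "b \<in> carrier A" "a \<otimes>\<^bsub>A\<^esub> b \<in> I e"
      show "a \<in> I e \<or> b \<in> I e"
      proof (rule ccontr)
        assume n: "\<not> (a \<in> I e \<or> b \<in> I e)"
        obtain z' where z': "z' \<in> carrier E" "idem (f a \<otimes> z')" "f a \<otimes> (f a \<otimes> z') = f a"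
          using support[of "f a"] ab(1) by auto
        let ?u = "f a \<otimes> z'"
        have c: "f a \<in> carrier E" "f b \<in> carrier E" using ab by auto
        have "f b \<otimes> (e \<otimes> ?u) = z' \<otimes> ((f a \<otimes> f b) \<otimes> e)"
          using c z'(1) ec(1) by (simp add: f.S.m_ac)
        also have "\<dots> = \<zero>" using ab z'(1) by (simp add: I_def)
        finally have "b \<in> I (e \<otimes> ?u)" using ab(2) by (simp add: I_def)
        then have "good (e \<otimes> ?u)"
          using larger[of "e \<otimes> ?u" b] idem_mult[OF e(1) z'(2)] I_sub[of ?u] n c z'(1) by simp
        moreover have "good (e \<otimes> ?m ?u)" using small[OF ab(1) _ z'] n by blast
        ultimately show False using split[OF e(1) z'(2)] e(2) by blast
      qed
    qed
    then have p: "I e \<in> Spec A" by (simp add: Spec_iff)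
    then have "I e \<in> contract A i ` Spec T" unfolding bij_betw_imp_surj_on[OF iso_bij] .
    then obtain P where P: "P \<in> Spec T" "contract A i P = I e"
      by (elim imageE) (rule that, simp_all)
    obtain s a where s: "s \<in> carrier A" "a \<in> carrier A" "i s \<notin> P" "i s \<otimes>\<^bsub>T\<^esub> x \<ominus>\<^bsub>T\<^esub> i a \<in> P"
      using iso_residue[OF P(1)] x unfolding residually_trivial_def by blast
    have sI: "s \<notin> I e" using s(3) unfolding P(2)[symmetric] contract_def by blast
    obtain z' where z': "z' \<in> carrier E" "idem (f s \<otimes> z')" "f s \<otimes> (f s \<otimes> z') = f s"
      using support[of "f s"] s(1) by auto
    define u where "u = f s \<otimes> z'"
    have c: "f s \<in> carrier E" "f a \<in> carrier E" "u \<in> carrier E" using s z' by (auto simp: u_def)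
    have "agrees M x (f a \<otimes> z')" if M: "M \<in> Spec E" and euM: "e \<otimes> u \<notin> M" for M
    proof -
      interpret M: primeideal M E using M by (simp add: Spec_iff)
      have uM: "u \<notin> M" using euM M.I_l_closed ec(1) by blast
      have eM: "e \<notin> M" using euM M.I_r_closed c(3) by blast
      have sM: "f s \<notin> M" using uM M.I_r_closed[of "f s" z'] z'(1) unfolding u_def by blast
      have "contract A i P \<subseteq> contract A f M"
      proof
        fix b assume "b \<in> contract A i P"
        then have b: "b \<in> carrier A" "f b \<otimes> e = \<zero>" unfolding P(2) I_def by simp_all
        then have "e \<otimes> f b \<in> M" using Spec_zero[OF M] ec(1) by (simp add: f.S.m_comm)
        then have "f b \<in> M" using primeideal_cancel[OF M ec(1) _ _ eM] b(1) by simp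
        with b(1) show "b \<in> contract A f M" unfolding contract_def by blast
      qed
      moreover have "ideal P T" using P(1) unfolding Spec_iff by (rule primeideal.axioms(1))
      ultimately obtain P' where P': "P' \<in> Spec T" "P \<subseteq> P'" "contract A i P' = contract A f M"
        using i.lying_over[OF int _ contract_Spec[OF f.ring_hom_cring_axioms M]] by metis
      have e': "point_over M = P'" by (rule point_over_unique[OF M P'(1,3)])
      have "f s \<otimes> (f a \<otimes> z') \<ominus> f a = (\<ominus> f a) \<otimes> ?m u"
        unfolding u_def using c z'(1) by algebra
      also have "\<dots> \<in> M"
        using M.I_l_closed[OF complement[OF z'(2)[folded u_def] M uM], of "\<ominus> f a"] c by simp
      finally show ?thesis
        unfolding e' using s P'(2) sM by (intro agree_atI[of s a]) auto
    qed
    then have "good (e \<otimes> u)" unfolding good_def using c(2) z'(1) by blast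
    moreover have "good (e \<otimes> ?m u)" using small[OF s(1) sI z'] by (simp add: u_def)
    ultimately show False using split[OF e(1) z'(2)[folded u_def]] e(2) by blast
  qed
  then show ?thesis unfolding good_def using Spec_one_notin by blast
qed

theorem extension_exists:
  assumes "noetherian_ring A" "von_neumann_regular E" "reduced_ring E"
    and "\<And>t. t \<in> carrier T \<Longrightarrow> integral_over T (i ` carrier A) t"
  shows "\<exists>g\<in>ring_hom T E. \<forall>a\<in>carrier A. g (i a) = f a"
  using extension_of_agreeing[OF assms(3)] agreeing_element[OF assms(1,2,4)] by blast

end

end

section \<open>Von Neumann regular total rings of fractions\<close>

definition acc_below :: "('a, 'm) ring_scheme \<Rightarrow> 'a set \<Rightarrow> bool" where
  "acc_below R I \<longleftrightarrow> (\<forall>F. F \<noteq> {} \<longrightarrow> (\<forall>J\<in>F. ideal J R \<and> J \<subseteq> I) \<longrightarrow>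
     (\<exists>J\<in>F. \<forall>K\<in>F. J \<subseteq> K \<longrightarrow> K = J))"

text \<open>For a reduced ring, this condition is equivalent to von Neumann regularity of the total ring of
  fractions.\<close>

definition complemented_ring :: "('a, 'm) ring_scheme \<Rightarrow> bool" where
  "complemented_ring R \<longleftrightarrow> (\<forall>b\<in>carrier R. \<exists>b'\<in>carrier R.
     b \<otimes>\<^bsub>R\<^esub> b' = \<zero>\<^bsub>R\<^esub> \<and>
     (\<forall>z\<in>carrier R. b \<otimes>\<^bsub>R\<^esub> z = \<zero>\<^bsub>R\<^esub> \<longrightarrow> b' \<otimes>\<^bsub>R\<^esub> z = \<zero>\<^bsub>R\<^esub> \<longrightarrow> z = \<zero>\<^bsub>R\<^esub>))"

lemma acc_belowD:
  assumes "acc_below R I" "F \<noteq> {}" "\<And>J. J \<in> F \<Longrightarrow> ideal J R" "\<And>J. J \<in> F \<Longrightarrow> J \<subseteq> I"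
  shows "\<exists>J\<in>F. \<forall>K\<in>F. J \<subseteq> K \<longrightarrow> K = J"
  using assms by (simp add: acc_below_def)

lemma noetherian_acc_below:
  assumes "noetherian_ring R"
  shows "acc_below R I"
  unfolding acc_below_def
proof (intro allI impI)
  fix F assume F: "F \<noteq> {}" "\<forall>J\<in>F. ideal J R \<and> J \<subseteq> I"
  then have "ideal J R" if "J \<in> F" for J using that by simp
  from noetherian_ring.maximal_in_ideal_family[OF assms F(1) this]
  show "\<exists>J\<in>F. \<forall>K\<in>F. J \<subseteq> K \<longrightarrow> K = J" .
qed

text \<open>If \<open>j z = 0\<close> in a reduced ring then \<open>Ann (j + z) = Ann j \<inter> Ann z\<close>, so adding to \<open>j\<close> an
  element that it kills enlarges the double annihilator until nothing is left to add.  The lemma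
  is this argument modulo a radical ideal \<open>J\<close>.\<close>

lemma (in cring) ex_regular_on_ideal:
  assumes J: "ideal J R" "\<And>x. x \<in> carrier R \<Longrightarrow> x \<otimes> x \<in> J \<Longrightarrow> x \<in> J"
    and I: "ideal I R" and acc: "acc_below R I"
  shows "\<exists>r\<in>I. \<forall>z\<in>I. r \<otimes> z \<in> J \<longrightarrow> z \<in> J"
proof -
  interpret I: ideal I R by fact
  interpret J: ideal J R by fact
  define W where "W j = {z \<in> I. \<forall>w\<in>I. j \<otimes> w \<in> J \<longrightarrow> z \<otimes> w \<in> J}" for j
  have W: "ideal (W j) R" for j
  proof (rule ideal_criterion)
    fix a x assume ax: "a \<in> carrier R" "x \<in> W j"
    then have xI: "x \<in> I" by (simp add: W_def)
    have "a \<otimes> x \<otimes> w \<in> J" if "w \<in> I" "j \<otimes> w \<in> J" for w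
      using J.I_l_closed[OF _ ax(1), of "x \<otimes> w"] ax that I.Icarr[OF xI] I.Icarr[OF that(1)]
      by (simp add: W_def m_assoc)
    then show "a \<otimes> x \<in> W j" using I.I_l_closed[OF xI ax(1)] by (simp add: W_def)
  qed (use I.Icarr I.zero_closed J.zero_closed in \<open>auto simp: W_def l_distr\<close>)
  have "W ` I \<noteq> {}" using I.zero_closed by blast
  moreover have "ideal K R" "K \<subseteq> I" if "K \<in> W ` I" for K
    using that W by (auto simp: W_def)
  ultimately have "\<exists>K\<in>W ` I. \<forall>L\<in>W ` I. K \<subseteq> L \<longrightarrow> L = K"
    by (rule acc_belowD[OF acc])
  then obtain j where j: "j \<in> I" and max: "\<And>k. k \<in> I \<Longrightarrow> W j \<subseteq> W k \<Longrightarrow> W k = W j"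
    by (elim bexE imageE) (rule that, auto)
  have "z \<in> J" if z: "z \<in> I" "j \<otimes> z \<in> J" for z
  proof -
    have c: "j \<in> carrier R" "z \<in> carrier R" using j z I.Icarr by blast+
    have kills: "z \<otimes> w \<in> J \<and> j \<otimes> w \<in> J" if w: "w \<in> I" "(j \<oplus> z) \<otimes> w \<in> J" for w
    proof -
      have wc: "w \<in> carrier R" using w(1) by (rule I.Icarr)
      have "(z \<otimes> w) \<otimes> (z \<otimes> w) = (z \<otimes> w) \<otimes> ((j \<oplus> z) \<otimes> w) \<ominus> (w \<otimes> w) \<otimes> (j \<otimes> z)"
        using c wc by algebra
      also have "\<dots> \<in> J"
        using ideal_minus_closed[OF J(1) J.I_l_closed[OF w(2)] J.I_l_closed[OF z(2)]] c wc by simp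
      finally have zw: "z \<otimes> w \<in> J"
        using J(2)[OF m_closed[OF c(2) wc]] by blast
      have "j \<otimes> w = (j \<oplus> z) \<otimes> w \<ominus> z \<otimes> w" using c wc by algebra
      then show ?thesis using zw ideal_minus_closed[OF J(1) w(2) zw] by simp
    qed
    have "W (j \<oplus> z) = W j"
      using kills j z(1) by (intro max) (auto simp: W_def)
    moreover have "z \<in> W (j \<oplus> z)" using kills z(1) by (simp add: W_def)
    ultimately have "z \<otimes> z \<in> J" using z by (simp add: W_def)
    then show ?thesis using J(2)[OF c(2)] by blast
  qed
  with j show ?thesis by blast
qed

lemma (in cring) ideal_colon:
  assumes J: "ideal J R" and b: "b \<in> carrier R"
  shows "ideal {z \<in> carrier R. b \<otimes> z \<in> J} R"
proof (rule ideal_criterion)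
  interpret J: ideal J R by fact
  fix a x assume "a \<in> carrier R" "x \<in> {z \<in> carrier R. b \<otimes> z \<in> J}"
  then show "a \<otimes> x \<in> {z \<in> carrier R. b \<otimes> z \<in> J}"
    using J.I_l_closed[of "b \<otimes> x" a] b by (simp add: m_lcomm)
qed (use b additive_subgroup.zero_closed[OF ideal.axioms(1)[OF J]]
    additive_subgroup.a_closed[OF ideal.axioms(1)[OF J]] in \<open>auto simp: r_distr\<close>)

lemma reduced_zero_radical:
  assumes "reduced_ring R" "x \<in> carrier R" "x \<otimes>\<^bsub>R\<^esub> x \<in> {\<zero>\<^bsub>R\<^esub>}"
  shows "x \<in> {\<zero>\<^bsub>R\<^esub>}"
  using reduced_ring_mult_self_zero[OF assms(1,2)] assms(3) by blast

lemma noetherian_complemented_ring: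
  fixes R (structure)
  assumes red: "reduced_ring R" and noeth: "noetherian_ring R"
  shows "complemented_ring R"
  unfolding complemented_ring_def
proof
  interpret cring R using red by (simp add: reduced_ring_def)
  fix b assume b: "b \<in> carrier R"
  show "\<exists>b'\<in>carrier R. b \<otimes> b' = \<zero> \<and> (\<forall>z\<in>carrier R. b \<otimes> z = \<zero> \<longrightarrow> b' \<otimes> z = \<zero> \<longrightarrow> z = \<zero>)"
    using ex_regular_on_ideal[OF zeroideal reduced_zero_radical[OF red] ideal_colon[OF zeroideal b]
        noetherian_acc_below[OF noeth]] by auto
qed

text \<open>The sum \<open>b + b'\<close> is a nonzerodivisor, and \<open>b\<^sup>2 = b (b + b')\<close>; hence \<open>t / (b + b')\<close> is a quasi-inverse of
  \<open>b/t\<close>.\<close>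

lemma von_neumann_regular_total_fractions:
  fixes R (structure)
  assumes red: "reduced_ring R" and compl: "complemented_ring R"
  shows "von_neumann_regular (total_fractions R)"
  unfolding von_neumann_regular_def
proof
  interpret cring R using red by (simp add: reduced_ring_def)
  let ?Q = "total_fractions R"
  fix x assume "x \<in> carrier ?Q"
  then obtain b t where b: "b \<in> carrier R" "t \<in> nonzerodivisors R" "x = fraction R b t"
    by (rule fraction_cases)
  have t: "t \<in> carrier R" using b(2) by (rule nonzerodivisors_closed)
  obtain b' where b': "b' \<in> carrier R" "b \<otimes> b' = \<zero>"
    "\<And>z. z \<in> carrier R \<Longrightarrow> b \<otimes> z = \<zero> \<Longrightarrow> b' \<otimes> z = \<zero> \<Longrightarrow> z = \<zero>"
    using compl b(1) unfolding complemented_ring_def by blast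
  have "z = \<zero>" if z: "z \<in> carrier R" "(b \<oplus> b') \<otimes> z = \<zero>" for z
  proof -
    have "(b \<otimes> z) \<otimes> (b \<otimes> z) = (b \<otimes> z) \<otimes> ((b \<oplus> b') \<otimes> z) \<ominus> (b \<otimes> b') \<otimes> (z \<otimes> z)"
      using b(1) b'(1) z(1) by algebra
    also have "\<dots> = \<zero>" using z b(1) b'(1,2) by simp
    finally have bz: "b \<otimes> z = \<zero>"
      using reduced_ring_mult_self_zero[OF red m_closed[OF b(1) z(1)]] by blast
    then have "b' \<otimes> z = \<zero>" using z b(1) b'(1) by (simp add: l_distr)
    with bz show ?thesis using b'(3) z(1) by blast
  qed
  then have n: "b \<oplus> b' \<in> nonzerodivisors R" using b(1) b'(1) by (simp add: nonzerodivisors_def)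
  have "b \<otimes> b \<otimes> t \<otimes> t = b \<otimes> (t \<otimes> t \<otimes> (b \<oplus> b')) \<ominus> (b \<otimes> b') \<otimes> (t \<otimes> t)"
    using b(1) t b'(1) by algebra
  also have "\<dots> = b \<otimes> (t \<otimes> t \<otimes> (b \<oplus> b'))" using b'(1,2) b(1) t by (simp add: a_minus_def)
  finally have "x \<otimes>\<^bsub>?Q\<^esub> x \<otimes>\<^bsub>?Q\<^esub> fraction R t (b \<oplus> b') = x"
    using b b'(1) n t by (simp add: fraction_mult fraction_eq_iff nonzerodivisors_mult)
  then show "\<exists>x'\<in>carrier ?Q. x \<otimes>\<^bsub>?Q\<^esub> x \<otimes>\<^bsub>?Q\<^esub> x' = x"
    using fraction_closed[OF t n] by blast
qed

section \<open>The seminormalization as a functor\<close>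

context cring
begin

lemma seminormalization_eq: "seminormalization R =
    (normalization R)\<lparr>carrier := pointwise_closure R (normalization R) (to_frac R)\<rparr>"
  by (rule seminormalization_eqI[OF is_seminormalization_pointwise_closure])

lemma carrier_seminormalization:
  "carrier (seminormalization R) = pointwise_closure R (normalization R) (to_frac R)"
  by (simp add: seminormalization_eq)

lemma subring_seminormalization: "subring (carrier (seminormalization R)) (normalization R)"
  and to_frac_image_seminormalization: "to_frac R ` carrier R \<subseteq> carrier (seminormalization R)"
  and seminormalization_iso: "spec_residue_iso R (seminormalization R) (to_frac R)"
  using is_seminormalization_pointwise_closure
  by (simp_all add: is_seminormalization_def subintegral_intermediate_def seminormalization_eq)

lemma seminormalization_hom: "ring_hom_cring R (seminormalization R) (to_frac R)"
proof -
  interpret N: ring_hom_cring R "normalization R" "to_frac R" by (rule to_frac_normalization_hom)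
  show ?thesis
    using N.hom_into_subring[OF subring_seminormalization to_frac_image_seminormalization]
    by (simp add: seminormalization_eq)
qed

lemma seminormalization_inclusion: "ring_hom_cring (seminormalization R) (normalization R) id"
  using cring.subring_inclusion_hom[OF normalization_cring subring_seminormalization]
  by (simp add: seminormalization_eq)

lemma normalization_inclusion: "ring_hom_cring (normalization R) (total_fractions R) id"
  using cring.subring_inclusion_hom[OF total_fractions_cring normalization_subring]
  by (simp add: normalization_eq[symmetric])

lemma seminormalization_integral:
  assumes "x \<in> carrier (seminormalization R)"
  shows "integral_over (seminormalization R) (to_frac R ` carrier R) x"
proof -
  have "x \<in> carrier (normalization R)"
    using subringE(1)[OF subring_seminormalization] assms by blast
  then show ?thesis
    using integral_over_subring[OF cring.axioms(1)[OF normalization_cring] subring_seminormalization]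
      normalization_integral by (simp add: seminormalization_eq)
qed

end

lemma seminormalization_ops:
  "monoid.mult (seminormalization R) = monoid.mult (total_fractions R)"
  "ring.add (seminormalization R) = ring.add (total_fractions R)"
  "\<one>\<^bsub>seminormalization R\<^esub> = \<one>\<^bsub>total_fractions R\<^esub>"
  "monoid.mult (normalization R) = monoid.mult (total_fractions R)"
  "ring.add (normalization R) = ring.add (total_fractions R)"
  "\<one>\<^bsub>normalization R\<^esub> = \<one>\<^bsub>total_fractions R\<^esub>"
  by (simp_all add: seminormalization_def normalization_def)

lemma ring_hom_change_codomain:
  assumes "g \<in> ring_hom T E" "g ` carrier T \<subseteq> carrier E'"
    "monoid.mult E' = monoid.mult E" "ring.add E' = ring.add E" "\<one>\<^bsub>E'\<^esub> = \<one>\<^bsub>E\<^esub>"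
  shows "g \<in> ring_hom T E'"
  using assms unfolding ring_hom_def by auto

text \<open>An extension of \<open>A \<rightarrow> B \<rightarrow> Q(B)\<close> to \<open>A\<^sup>S\<^sup>N\<close> lands in the seminormalization of \<open>B\<close>: above a
  prime of \<open>B\<close>, its values are those of \<open>A\<^sup>S\<^sup>N\<close> at a single point.\<close>

lemma seminormalization_extension_range:
  assumes f: "ring_hom_cring A B f"
    and g: "g \<in> ring_hom (seminormalization A) (total_fractions B)"
      "\<And>a. a \<in> carrier A \<Longrightarrow> g (to_frac A a) = to_frac B (f a)"
  shows "g ` carrier (seminormalization A) \<subseteq> carrier (seminormalization B)"
proof
  interpret f: ring_hom_cring A B f by fact
  let ?S = "seminormalization A" and ?N = "normalization B" and ?E = "total_fractions B"
  interpret iA: ring_hom_cring A ?S "to_frac A" by (rule f.R.seminormalization_hom)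
  interpret N: ring_hom_cring B ?N "to_frac B" by (rule f.S.to_frac_normalization_hom)
  interpret E: ring_hom_cring B ?E "to_frac B" by (rule f.S.to_frac_hom)
  interpret g: ring_hom_cring ?S ?E g by unfold_locales (rule g(1))
  have gN: "g x \<in> carrier ?N" if x: "x \<in> carrier ?S" for x
  proof -
    have "to_frac A ` carrier A \<subseteq> carrier ?S" by auto
    from g.integral_over_image[OF this x f.R.seminormalization_integral[OF x]]
    have "integral_over ?E (g ` to_frac A ` carrier A) (g x)" .
    moreover have "g ` to_frac A ` carrier A \<subseteq> to_frac B ` carrier B" using g(2) by auto
    ultimately have "integral_over ?E (to_frac B ` carrier B) (g x)" by (rule integral_over_mono)
    then show ?thesis using g.hom_closed[OF x] by (simp add: normalization_def)
  qed
  have "g \<in> ring_hom ?S ?N"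
    by (rule ring_hom_change_codomain[OF g(1)]) (use gN in \<open>auto simp: seminormalization_ops\<close>)
  then interpret gN: ring_hom_cring ?S ?N g by unfold_locales
  have bij: "bij_betw (contract A (to_frac A)) (Spec ?S) (Spec A)"
    and res: "\<And>Q. Q \<in> Spec ?S \<Longrightarrow> residually_trivial A ?S (to_frac A) Q"
    using f.R.seminormalization_iso unfolding spec_residue_iso_iff[OF iA.ring_hom_cring_axioms] by blast+
  fix y assume "y \<in> g ` carrier ?S"
  then obtain x where x: "x \<in> carrier ?S" "y = g x" by blast
  show "y \<in> carrier (seminormalization B)"
    unfolding f.S.carrier_seminormalization x(2)
  proof (rule N.pointwise_closureI[OF gN[OF x(1)]])
    fix p assume p: "p \<in> Spec B"
    let ?p = "contract A f p"
    have "?p \<in> contract A (to_frac A) ` Spec ?S"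
      unfolding bij_betw_imp_surj_on[OF bij] by (rule contract_Spec[OF f p])
    then obtain P where P: "P \<in> Spec ?S" "contract A (to_frac A) P = ?p"
      by (elim imageE) (rule that, simp_all)
    obtain s a where s: "s \<in> carrier A" "a \<in> carrier A" "to_frac A s \<notin> P"
      "to_frac A s \<otimes>\<^bsub>?S\<^esub> x \<ominus>\<^bsub>?S\<^esub> to_frac A a \<in> P"
      using res[OF P(1)] x(1) unfolding residually_trivial_def by blast
    have "s \<notin> contract A (to_frac A) P" using s(3) unfolding contract_def by blast
    then have "s \<notin> ?p" unfolding P(2) .
    then have sp: "f s \<notin> p" using s(1) unfolding contract_def by blast
    have "to_frac B (f s) \<otimes>\<^bsub>?N\<^esub> g x \<ominus>\<^bsub>?N\<^esub> to_frac B (f a) \<in> Q"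
      if Q: "Q \<in> Spec ?N" "contract B (to_frac B) Q = p" for Q
    proof -
      have P': "contract ?S g Q \<in> Spec ?S" by (rule contract_Spec[OF gN.ring_hom_cring_axioms Q(1)])
      have "contract A (to_frac A) (contract ?S g Q) = contract A f (contract B (to_frac B) Q)"
        using contract_cong[of A "g \<circ> to_frac A" "to_frac B \<circ> f"] g(2)
        by (simp add: contract_comp image_subset_iff)
      then have "contract ?S g Q = P"
        using inj_onD[OF bij_betw_imp_inj_on[OF bij] _ P' P(1)] P(2) Q(2) by simp
      then have "g (to_frac A s \<otimes>\<^bsub>?S\<^esub> x \<ominus>\<^bsub>?S\<^esub> to_frac A a) \<in> Q"
        using s(4) unfolding contract_def by blast
      moreover have c: "to_frac A s \<in> carrier ?S" "to_frac A a \<in> carrier ?S"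
        using s(1,2) by auto
      ultimately show ?thesis
        unfolding gN.hom_minus[OF iA.S.m_closed[OF c(1) x(1)] c(2)] gN.hom_mult[OF c(1) x(1)]
          g(2)[OF s(1)] g(2)[OF s(2)] by blast
    qed
    then show "\<exists>s\<in>carrier B. \<exists>a\<in>carrier B. s \<notin> p \<and> (\<forall>Q\<in>Spec ?N. contract B (to_frac B) Q = p \<longrightarrow>
        to_frac B s \<otimes>\<^bsub>?N\<^esub> g x \<ominus>\<^bsub>?N\<^esub> to_frac B a \<in> Q)"
      using sp f.hom_closed[OF s(1)] f.hom_closed[OF s(2)] by blast
  qed
qed

text \<open>The extension property gives a map into the total ring of fractions of \<open>B\<close>, which is reduced, so
  the map is unique; the description operator therefore denotes it.\<close>

theorem seminormalization_map:
  assumes f: "ring_hom_cring A B f"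
    and A: "noetherian_ring A" and B: "reduced_ring B" "von_neumann_regular (total_fractions B)"
  shows "seminormalization_map A B f \<in> ring_hom (seminormalization A) (seminormalization B)"
    and "a \<in> carrier A \<Longrightarrow> seminormalization_map A B f (to_frac A a) = to_frac B (f a)"
proof -
  interpret f: ring_hom_cring A B f by fact
  let ?S = "seminormalization A" and ?T = "seminormalization B" and ?E = "total_fractions B"
  interpret iA: ring_hom_cring A ?S "to_frac A" by (rule f.R.seminormalization_hom)
  interpret E: ring_hom_cring B ?E "to_frac B" by (rule f.S.to_frac_hom)
  interpret span: hom_span A ?S "to_frac A" ?E "to_frac B \<circ> f"
    by (intro hom_span.intro iA.ring_hom_cring_axioms)
      (unfold_locales, rule ring_hom_trans[OF f.homh E.homh])
  note red = reduced_total_fractions[OF B(1)]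
  define ext where "ext g \<longleftrightarrow> g \<in> ring_hom ?S ?T \<and> g \<in> extensional (carrier ?S) \<and>
      (\<forall>a\<in>carrier A. g (to_frac A a) = to_frac B (f a))" for g
  have TE: "carrier ?T \<subseteq> carrier ?E"
    using subringE(1)[OF f.S.subring_seminormalization] subringE(1)[OF f.S.normalization_subring] by blast
  have into_E: "g \<in> ring_hom ?S ?E" if g: "g \<in> ring_hom ?S ?T" for g
    by (rule ring_hom_change_codomain[OF g])
      (use ring_hom_closed[OF g] TE in \<open>auto simp: seminormalization_ops\<close>)
  obtain g where g: "g \<in> ring_hom ?S ?E" "\<And>a. a \<in> carrier A \<Longrightarrow> g (to_frac A a) = to_frac B (f a)"
    using span.extension_exists[OF f.R.seminormalization_iso A B(2) red f.R.seminormalization_integral]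
    by auto
  have "g \<in> ring_hom ?S ?T"
    by (rule ring_hom_change_codomain[OF g(1)])
      (use seminormalization_extension_range[OF f g] in \<open>auto simp: seminormalization_ops\<close>)
  then have "ext (restrict g (carrier ?S))"
    unfolding ext_def using g(2) by (auto simp: ring_hom_def)
  moreover have "g = g'" if g: "ext g" "ext g'" for g g'
  proof (rule extensionalityI)
    fix x assume "x \<in> carrier ?S"
    then show "g x = g' x"
      using span.extension_unique[OF f.R.seminormalization_iso red, of g g' x] g into_E
      unfolding ext_def by simp
  qed (use g in \<open>auto simp: ext_def\<close>)
  ultimately have "ext (THE g. ext g)" by (metis theI)
  then have "ext (seminormalization_map A B f)"
    unfolding seminormalization_map_def ext_def .
  then show "seminormalization_map A B f \<in> ring_hom ?S ?T"
    and "a \<in> carrier A \<Longrightarrow> seminormalization_map A B f (to_frac A a) = to_frac B (f a)"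
    unfolding ext_def by blast+
qed

section \<open>Radicals and quotients\<close>

context cring
begin

lemma mem_radical_iff:
  assumes I: "ideal I R" and x: "x \<in> carrier R"
  shows "x \<in> radical R I \<longleftrightarrow> (\<forall>P\<in>Spec R. I \<subseteq> P \<longrightarrow> x \<in> P)"
proof
  assume "x \<in> radical R I"
  then obtain n :: nat where n: "x [^] n \<in> I" unfolding radical_def by blast
  show "\<forall>P\<in>Spec R. I \<subseteq> P \<longrightarrow> x \<in> P"
  proof (intro ballI impI)
    fix P assume P: "P \<in> Spec R" "I \<subseteq> P"
    have "x [^] n \<in> P" using n P(2) by (rule rev_subsetD)
    then show "x \<in> P" by (rule pow_mem_primeideal[OF P(1)[unfolded Spec_iff] x])
  qed
next
  interpret I: ideal I R by fact
  assume *: "\<forall>P\<in>Spec R. I \<subseteq> P \<longrightarrow> x \<in> P"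
  show "x \<in> radical R I"
  proof (rule ccontr)
    assume n: "x \<notin> radical R I"
    have pow: "x [^] (n::nat) \<notin> I" for n
    proof
      assume a: "x [^] n \<in> I"
      then have "x [^] Suc n \<in> I" using I.I_r_closed[OF a x] by simp
      then show False using n x unfolding radical_def by blast
    qed
    define U where "U = range (\<lambda>n::nat. x [^] n)"
    have U: "U \<subseteq> carrier R" "\<one> \<in> U" "I \<inter> U = {}" "x \<in> U"
      unfolding U_def using x pow by (auto intro: image_eqI[of _ _ "0::nat"] image_eqI[of _ _ "1::nat"])
    have "a \<otimes> b \<in> U" if ab: "a \<in> U" "b \<in> U" for a b
    proof -
      obtain m n :: nat where "a = x [^] m" "b = x [^] n" using ab unfolding U_def by blast
      then have "a \<otimes> b = x [^] (m + n)" using x by (simp add: nat_pow_mult)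
      then show ?thesis unfolding U_def by blast
    qed
    then obtain P where P: "primeideal P R" "I \<subseteq> P" "P \<inter> U = {}"
      by (rule prime_avoiding[OF I U(1,2) _ U(3)])
    then have "x \<in> P" using * by (simp add: Spec_iff)
    with P(3) U(4) show False by blast
  qed
qed

lemma radical_subset_prime:
  assumes "ideal I R" "P \<in> Spec R" "I \<subseteq> P"
  shows "radical R I \<subseteq> P"
proof
  fix x assume x: "x \<in> radical R I"
  then have "x \<in> carrier R" by (simp add: radical_def)
  then show "x \<in> P" using mem_radical_iff[OF assms(1)] x assms(2,3) by simp
qed

lemma radical_ideal:
  assumes I: "ideal I R"
  shows "ideal (radical R I) R"
proof -
  let ?J = "radical R I"
  have J: "x \<in> ?J \<longleftrightarrow> x \<in> carrier R \<and> (\<forall>P\<in>Spec R. I \<subseteq> P \<longrightarrow> x \<in> P)" for x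
    using mem_radical_iff[OF I, of x] by (auto simp: radical_def)
  show ?thesis
  proof (rule ideal_criterion)
    show "?J \<subseteq> carrier R" by (auto simp: radical_def)
    show "\<zero> \<in> ?J" unfolding J using Spec_zero[of _ R] by simp
    show "x \<oplus> y \<in> ?J" if "x \<in> ?J" "y \<in> ?J" for x y
      using that additive_subgroup.a_closed[OF ideal.axioms(1)[OF Spec_ideal[of _ R]]]
      unfolding J by (simp add: add.m_closed)
    show "a \<otimes> x \<in> ?J" if "a \<in> carrier R" "x \<in> ?J" for a x
      using that ideal.I_l_closed[OF Spec_ideal[of _ R]] unfolding J by simp
  qed
qed

lemma reduced_ring_Quot_radical:
  assumes I: "ideal I R"
  shows "reduced_ring (R Quot radical R I)"
proof -
  let ?J = "radical R I"
  have J: "ideal ?J R" by (rule radical_ideal[OF I])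
  interpret q: ring_hom_cring R "R Quot ?J" "(+>) ?J"
    by (rule ideal.rcos_ring_hom_cring[OF J is_cring])
  have "y = \<zero>\<^bsub>R Quot ?J\<^esub>"
    if y: "y \<in> carrier (R Quot ?J)" "y [^]\<^bsub>R Quot ?J\<^esub> (n::nat) = \<zero>\<^bsub>R Quot ?J\<^esub>" for y n
  proof -
    obtain x where x: "x \<in> carrier R" "y = ?J +> x" using y(1) unfolding carrier_Quot by (rule imageE)
    have "?J +> (x [^] n) = \<zero>\<^bsub>R Quot ?J\<^esub>"
      using y(2) x by (simp add: q.ring.hom_nat_pow)
    then have "x [^] n \<in> ?J" using coset_zero_iff[OF J, of "x [^] n"] x(1) by simp
    then have "x \<in> P" if "P \<in> Spec R" "I \<subseteq> P" for P
      using pow_mem_primeideal[of P x n] x(1) radical_subset_prime[OF I that] that(1)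
      by (auto simp: Spec_iff)
    then have "x \<in> ?J" using mem_radical_iff[OF I x(1)] by blast
    then show ?thesis using x coset_zero_iff[OF J x(1)] by simp
  qed
  then show ?thesis
    unfolding reduced_ring_def using q.S.is_cring by blast
qed

end

lemma noetherian_ring_Quot:
  assumes "noetherian_ring R" "ideal I R"
  shows "noetherian_ring (R Quot I)"
proof -
  interpret R: noetherian_ring R by fact
  interpret q: ring_hom_ring R "R Quot I" "(+>\<^bsub>R\<^esub>) I" by (rule ideal.rcos_ring_hom_ring[OF assms(2)])
  define pre where "pre J = {r \<in> carrier R. I +>\<^bsub>R\<^esub> r \<in> J}" for J
  show ?thesis
  proof (rule q.S.trivial_ideal_chain_imp_noetherian)
    fix C assume C: "C \<noteq> {}" "subset.chain {J. ideal J (R Quot I)} C"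
    have id: "ideal J (R Quot I)" if "J \<in> C" for J
      using C(2) that unfolding subset_chain_def by blast
    have "ideal (pre J) R" if "J \<in> C" for J
      unfolding pre_def using q.ideal_vimage[OF id[OF that]] .
    moreover have "pre J \<subseteq> pre K" if "J \<subseteq> K" for J K
      using that unfolding pre_def by blast
    ultimately have "subset.chain {J. ideal J R} (pre ` C)"
      using C(2) unfolding subset_chain_def by (simp add: image_subset_iff) metis
    then have "\<Union>(pre ` C) \<in> pre ` C"
      using R.ideal_chain_is_trivial C(1) by simp
    then obtain J where J: "J \<in> C" "\<Union>(pre ` C) = pre J" by (rule imageE)
    have "K \<subseteq> J" if K: "K \<in> C" for K
    proof
      fix y assume y: "y \<in> K"
      then have "y \<in> carrier (R Quot I)" by (rule ideal.Icarr[OF id[OF K]])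
      then obtain r where r: "r \<in> carrier R" "y = I +>\<^bsub>R\<^esub> r" unfolding carrier_Quot by (rule imageE)
      then have "r \<in> pre K" using y by (simp add: pre_def)
      then have "r \<in> pre J" using K J(2) by blast
      then show "y \<in> J" using r(2) by (simp add: pre_def)
    qed
    then have "\<Union>C = J" using J(1) by (intro equalityI Union_least Union_upper)
    then show "\<Union>C \<in> C" using J(1) by simp
  qed
qed

section \<open>The conductor\<close>

context cring
begin

lemma conductor_multiple:
  assumes "r \<in> conductor R" "x \<in> carrier (normalization R)"
  obtains a where "a \<in> conductor R" "to_frac R a = to_frac R r \<otimes>\<^bsub>normalization R\<^esub> x"
proof -
  interpret N: ring_hom_cring R "normalization R" "to_frac R" by (rule to_frac_normalization_hom)
  have r: "r \<in> carrier R" "\<And>x. x \<in> carrier (normalization R) \<Longrightarrow>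
      to_frac R r \<otimes>\<^bsub>normalization R\<^esub> x \<in> to_frac R ` carrier R"
    using assms(1) by (simp_all add: conductor_def)
  obtain a where a: "a \<in> carrier R" "to_frac R r \<otimes>\<^bsub>normalization R\<^esub> x = to_frac R a"
    using r(2)[OF assms(2)] by blast
  have "to_frac R a \<otimes>\<^bsub>normalization R\<^esub> y \<in> to_frac R ` carrier R" if y: "y \<in> carrier (normalization R)" for y
  proof -
    have "to_frac R a \<otimes>\<^bsub>normalization R\<^esub> y = to_frac R r \<otimes>\<^bsub>normalization R\<^esub> (x \<otimes>\<^bsub>normalization R\<^esub> y)"
      unfolding a(2)[symmetric] using r(1) y assms(2) by (simp add: N.S.m_assoc)
    then show ?thesis using r(2)[of "x \<otimes>\<^bsub>normalization R\<^esub> y"] y assms(2) by simp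
  qed
  then have "a \<in> conductor R" using a(1) by (simp add: conductor_def)
  with a(2) show ?thesis by (intro that) auto
qed

lemma conductor_ideal: "ideal (conductor R) R"
proof (rule ideal_criterion)
  let ?c = "conductor R" and ?N = "normalization R"
  interpret N: ring_hom_cring R ?N "to_frac R" by (rule to_frac_normalization_hom)
  note image = subringE[OF N.image_subring]
  show "?c \<subseteq> carrier R" by (auto simp: conductor_def)
  show "\<zero> \<in> ?c" using image(2) by (simp add: conductor_def)
  show "r \<oplus> s \<in> ?c" if "r \<in> ?c" "s \<in> ?c" for r s
    using that image(7) by (simp add: conductor_def N.S.l_distr)
  fix x r assume x: "x \<in> carrier R" and r: "r \<in> ?c"
  have rR: "r \<in> carrier R" using r by (simp add: conductor_def)
  obtain a where a: "a \<in> ?c" "to_frac R a = to_frac R r \<otimes>\<^bsub>?N\<^esub> to_frac R x"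
    using conductor_multiple[OF r N.hom_closed[OF x]] .
  have "a \<in> carrier R" using a(1) by (simp add: conductor_def)
  then have "a = x \<otimes> r"
    using inj_onD[OF to_frac_inj, of a "x \<otimes> r"] a(2) rR x by (simp add: N.S.m_comm)
  then show "x \<otimes> r \<in> ?c" using a(1) by simp
qed

lemma conductor_image_ideal: "ideal (to_frac R ` conductor R) (normalization R)"
proof -
  let ?c = "to_frac R ` conductor R" and ?N = "normalization R"
  interpret N: ring_hom_cring R ?N "to_frac R" by (rule to_frac_normalization_hom)
  interpret c: ideal "conductor R" R by (rule conductor_ideal)
  show ?thesis
  proof (rule N.S.ideal_criterion)
    show "?c \<subseteq> carrier ?N" using c.Icarr by auto
    show "\<zero>\<^bsub>?N\<^esub> \<in> ?c" using c.zero_closed by (intro image_eqI[of _ _ "\<zero>"]) auto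
  next
    fix x y assume "x \<in> ?c" "y \<in> ?c"
    then obtain a b where "a \<in> conductor R" "b \<in> conductor R" "x = to_frac R a" "y = to_frac R b" by blast
    then show "x \<oplus>\<^bsub>?N\<^esub> y \<in> ?c" using c.Icarr by (intro image_eqI[of _ _ "a \<oplus> b"]) auto
  next
    fix y x assume y: "y \<in> carrier ?N" and "x \<in> ?c"
    then obtain r where r: "r \<in> conductor R" "x = to_frac R r" by blast
    obtain a where "a \<in> conductor R" "to_frac R a = to_frac R r \<otimes>\<^bsub>?N\<^esub> y"
      using conductor_multiple[OF r(1) y] .
    then show "y \<otimes>\<^bsub>?N\<^esub> x \<in> ?c" using r y c.Icarr by (metis N.S.m_comm N.hom_closed imageI)
  qed
qed

lemma contract_radical_conductor:
  "contract R (to_frac R) (radical (normalization R) (to_frac R ` conductor R)) = radical R (conductor R)"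
proof -
  interpret N: ring_hom_cring R "normalization R" "to_frac R" by (rule to_frac_normalization_hom)
  have "to_frac R x [^]\<^bsub>normalization R\<^esub> n \<in> to_frac R ` conductor R \<longleftrightarrow> x [^] n \<in> conductor R"
    if "x \<in> carrier R" for x and n :: nat
  proof -
    have "conductor R \<subseteq> carrier R" by (auto simp: conductor_def)
    then show ?thesis
      using inj_on_image_mem_iff[OF to_frac_inj, of "x [^] n" "conductor R"] that
      by (simp add: N.ring.hom_nat_pow)
  qed
  then show ?thesis by (auto simp: contract_def radical_def)
qed

end

lemma reduced_subring:
  assumes red: "reduced_ring E" and h: "ring_hom_cring T E h" "inj_on h (carrier T)"
  shows "reduced_ring T"
proof -
  interpret ring_hom_cring T E h by fact
  have "x = \<zero>\<^bsub>T\<^esub>" if x: "x \<in> carrier T" "x [^]\<^bsub>T\<^esub> (n::nat) = \<zero>\<^bsub>T\<^esub>" for x n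
  proof -
    have "h x [^]\<^bsub>E\<^esub> n = \<zero>\<^bsub>E\<^esub>" using x ring.hom_nat_pow[OF x(1), of n] by simp
    then have "h x = \<zero>\<^bsub>E\<^esub>" using red hom_closed[OF x(1)] unfolding reduced_ring_def by blast
    then show ?thesis using inj_onD[OF h(2), of x "\<zero>\<^bsub>T\<^esub>"] x(1) by simp
  qed
  then show ?thesis unfolding reduced_ring_def using R.is_cring by blast
qed

lemma reduced_normalization:
  assumes "reduced_ring R"
  shows "reduced_ring (normalization R)"
proof -
  interpret cring R using assms by (simp add: reduced_ring_def)
  show ?thesis
    using reduced_subring[OF reduced_total_fractions[OF assms] normalization_inclusion] by simp
qed

text \<open>Idempotents are integral, so the support that \<open>x\<close> has in the total ring of fractions lies in the
  normalization.\<close>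

lemma (in cring) normalization_support:
  assumes vnr: "von_neumann_regular (total_fractions R)" and x: "x \<in> carrier (normalization R)"
  shows "\<exists>e\<in>carrier (normalization R). e \<otimes>\<^bsub>normalization R\<^esub> e = e \<and> x \<otimes>\<^bsub>normalization R\<^esub> e = x \<and>
    (\<forall>w\<in>carrier (normalization R). x \<otimes>\<^bsub>normalization R\<^esub> w = \<zero>\<^bsub>normalization R\<^esub> \<longrightarrow>
       e \<otimes>\<^bsub>normalization R\<^esub> w = \<zero>\<^bsub>normalization R\<^esub>)"
proof -
  let ?N = "normalization R" and ?Q = "total_fractions R"
  interpret Q: ring_hom_cring R ?Q "to_frac R" by (rule to_frac_hom)
  have NQ: "carrier ?N \<subseteq> carrier ?Q" using subringE(1)[OF normalization_subring] .
  have ops: "monoid.mult ?N = monoid.mult ?Q" "\<zero>\<^bsub>?N\<^esub> = \<zero>\<^bsub>?Q\<^esub>" by (simp_all add: normalization_def)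
  have xQ: "x \<in> carrier ?Q" using NQ x by blast
  obtain x' where x': "x' \<in> carrier ?Q" "x \<otimes>\<^bsub>?Q\<^esub> x \<otimes>\<^bsub>?Q\<^esub> x' = x"
    using vnr xQ unfolding von_neumann_regular_def by blast
  let ?e = "x \<otimes>\<^bsub>?Q\<^esub> x'"
  have e: "?e \<in> carrier ?Q" using xQ x'(1) by simp
  have xe: "x \<otimes>\<^bsub>?Q\<^esub> ?e = x" using x' xQ by (simp add: Q.S.m_assoc)
  have "?e \<otimes>\<^bsub>?Q\<^esub> ?e = (x \<otimes>\<^bsub>?Q\<^esub> ?e) \<otimes>\<^bsub>?Q\<^esub> x'"
    using xQ x'(1) by (simp add: Q.S.m_ac)
  then have ee: "?e \<otimes>\<^bsub>?Q\<^esub> ?e = ?e" using xe by simp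
  have "integral_over ?Q (to_frac R ` carrier R) ?e"
    unfolding integral_over_def
  proof (intro exI conjI)
    show "set [to_frac R (\<ominus> \<one>), to_frac R \<zero>] \<subseteq> to_frac R ` carrier R"
      unfolding set_simps
      using imageI[OF a_inv_closed[OF one_closed], of "to_frac R"] imageI[OF zero_closed, of "to_frac R"]
      by blast
    show "Q.S.eval (\<one>\<^bsub>?Q\<^esub> # [to_frac R (\<ominus> \<one>), to_frac R \<zero>]) ?e = \<zero>\<^bsub>?Q\<^esub>"
      using e ee by (simp add: numeral_2_eq_2 Q.S.l_minus Q.S.r_neg)
  qed
  then have eN: "?e \<in> carrier ?N" using e by (simp add: normalization_def)
  have "?e \<otimes>\<^bsub>?Q\<^esub> w = \<zero>\<^bsub>?Q\<^esub>" if w: "w \<in> carrier ?N" "x \<otimes>\<^bsub>?Q\<^esub> w = \<zero>\<^bsub>?Q\<^esub>" for w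
  proof -
    have wQ: "w \<in> carrier ?Q" using NQ w(1) by blast
    have "?e \<otimes>\<^bsub>?Q\<^esub> w = x' \<otimes>\<^bsub>?Q\<^esub> (x \<otimes>\<^bsub>?Q\<^esub> w)" using xQ x'(1) wQ by (simp add: Q.S.m_ac)
    then show ?thesis using w(2) x'(1) by simp
  qed
  with eN ee xe show ?thesis unfolding ops by blast
qed

lemma (in cring) complemented_ring_Quot:
  assumes J: "ideal J R"
    and ex: "\<And>x. x \<in> carrier R \<Longrightarrow> \<exists>x'\<in>carrier R. x \<otimes> x' \<in> J \<and>
      (\<forall>z\<in>carrier R. x \<otimes> z \<in> J \<longrightarrow> x' \<otimes> z \<in> J \<longrightarrow> z \<in> J)"
  shows "complemented_ring (R Quot J)"
  unfolding complemented_ring_def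
proof
  let ?B = "R Quot J"
  interpret q: ring_hom_cring R ?B "(+>) J" by (rule ideal.rcos_ring_hom_cring[OF J is_cring])
  note zero = coset_zero_iff[OF J]
  fix b assume "b \<in> carrier ?B"
  then obtain x where x: "x \<in> carrier R" "b = J +> x" unfolding carrier_Quot by (rule imageE)
  obtain x' where x': "x' \<in> carrier R" "x \<otimes> x' \<in> J"
    "\<And>z. z \<in> carrier R \<Longrightarrow> x \<otimes> z \<in> J \<Longrightarrow> x' \<otimes> z \<in> J \<Longrightarrow> z \<in> J"
    using ex[OF x(1)] by blast
  have mult_zero: "(J +> u) \<otimes>\<^bsub>?B\<^esub> (J +> v) = \<zero>\<^bsub>?B\<^esub> \<longleftrightarrow> u \<otimes> v \<in> J"
    if "u \<in> carrier R" "v \<in> carrier R" for u v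
    using zero[of "u \<otimes> v"] that by simp
  have "y = \<zero>\<^bsub>?B\<^esub>"
    if y: "y \<in> carrier ?B" "b \<otimes>\<^bsub>?B\<^esub> y = \<zero>\<^bsub>?B\<^esub>" "(J +> x') \<otimes>\<^bsub>?B\<^esub> y = \<zero>\<^bsub>?B\<^esub>" for y
  proof -
    obtain z where z: "z \<in> carrier R" "y = J +> z" using y(1) unfolding carrier_Quot by (rule imageE)
    have "z \<in> J"
      using x'(3)[OF z(1)] y(2,3) mult_zero[OF x(1) z(1)] mult_zero[OF x'(1) z(1)]
      unfolding x(2) z(2) by blast
    then show ?thesis using zero[OF z(1)] z(2) by simp
  qed
  moreover have "b \<otimes>\<^bsub>?B\<^esub> (J +> x') = \<zero>\<^bsub>?B\<^esub>"
    using mult_zero[OF x(1) x'(1)] x'(2) unfolding x(2) by blast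
  ultimately show "\<exists>b'\<in>carrier ?B. b \<otimes>\<^bsub>?B\<^esub> b' = \<zero>\<^bsub>?B\<^esub> \<and>
      (\<forall>y\<in>carrier ?B. b \<otimes>\<^bsub>?B\<^esub> y = \<zero>\<^bsub>?B\<^esub> \<longrightarrow> b' \<otimes>\<^bsub>?B\<^esub> y = \<zero>\<^bsub>?B\<^esub> \<longrightarrow> y = \<zero>\<^bsub>?B\<^esub>)"
    using q.hom_closed[OF x'(1)] by blast
qed

text \<open>Multiplication by an element \<open>r\<close> of the conductor maps the normalization into \<open>R\<close>.  Where it
  is injective, it embeds the ideals of the normalization into those of \<open>R\<close>.\<close>

lemma (in cring) acc_below_conductor:
  assumes noeth: "noetherian_ring R" and r: "r \<in> conductor R"
    and inj: "\<And>w. w \<in> I \<Longrightarrow> to_frac R r \<otimes>\<^bsub>normalization R\<^esub> w = \<zero>\<^bsub>normalization R\<^esub> \<Longrightarrow>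
      w = \<zero>\<^bsub>normalization R\<^esub>"
  shows "acc_below (normalization R) I"
  unfolding acc_below_def
proof (intro allI impI)
  let ?N = "normalization R" and ?r = "to_frac R r"
  interpret N: ring_hom_cring R ?N "to_frac R" by (rule to_frac_normalization_hom)
  have rN: "?r \<in> carrier ?N" using r by (simp add: conductor_def)
  fix F assume F: "F \<noteq> {}" "\<forall>V\<in>F. ideal V ?N \<and> V \<subseteq> I"
  define \<Phi> where "\<Phi> V = {a \<in> carrier R. \<exists>w\<in>V. to_frac R a = ?r \<otimes>\<^bsub>?N\<^esub> w}" for V
  have \<Phi>_ideal: "ideal (\<Phi> V) R" if V: "V \<in> F" for V
  proof (rule ideal_criterion)
    interpret V: ideal V ?N using F(2) V by blast
    show "\<Phi> V \<subseteq> carrier R" by (auto simp: \<Phi>_def)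
    show "\<zero> \<in> \<Phi> V" using rN V.zero_closed by (auto simp: \<Phi>_def intro!: bexI[of _ "\<zero>\<^bsub>?N\<^esub>"])
    fix x y assume "x \<in> \<Phi> V" "y \<in> \<Phi> V"
    then obtain v w where "x \<in> carrier R" "v \<in> V" "to_frac R x = ?r \<otimes>\<^bsub>?N\<^esub> v"
      "y \<in> carrier R" "w \<in> V" "to_frac R y = ?r \<otimes>\<^bsub>?N\<^esub> w" by (auto simp: \<Phi>_def)
    then show "x \<oplus> y \<in> \<Phi> V"
      using rN V.Icarr V.a_closed[of v w]
      by (auto simp: \<Phi>_def N.S.r_distr intro!: bexI[of _ "v \<oplus>\<^bsub>?N\<^esub> w"])
  next
    interpret V: ideal V ?N using F(2) V by blast
    fix t a assume t: "t \<in> carrier R" and "a \<in> \<Phi> V"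
    then obtain w where w: "a \<in> carrier R" "w \<in> V" "to_frac R a = ?r \<otimes>\<^bsub>?N\<^esub> w" by (auto simp: \<Phi>_def)
    have "to_frac R (t \<otimes> a) = ?r \<otimes>\<^bsub>?N\<^esub> (to_frac R t \<otimes>\<^bsub>?N\<^esub> w)"
      using N.S.m_lcomm[OF rN N.hom_closed[OF t] V.Icarr[OF w(2)]] w t by simp
    then show "t \<otimes> a \<in> \<Phi> V"
      using t w V.I_l_closed[OF w(2) N.hom_closed[OF t]] unfolding \<Phi>_def by blast
  qed
  have "\<exists>L\<in>\<Phi> ` F. \<forall>K\<in>\<Phi> ` F. L \<subseteq> K \<longrightarrow> K = L"
    using F(1) \<Phi>_ideal by (intro noetherian_ring.maximal_in_ideal_family[OF noeth]) auto
  then obtain V where V: "V \<in> F" "\<And>V'. V' \<in> F \<Longrightarrow> \<Phi> V \<subseteq> \<Phi> V' \<Longrightarrow> \<Phi> V' = \<Phi> V"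
    by (elim bexE imageE) (rule that, auto)
  have "V' \<subseteq> V" if V': "V' \<in> F" "V \<subseteq> V'" for V'
  proof
    fix w assume w: "w \<in> V'"
    interpret V': ideal V' ?N using F(2) V'(1) by blast
    have wN: "w \<in> carrier ?N" using w by (rule V'.Icarr)
    obtain a where a: "a \<in> conductor R" "to_frac R a = ?r \<otimes>\<^bsub>?N\<^esub> w"
      using conductor_multiple[OF r wN] .
    then have "a \<in> \<Phi> V'" using w by (auto simp: \<Phi>_def conductor_def)
    moreover have "\<Phi> V \<subseteq> \<Phi> V'" using V'(2) unfolding \<Phi>_def by blast
    ultimately have "a \<in> \<Phi> V" using V(2)[OF V'(1)] by blast
    then obtain w' where w': "w' \<in> V" "to_frac R a = ?r \<otimes>\<^bsub>?N\<^esub> w'" by (auto simp: \<Phi>_def)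
    have w'N: "w' \<in> carrier ?N" using w'(1) V'(2) V'.Icarr by blast
    have "?r \<otimes>\<^bsub>?N\<^esub> (w \<ominus>\<^bsub>?N\<^esub> w') = ?r \<otimes>\<^bsub>?N\<^esub> w \<ominus>\<^bsub>?N\<^esub> ?r \<otimes>\<^bsub>?N\<^esub> w'" using rN wN w'N by algebra
    also have "\<dots> = \<zero>\<^bsub>?N\<^esub>" using a(2) w'(2) rN wN w'N by (simp add: a_minus_def N.S.r_neg)
    finally have z: "?r \<otimes>\<^bsub>?N\<^esub> (w \<ominus>\<^bsub>?N\<^esub> w') = \<zero>\<^bsub>?N\<^esub>" .
    have "w \<ominus>\<^bsub>?N\<^esub> w' \<in> I"
      using N.S.ideal_minus_closed[OF V'.is_ideal w] w'(1) V'(2) F(2) V'(1) by blast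
    then have "w \<ominus>\<^bsub>?N\<^esub> w' = \<zero>\<^bsub>?N\<^esub>" using z by (rule inj)
    then have "w = w'" using wN w'N by simp
    then show "w \<in> V" using w'(1) by simp
  qed
  then show "\<exists>V\<in>F. \<forall>K\<in>F. V \<subseteq> K \<longrightarrow> K = V" using V(1) by blast
qed

text \<open>This is applied with the normalization in the role of \<open>R\<close>.  An idempotent \<open>e\<close> splits the ring
  into a part that contains \<open>J\<close> and has the ascending chain condition, and a part in which every
  \<open>x\<close> has a support \<open>f\<close>.  The complement of \<open>x\<close> modulo \<open>J\<close> is the sum of the one found by the chain
  condition and of \<open>(1 - e) (1 - f)\<close>.\<close>

lemma (in cring) complemented_Quot_split:
  assumes J: "ideal J R" "\<And>x. x \<in> carrier R \<Longrightarrow> x \<otimes> x \<in> J \<Longrightarrow> x \<in> J"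
    and e: "e \<in> carrier R" "e \<otimes> e = e" and eJ: "\<And>y. y \<in> J \<Longrightarrow> (\<one> \<ominus> e) \<otimes> y = \<zero>"
    and acc: "\<And>I. (\<And>w. w \<in> I \<Longrightarrow> w \<in> carrier R \<and> (\<one> \<ominus> e) \<otimes> w = \<zero>) \<Longrightarrow> acc_below R I"
    and support: "\<And>x. x \<in> carrier R \<Longrightarrow> \<exists>f\<in>carrier R. x \<otimes> f = x \<and>
      (\<forall>w\<in>carrier R. x \<otimes> w = \<zero> \<longrightarrow> f \<otimes> w = \<zero>)"
  shows "complemented_ring (R Quot J)"
proof (rule complemented_ring_Quot[OF J(1)])
  interpret J: ideal J R by fact
  define e' where "e' = \<one> \<ominus> e"
  have e': "e' \<in> carrier R" using e(1) by (simp add: e'_def)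
  note eJ = eJ[folded e'_def] and acc = acc[folded e'_def]
  have decomp: "w = e \<otimes> w \<oplus> e' \<otimes> w" if "w \<in> carrier R" for w
    unfolding e'_def using e(1) that by algebra
  have "e \<otimes> e' = e \<ominus> e \<otimes> e" unfolding e'_def using e(1) by algebra
  then have ee': "e \<otimes> e' = \<zero>" using e by (simp add: a_minus_def r_neg)
  fix x assume x: "x \<in> carrier R"
  define I where "I = {z \<in> carrier R. x \<otimes> z \<in> J} \<inter> {z \<in> carrier R. e' \<otimes> z \<in> {\<zero>}}"
  have I: "ideal I R"
    unfolding I_def by (intro i_intersect ideal_colon J(1) zeroideal x e')
  have "acc_below R I" by (rule acc) (simp add: I_def)
  then obtain x' where x': "x' \<in> I" "\<And>z. z \<in> I \<Longrightarrow> x' \<otimes> z \<in> J \<Longrightarrow> z \<in> J"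
    using ex_regular_on_ideal[OF J I] by blast
  have x'c: "x' \<in> carrier R" "x \<otimes> x' \<in> J" "e' \<otimes> x' = \<zero>"
    using x'(1) by (simp_all add: I_def)
  obtain f where f: "f \<in> carrier R" "x \<otimes> f = x"
    "\<And>w. w \<in> carrier R \<Longrightarrow> x \<otimes> w = \<zero> \<Longrightarrow> f \<otimes> w = \<zero>"
    using support[OF x] by blast
  define g where "g = e' \<otimes> (\<one> \<ominus> f)"
  have g: "g \<in> carrier R" using e' f(1) by (simp add: g_def)
  have "x \<otimes> g = e' \<otimes> (x \<ominus> x \<otimes> f)" unfolding g_def using e' f(1) x by algebra
  then have xg: "x \<otimes> g = \<zero>" using e' f(2) x by (simp add: a_minus_def r_neg)
  have "e \<otimes> g = (e \<otimes> e') \<otimes> (\<one> \<ominus> f)" unfolding g_def using e' f(1) e(1) by algebra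
  then have eg: "e \<otimes> g = \<zero>" using ee' f(1) by simp
  let ?x = "x' \<oplus> g"
  have xx: "x \<otimes> ?x \<in> J" using x x'c(1,2) g xg by (simp add: r_distr)
  have "z \<in> J" if z: "z \<in> carrier R" and xz: "x \<otimes> z \<in> J" and x''z: "?x \<otimes> z \<in> J" for z
  proof -
    have "e \<otimes> (?x \<otimes> z) = (e \<otimes> g) \<otimes> z \<oplus> x' \<otimes> (e \<otimes> z)"
      using e(1) x'c(1) g z by algebra
    then have "x' \<otimes> (e \<otimes> z) \<in> J"
      using J.I_l_closed[OF x''z e(1)] eg x'c(1) e(1) z by simp
    moreover have "e \<otimes> z \<in> I"
    proof -
      have "x \<otimes> (e \<otimes> z) = e \<otimes> (x \<otimes> z)" by (rule m_lcomm[OF x e(1) z])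
      moreover have "e' \<otimes> (e \<otimes> z) = (e \<otimes> e') \<otimes> z" using e(1) e' z by algebra
      ultimately show ?thesis
        using J.I_l_closed[OF xz e(1)] ee' e(1) z by (simp add: I_def)
    qed
    ultimately have ez: "e \<otimes> z \<in> J" using x'(2) by blast
    have "g \<otimes> z = e' \<otimes> (?x \<otimes> z) \<ominus> (e' \<otimes> x') \<otimes> z \<oplus> (e \<otimes> g) \<otimes> z"
      unfolding e'_def using e(1) x'c(1) g z by algebra
    then have gz: "g \<otimes> z = \<zero>" using eJ[OF x''z] x'c(3) eg z by simp
    have "x \<otimes> (e' \<otimes> z) = e' \<otimes> (x \<otimes> z)" by (rule m_lcomm[OF x e' z])
    then have fz: "f \<otimes> (e' \<otimes> z) = \<zero>" using f(3) eJ[OF xz] e' z by simp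
    have "e' \<otimes> z = g \<otimes> z \<oplus> f \<otimes> (e' \<otimes> z)" unfolding g_def using e' f(1) z by algebra
    then have "z = e \<otimes> z" using decomp[OF z] gz fz e(1) z by simp
    then show ?thesis using ez by simp
  qed
  then show "\<exists>x'\<in>carrier R. x \<otimes> x' \<in> J \<and>
      (\<forall>z\<in>carrier R. x \<otimes> z \<in> J \<longrightarrow> x' \<otimes> z \<in> J \<longrightarrow> z \<in> J)"
    using xx x'c(1) g by (intro bexI[of _ ?x]) blast+
qed

text \<open>The normalization \<open>N\<close> need not be Noetherian, but an element \<open>r\<close> of the conductor with the same
  annihilator as the whole conductor has an idempotent \<open>e \<in> N\<close> as its support, and \<open>e\<close> splits \<open>N\<close>
  into a part that \<open>r\<close> embeds into \<open>R\<close> and a part on which the conductor vanishes.\<close>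

theorem complemented_Quot_radical_conductor:
  fixes R (structure)
  assumes noeth: "noetherian_ring R" and red: "reduced_ring R"
  shows "complemented_ring (normalization R Quot radical (normalization R) (to_frac R ` conductor R))"
proof -
  interpret cring R using red by (simp add: reduced_ring_def)
  let ?N = "normalization R"
  interpret N: ring_hom_cring R ?N "to_frac R" by (rule to_frac_normalization_hom)
  define J where "J = radical ?N (to_frac R ` conductor R)"
  have J: "ideal J ?N" unfolding J_def by (rule N.S.radical_ideal[OF conductor_image_ideal])
  have redN: "reduced_ring ?N" by (rule reduced_normalization[OF red])
  note support = normalization_support[OF von_neumann_regular_total_fractions[OF red
        noetherian_complemented_ring[OF red noeth]]]
  obtain r where r: "r \<in> conductor R" "\<And>z. z \<in> conductor R \<Longrightarrow> r \<otimes> z = \<zero> \<Longrightarrow> z = \<zero>"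
    using ex_regular_on_ideal[OF zeroideal reduced_zero_radical[OF red] conductor_ideal
        noetherian_acc_below[OF noeth]] by blast
  have rR: "r \<in> carrier R" using r(1) by (simp add: conductor_def)
  define \<rho> where "\<rho> = to_frac R r"
  have \<rho>: "\<rho> \<in> carrier ?N" using rR by (simp add: \<rho>_def)
  obtain e where e: "e \<in> carrier ?N" "e \<otimes>\<^bsub>?N\<^esub> e = e" "\<rho> \<otimes>\<^bsub>?N\<^esub> e = \<rho>"
    "\<And>w. w \<in> carrier ?N \<Longrightarrow> \<rho> \<otimes>\<^bsub>?N\<^esub> w = \<zero>\<^bsub>?N\<^esub> \<Longrightarrow> e \<otimes>\<^bsub>?N\<^esub> w = \<zero>\<^bsub>?N\<^esub>"
    using support[OF \<rho>] by blast
  let ?e' = "\<one>\<^bsub>?N\<^esub> \<ominus>\<^bsub>?N\<^esub> e"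
  have e': "?e' \<in> carrier ?N" using e(1) by simp
  have "\<rho> \<otimes>\<^bsub>?N\<^esub> ?e' = \<rho> \<ominus>\<^bsub>?N\<^esub> \<rho> \<otimes>\<^bsub>?N\<^esub> e" using e(1) \<rho> by algebra
  then have \<rho>e': "\<rho> \<otimes>\<^bsub>?N\<^esub> ?e' = \<zero>\<^bsub>?N\<^esub>" using \<rho> e(3) by (simp add: a_minus_def N.S.r_neg)
  show ?thesis
    unfolding J_def[symmetric]
  proof (rule N.S.complemented_Quot_split[OF J _ e(1,2)])
    \<comment> \<open>\<open>J\<close> is a radical ideal.\<close>
    show "x \<in> J" if x: "x \<in> carrier ?N" "x \<otimes>\<^bsub>?N\<^esub> x \<in> J" for x
    proof -
      obtain n :: nat where "n > 0" "(x \<otimes>\<^bsub>?N\<^esub> x) [^]\<^bsub>?N\<^esub> n \<in> to_frac R ` conductor R"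
        using x(2) unfolding J_def radical_def by blast
      then have "n + n > 0" "x [^]\<^bsub>?N\<^esub> (n + n) \<in> to_frac R ` conductor R"
        using x(1) by (simp_all add: N.S.nat_pow_distrib N.S.nat_pow_mult[symmetric])
      then show ?thesis unfolding J_def radical_def using x(1) by blast
    qed
  next
    \<comment> \<open>Since \<open>r\<close> annihilates \<open>1 - e\<close>, the conductor does, and so does its radical, as the normalization is reduced.\<close>
    fix y assume y: "y \<in> J"
    then have yN: "y \<in> carrier ?N" by (rule ideal.Icarr[OF J])
    obtain n :: nat where n: "n > 0" "y [^]\<^bsub>?N\<^esub> n \<in> to_frac R ` conductor R"
      using y unfolding J_def radical_def by blast
    then obtain c0 where c0: "c0 \<in> conductor R" "y [^]\<^bsub>?N\<^esub> n = to_frac R c0" by blast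
    have c0R: "c0 \<in> carrier R" using c0(1) by (simp add: conductor_def)
    obtain t where t: "t \<in> conductor R" "to_frac R t = to_frac R c0 \<otimes>\<^bsub>?N\<^esub> ?e'"
      using conductor_multiple[OF c0(1) e'] .
    have tR: "t \<in> carrier R" using t(1) by (simp add: conductor_def)
    have "to_frac R (r \<otimes> t) = to_frac R c0 \<otimes>\<^bsub>?N\<^esub> (\<rho> \<otimes>\<^bsub>?N\<^esub> ?e')"
      using rR tR e' c0R t(2) by (simp add: \<rho>_def N.S.m_ac)
    also have "\<dots> = to_frac R \<zero>" using \<rho>e' c0R by simp
    finally have "r \<otimes> t = \<zero>"
      using inj_onD[OF to_frac_inj] rR tR by (meson m_closed zero_closed)
    then have "t = \<zero>" using r(2) t(1) by blast
    then have z: "y [^]\<^bsub>?N\<^esub> n \<otimes>\<^bsub>?N\<^esub> ?e' = \<zero>\<^bsub>?N\<^esub>" using t(2) c0(2) by simp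
    obtain k where k: "n = Suc k" using n(1) by (cases n) auto
    have "(?e' \<otimes>\<^bsub>?N\<^esub> y) [^]\<^bsub>?N\<^esub> n = ?e' [^]\<^bsub>?N\<^esub> k \<otimes>\<^bsub>?N\<^esub> (y [^]\<^bsub>?N\<^esub> n \<otimes>\<^bsub>?N\<^esub> ?e')"
      using e' yN by (simp add: N.S.nat_pow_distrib k N.S.m_ac)
    then have "(?e' \<otimes>\<^bsub>?N\<^esub> y) [^]\<^bsub>?N\<^esub> n = \<zero>\<^bsub>?N\<^esub>" using z e' by simp
    then show "?e' \<otimes>\<^bsub>?N\<^esub> y = \<zero>\<^bsub>?N\<^esub>"
      using redN N.S.m_closed[OF e' yN] unfolding reduced_ring_def by blast
  next
    \<comment> \<open>On the part cut out by \<open>e\<close>, multiplication by \<open>r\<close> is injective.\<close>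
    fix I assume I: "\<And>w. w \<in> I \<Longrightarrow> w \<in> carrier ?N \<and> ?e' \<otimes>\<^bsub>?N\<^esub> w = \<zero>\<^bsub>?N\<^esub>"
    show "acc_below ?N I"
    proof (rule acc_below_conductor[OF noeth r(1)])
      fix w assume w: "w \<in> I" "to_frac R r \<otimes>\<^bsub>?N\<^esub> w = \<zero>\<^bsub>?N\<^esub>"
      have wN: "w \<in> carrier ?N" using I[OF w(1)] by blast
      have "w = e \<otimes>\<^bsub>?N\<^esub> w \<oplus>\<^bsub>?N\<^esub> ?e' \<otimes>\<^bsub>?N\<^esub> w" using e(1) wN by algebra
      then show "w = \<zero>\<^bsub>?N\<^esub>" using e(4)[OF wN w(2)[folded \<rho>_def]] I[OF w(1)] by simp
    qed
  next
    fix x assume "x \<in> carrier ?N"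
    from support[OF this] show "\<exists>f\<in>carrier ?N. x \<otimes>\<^bsub>?N\<^esub> f = x \<and>
        (\<forall>w\<in>carrier ?N. x \<otimes>\<^bsub>?N\<^esub> w = \<zero>\<^bsub>?N\<^esub> \<longrightarrow> f \<otimes>\<^bsub>?N\<^esub> w = \<zero>\<^bsub>?N\<^esub>)" by blast
  qed
qed

section \<open>The seminormalization as a pullback\<close>

lemma lying_over_surj:
  assumes q: "ring_hom_cring A B q" and surj: "carrier B = q ` carrier A"
    and p: "p \<in> Spec A" and ker: "\<And>a. a \<in> carrier A \<Longrightarrow> q a = \<zero>\<^bsub>B\<^esub> \<Longrightarrow> a \<in> p"
  obtains P where "P \<in> Spec B" "contract A q P = p"
proof -
  interpret q: ring_hom_cring A B q by fact
  interpret cring_with_subring B "q ` carrier A"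
    using q.S.is_cring q.S.carrier_is_subring
    by (intro cring_with_subring.intro cring_with_subring_axioms.intro) (simp_all add: surj)
  have "contract A q {\<zero>\<^bsub>B\<^esub>} \<subseteq> p" using ker by (auto simp: contract_def)
  moreover have "integral_over B (q ` carrier A) t" if "t \<in> carrier B" for t
    using that integral_over_K by (simp add: surj)
  ultimately show ?thesis
    using q.lying_over[OF _ q.S.zeroideal p] that by metis
qed

lemma contract_surj_inj:
  assumes q: "carrier B = q ` carrier A" and P: "P \<in> Spec B" "P' \<in> Spec B"
    and e: "contract A q P = contract A q P'"
  shows "P = P'"
proof -
  have sub: "P \<subseteq> carrier B" if "P \<in> Spec B" for P
    using additive_subgroup.a_subset[OF ideal.axioms(1)[OF Spec_ideal[OF that]]] .
  have "P = q ` contract A q P" if "P \<in> Spec B" for P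
    using sub[OF that] unfolding q contract_def by blast
  with P e show ?thesis by metis
qed

text \<open>Let \<open>x\<close> be in the seminormalization of \<open>R\<close>.  By functoriality its image under
  \<open>R\<^sup>S\<^sup>N \<rightarrow> A\<^sup>S\<^sup>N \<rightarrow> B\<^sup>S\<^sup>N\<close> is the class of \<open>x\<close>, because homomorphisms from \<open>R\<^sup>S\<^sup>N\<close> to a reduced ring are
  determined by their restrictions to \<open>R\<close>.  Conversely, let the class of \<open>x\<close> come from \<open>t \<in> A\<^sup>S\<^sup>N\<close>, and let \<open>p\<close> be a prime of
  \<open>R\<close>.  If \<open>p\<close> does not contain the conductor, some \<open>s \<notin> p\<close> satisfies \<open>s x \<in> R\<close>.  If it does, \<open>p\<close> and
  all primes of \<open>N\<close> over it come from \<open>A\<close> and \<open>B\<close>, and the value of \<open>t\<close> at the point of \<open>A\<^sup>S\<^sup>N\<close> over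
  \<open>p\<close> is the value of \<open>x\<close> at each of them.\<close>

theorem pullback_eq_pointwise_closure:
  fixes R :: "('a, 'm) ring_scheme"
  assumes noeth: "noetherian_ring R" and red: "reduced_ring R"
  defines "N \<equiv> normalization R" and "\<iota> \<equiv> to_frac R"
  defines "J \<equiv> radical N (\<iota> ` conductor R)" and "I \<equiv> radical R (conductor R)"
  defines "A \<equiv> R Quot I" and "B \<equiv> N Quot J"
  defines "\<phi> \<equiv> seminormalization_map A B (quot_map N J \<iota>)"
  assumes x: "x \<in> carrier N"
  shows "to_frac B (J +>\<^bsub>N\<^esub> x) \<in> \<phi> ` carrier (seminormalization A) \<longleftrightarrow> x \<in> pointwise_closure R N \<iota>"
proof -
  interpret R: cring R using red by (simp add: reduced_ring_def)
  interpret N: ring_hom_cring R N \<iota> unfolding N_def \<iota>_def by (rule R.to_frac_normalization_hom)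
  have c: "ideal (conductor R) R" by (rule R.conductor_ideal)
  have cN: "ideal (\<iota> ` conductor R) N" unfolding \<iota>_def N_def by (rule R.conductor_image_ideal)
  have I: "ideal I R" unfolding I_def by (rule R.radical_ideal[OF c])
  have J: "ideal J N" unfolding J_def by (rule N.S.radical_ideal[OF cN])
  have contract_J: "contract R \<iota> J = I"
    unfolding J_def I_def N_def \<iota>_def by (rule R.contract_radical_conductor)
  have IJ: "\<iota> ` I \<subseteq> J" using contract_J unfolding contract_def by blast
  define \<pi> where "\<pi> = (\<lambda>a. I +>\<^bsub>R\<^esub> a)"
  define \<beta> where "\<beta> = (\<lambda>y. J +>\<^bsub>N\<^esub> y)"
  interpret \<pi>: ring_hom_cring R A \<pi>
    unfolding A_def \<pi>_def by (rule ideal.rcos_ring_hom_cring[OF I R.is_cring])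
  interpret \<beta>: ring_hom_cring N B \<beta>
    unfolding B_def \<beta>_def by (rule ideal.rcos_ring_hom_cring[OF J N.S.is_cring])
  have surj: "carrier A = \<pi> ` carrier R" "carrier B = \<beta> ` carrier N"
    unfolding A_def B_def \<pi>_def \<beta>_def by (rule carrier_Quot)+
  have zero_\<beta>: "\<beta> y = \<zero>\<^bsub>B\<^esub> \<longleftrightarrow> y \<in> J" if "y \<in> carrier N" for y
    unfolding \<beta>_def B_def by (rule N.S.coset_zero_iff[OF J that])
  have zero_\<pi>: "\<pi> a = \<zero>\<^bsub>A\<^esub> \<longleftrightarrow> a \<in> I" if "a \<in> carrier R" for a
    unfolding \<pi>_def A_def by (rule R.coset_zero_iff[OF I that])
  define q where "q = quot_map N J \<iota>"
  interpret q: ring_hom_cring A B q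
    unfolding q_def A_def B_def by (rule N.quot_map_hom[OF I J IJ])
  have q: "q (\<pi> a) = \<beta> (\<iota> a)" if "a \<in> carrier R" for a
    unfolding q_def \<pi>_def \<beta>_def by (rule N.quot_map_coset[OF I J IJ that])
  have noethA: "noetherian_ring A" unfolding A_def by (rule noetherian_ring_Quot[OF noeth I])
  have redA: "reduced_ring A" unfolding A_def I_def by (rule R.reduced_ring_Quot_radical[OF c])
  have redB: "reduced_ring B" unfolding B_def J_def by (rule N.S.reduced_ring_Quot_radical[OF cN])
  have vnrA: "von_neumann_regular (total_fractions A)"
    by (rule von_neumann_regular_total_fractions[OF redA noetherian_complemented_ring[OF redA noethA]])
  have vnrB: "von_neumann_regular (total_fractions B)"
    by (rule von_neumann_regular_total_fractions[OF redB])
      (unfold B_def J_def N_def \<iota>_def, rule complemented_Quot_radical_conductor[OF noeth red])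
  let ?SA = "seminormalization A" and ?SB = "seminormalization B" and ?SR = "seminormalization R"
    and ?E = "total_fractions B"
  have \<phi>: "\<phi> \<in> ring_hom ?SA ?SB" "\<And>a. a \<in> carrier A \<Longrightarrow> \<phi> (to_frac A a) = to_frac B (q a)"
    unfolding \<phi>_def q_def[symmetric]
    using seminormalization_map[OF q.ring_hom_cring_axioms noethA redB vnrB] by blast+
  interpret iA: ring_hom_cring A ?SA "to_frac A" by (rule \<pi>.S.seminormalization_hom)
  interpret iB: ring_hom_cring B ?SB "to_frac B" by (rule \<beta>.S.seminormalization_hom)
  interpret iR: ring_hom_cring R ?SR \<iota> unfolding \<iota>_def by (rule R.seminormalization_hom)
  interpret eB: ring_hom_cring B ?E "to_frac B" by (rule \<beta>.S.to_frac_hom)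
  interpret \<phi>: ring_hom_cring ?SA ?SB \<phi> by unfold_locales (rule \<phi>(1))
  have SR: "carrier ?SR = pointwise_closure R N \<iota>"
    unfolding N_def \<iota>_def by (rule R.carrier_seminormalization)
  show ?thesis
  proof
    assume x': "x \<in> pointwise_closure R N \<iota>"
    \<comment> \<open>Functoriality along \<open>R \<rightarrow> A\<close> produces the preimage of the class of \<open>x\<close>.\<close>
    define \<psi> where "\<psi> = seminormalization_map R A \<pi>"
    have \<psi>: "\<psi> \<in> ring_hom ?SR ?SA" "\<And>a. a \<in> carrier R \<Longrightarrow> \<psi> (\<iota> a) = to_frac A (\<pi> a)"
      unfolding \<psi>_def \<iota>_def
      using seminormalization_map[OF \<pi>.ring_hom_cring_axioms noeth redA vnrA] by blast+
    have SBE: "id \<in> ring_hom ?SB ?E"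
      using ring_hom_trans[OF ring_hom_cring.homh[OF \<beta>.S.seminormalization_inclusion]
          ring_hom_cring.homh[OF \<beta>.S.normalization_inclusion]] by simp
    have SRN: "id \<in> ring_hom ?SR N"
      unfolding N_def by (rule ring_hom_cring.homh[OF R.seminormalization_inclusion])
    have 1: "\<phi> \<circ> \<psi> \<in> ring_hom ?SR ?E"
      using ring_hom_trans[OF ring_hom_trans[OF \<psi>(1) \<phi>(1)] SBE] by simp
    have 2: "to_frac B \<circ> \<beta> \<in> ring_hom ?SR ?E"
      using ring_hom_trans[OF ring_hom_trans[OF SRN \<beta>.homh] eB.homh] by simp
    interpret span: hom_span R ?SR \<iota> ?E "to_frac B \<circ> \<beta> \<circ> \<iota>"
      by (intro hom_span.intro iR.ring_hom_cring_axioms)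
        (unfold_locales, rule ring_hom_trans[OF iR.homh 2])
    have "spec_residue_iso R ?SR \<iota>" unfolding \<iota>_def by (rule R.seminormalization_iso)
    then have "(\<phi> \<circ> \<psi>) x = (to_frac B \<circ> \<beta>) x"
      using span.extension_unique[OF _ reduced_total_fractions[OF redB] 1 _ 2, of x] x' \<phi>(2) \<psi>(2) q
      by (simp add: SR)
    moreover have "\<psi> x \<in> carrier ?SA" using ring_hom_closed[OF \<psi>(1)] x' by (simp add: SR)
    ultimately show "to_frac B (J +>\<^bsub>N\<^esub> x) \<in> \<phi> ` carrier ?SA"
      by (intro image_eqI[of _ _ "\<psi> x"]) (simp_all add: \<beta>_def)
  next
    assume "to_frac B (J +>\<^bsub>N\<^esub> x) \<in> \<phi> ` carrier ?SA"
    then obtain t where t: "t \<in> carrier ?SA" "\<phi> t = to_frac B (\<beta> x)" by (auto simp: \<beta>_def)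
    have bij: "bij_betw (contract A (to_frac A)) (Spec ?SA) (Spec A)"
      and res: "\<And>Q. Q \<in> Spec ?SA \<Longrightarrow> residually_trivial A ?SA (to_frac A) Q"
      using \<pi>.S.seminormalization_iso unfolding spec_residue_iso_iff[OF iA.ring_hom_cring_axioms] by blast+
    show "x \<in> pointwise_closure R N \<iota>"
    proof (rule N.pointwise_closureI[OF x])
      fix p assume p: "p \<in> Spec R"
      show "\<exists>s\<in>carrier R. \<exists>a\<in>carrier R. s \<notin> p \<and>
          (\<forall>Q\<in>Spec N. contract R \<iota> Q = p \<longrightarrow> \<iota> s \<otimes>\<^bsub>N\<^esub> x \<ominus>\<^bsub>N\<^esub> \<iota> a \<in> Q)"
      proof (cases "conductor R \<subseteq> p")
        case False
        then obtain s where s: "s \<in> conductor R" "s \<notin> p" by blast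
        have sR: "s \<in> carrier R" using s(1) by (simp add: conductor_def)
        obtain a where a: "a \<in> conductor R" "\<iota> a = \<iota> s \<otimes>\<^bsub>N\<^esub> x"
          using R.conductor_multiple[OF s(1) x[unfolded N_def]] unfolding N_def \<iota>_def .
        have aR: "a \<in> carrier R" using a(1) by (simp add: conductor_def)
        have "\<iota> s \<otimes>\<^bsub>N\<^esub> x \<ominus>\<^bsub>N\<^esub> \<iota> a \<in> Q" if "Q \<in> Spec N" for Q
        proof -
          interpret Q: primeideal Q N using that by (simp add: Spec_iff)
          show ?thesis using a(2)[symmetric] aR by (simp add: a_minus_def N.S.r_neg Q.zero_closed)
        qed
        with s(2) sR aR show ?thesis by blast
      next
        case True
        have Ip: "I \<subseteq> p" unfolding I_def by (rule R.radical_subset_prime[OF c p True])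
        obtain p' where p': "p' \<in> Spec A" "contract R \<pi> p' = p"
        proof (rule lying_over_surj[OF \<pi>.ring_hom_cring_axioms surj(1) p])
          show "a \<in> p" if "a \<in> carrier R" "\<pi> a = \<zero>\<^bsub>A\<^esub>" for a
            using zero_\<pi> that Ip by blast
        qed
        have "p' \<in> contract A (to_frac A) ` Spec ?SA"
          unfolding bij_betw_imp_surj_on[OF bij] by (rule p'(1))
        then obtain P where P: "P \<in> Spec ?SA" "contract A (to_frac A) P = p'"
          by (elim imageE) (rule that, simp_all)
        obtain s' a' where s': "s' \<in> carrier A" "a' \<in> carrier A" "to_frac A s' \<notin> P"
          "to_frac A s' \<otimes>\<^bsub>?SA\<^esub> t \<ominus>\<^bsub>?SA\<^esub> to_frac A a' \<in> P"
          using res[OF P(1)] t(1) unfolding residually_trivial_def by blast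
        obtain s where s: "s \<in> carrier R" "s' = \<pi> s" using s'(1) unfolding surj by (rule imageE)
        obtain a where a: "a \<in> carrier R" "a' = \<pi> a" using s'(2) unfolding surj by (rule imageE)
        have "s' \<notin> contract A (to_frac A) P" using s'(3) unfolding contract_def by blast
        then have "s' \<notin> p'" unfolding P(2) .
        then have "s \<notin> contract R \<pi> p'" using s(2) unfolding contract_def by blast
        then have sp: "s \<notin> p" unfolding p'(2) .
        have "\<iota> s \<otimes>\<^bsub>N\<^esub> x \<ominus>\<^bsub>N\<^esub> \<iota> a \<in> Q" if Q: "Q \<in> Spec N" "contract R \<iota> Q = p" for Q
        proof -
          have "\<iota> ` conductor R \<subseteq> Q" using True unfolding Q(2)[symmetric] contract_def by blast
          then have JQ: "J \<subseteq> Q" unfolding J_def by (rule N.S.radical_subset_prime[OF cN Q(1)])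
          obtain Q1 where Q1: "Q1 \<in> Spec B" "contract N \<beta> Q1 = Q"
          proof (rule lying_over_surj[OF \<beta>.ring_hom_cring_axioms surj(2) Q(1)])
            show "y \<in> Q" if "y \<in> carrier N" "\<beta> y = \<zero>\<^bsub>B\<^esub>" for y
              using zero_\<beta> that JQ by blast
          qed
          obtain Q2 where Q2: "Q2 \<in> Spec ?SB" "contract B (to_frac B) Q2 = Q1"
            using iB.lying_over_zero[OF \<beta>.S.seminormalization_integral \<beta>.S.to_frac_inj Q1(1)] .
          have down: "y \<in> Q" if y: "y \<in> carrier N" "to_frac B (\<beta> y) \<in> Q2" for y
          proof -
            have "\<beta> y \<in> contract B (to_frac B) Q2" using y \<beta>.hom_closed unfolding contract_def by blast
            then have "\<beta> y \<in> Q1" unfolding Q2(2) .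
            then have "y \<in> contract N \<beta> Q1" using y(1) unfolding contract_def by blast
            then show ?thesis unfolding Q1(2) .
          qed
          \<comment> \<open>The prime \<open>Q2\<close> of \<open>B\<^sup>S\<^sup>N\<close> over \<open>Q\<close> restricts to the one point of \<open>A\<^sup>S\<^sup>N\<close> over \<open>p\<close>.\<close>
          let ?P = "contract ?SA \<phi> Q2"
          have P': "?P \<in> Spec ?SA" by (rule contract_Spec[OF \<phi>.ring_hom_cring_axioms Q2(1)])
          have "contract R \<pi> (contract A (to_frac A) ?P) = contract R (\<phi> \<circ> to_frac A \<circ> \<pi>) Q2"
            using \<pi>.hom_closed iA.hom_closed by (simp add: contract_comp image_subset_iff o_assoc)
          also have "\<dots> = contract R (to_frac B \<circ> \<beta> \<circ> \<iota>) Q2"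
            by (rule contract_cong) (simp add: \<phi>(2) q)
          also have "\<dots> = contract R \<iota> (contract N \<beta> (contract B (to_frac B) Q2))"
            using N.hom_closed \<beta>.hom_closed by (simp add: contract_comp image_subset_iff o_assoc)
          also have "\<dots> = contract R \<pi> p'" unfolding Q2(2) Q1(2) Q(2) p'(2) ..
          finally have "contract A (to_frac A) ?P = p'"
            by (rule contract_surj_inj[OF surj(1) contract_Spec[OF iA.ring_hom_cring_axioms P'] p'(1)])
          then have "?P = P"
            using inj_onD[OF bij_betw_imp_inj_on[OF bij] _ P' P(1)] P(2) by simp
          then have m: "\<phi> (to_frac A s' \<otimes>\<^bsub>?SA\<^esub> t \<ominus>\<^bsub>?SA\<^esub> to_frac A a') \<in> Q2"
            using s'(4) unfolding contract_def by blast
          have cl: "to_frac A s' \<in> carrier ?SA" "to_frac A a' \<in> carrier ?SA" using s'(1,2) by auto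
          have cN': "\<iota> s \<in> carrier N" "\<iota> a \<in> carrier N" "\<iota> s \<otimes>\<^bsub>N\<^esub> x \<in> carrier N"
            using s(1) a(1) x by auto
          have "\<phi> (to_frac A s' \<otimes>\<^bsub>?SA\<^esub> t \<ominus>\<^bsub>?SA\<^esub> to_frac A a')
              = to_frac B (\<beta> (\<iota> s)) \<otimes>\<^bsub>?SB\<^esub> to_frac B (\<beta> x) \<ominus>\<^bsub>?SB\<^esub> to_frac B (\<beta> (\<iota> a))"
            unfolding \<phi>.hom_minus[OF iA.S.m_closed[OF cl(1) t(1)] cl(2)] \<phi>.hom_mult[OF cl(1) t(1)] t(2)
              \<phi>(2)[OF s'(1)] \<phi>(2)[OF s'(2)]
            unfolding s(2) a(2) q[OF s(1)] q[OF a(1)] ..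
          also have "\<dots> = to_frac B (\<beta> (\<iota> s \<otimes>\<^bsub>N\<^esub> x \<ominus>\<^bsub>N\<^esub> \<iota> a))"
            unfolding \<beta>.hom_minus[OF cN'(3,2)] \<beta>.hom_mult[OF cN'(1) x]
              iB.hom_minus[OF \<beta>.S.m_closed[OF \<beta>.hom_closed[OF cN'(1)] \<beta>.hom_closed[OF x]] \<beta>.hom_closed[OF cN'(2)]]
              iB.hom_mult[OF \<beta>.hom_closed[OF cN'(1)] \<beta>.hom_closed[OF x]] ..
          finally have "to_frac B (\<beta> (\<iota> s \<otimes>\<^bsub>N\<^esub> x \<ominus>\<^bsub>N\<^esub> \<iota> a)) \<in> Q2" using m by simp
          then show ?thesis using down cN' by simp
        qed
        with sp s(1) a(1) show ?thesis by blast
      qed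
    qed
  qed
qed

theorem theorem2p1:
  fixes R :: "('a, 'm) ring_scheme"
  assumes "noetherian_ring R" and "reduced_ring R"
  shows
    "let N = normalization R;
         c = conductor R;
         cN = to_frac R ` c;
         A = R Quot (radical R c);
         B = N Quot (radical N cN);
         \<phi> = seminormalization_map A B (quot_map N (radical N cN) (to_frac R));
         D = (total_fractions B)
               \<lparr>carrier := \<phi> ` carrier (seminormalization A) \<inter> to_frac B ` carrier B\<rparr>;
         C = fiber_product N D (\<lambda>x. to_frac B (radical N cN +>\<^bsub>N\<^esub> x)) (\<lambda>d. d)
     in ideal c R \<and> ideal cN N \<and>
        fst \<in> ring_hom C N \<and> inj_on fst (carrier C) \<and>
        subring (fst ` carrier C) N \<and> to_frac R ` carrier R \<subseteq> fst ` carrier C \<and>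
        is_seminormalization R (fst ` carrier C)"
proof -
  interpret R: cring R using assms(2) by (simp add: reduced_ring_def)
  define N where "N = normalization R"
  define J where "J = radical N (to_frac R ` conductor R)"
  define A where "A = R Quot radical R (conductor R)"
  define B where "B = N Quot J"
  define \<phi> where "\<phi> = seminormalization_map A B (quot_map N J (to_frac R))"
  define D where "D = (total_fractions B)
    \<lparr>carrier := \<phi> ` carrier (seminormalization A) \<inter> to_frac B ` carrier B\<rparr>"
  define C where "C = fiber_product N D (\<lambda>x. to_frac B (J +>\<^bsub>N\<^esub> x)) (\<lambda>d. d)"
  interpret N: ring_hom_cring R N "to_frac R" unfolding N_def by (rule R.to_frac_normalization_hom)
  have iff: "to_frac B (J +>\<^bsub>N\<^esub> x) \<in> \<phi> ` carrier (seminormalization A) \<longleftrightarrow>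
      x \<in> pointwise_closure R N (to_frac R)" if "x \<in> carrier N" for x
    using pullback_eq_pointwise_closure[OF assms, of x] that
    unfolding \<phi>_def A_def B_def J_def N_def by blast
  have in_B: "to_frac B (J +>\<^bsub>N\<^esub> x) \<in> to_frac B ` carrier B" if "x \<in> carrier N" for x
    unfolding B_def carrier_Quot using that by blast
  have carrier_C: "carrier C = {(x, d). x \<in> carrier N \<and> d \<in> carrier D \<and> to_frac B (J +>\<^bsub>N\<^esub> x) = d}"
    unfolding C_def fiber_product_def by auto
  have fst_C: "fst ` carrier C = pointwise_closure R N (to_frac R)"
  proof
    show "fst ` carrier C \<subseteq> pointwise_closure R N (to_frac R)"
    proof
      fix x assume "x \<in> fst ` carrier C"
      then obtain d where "(x, d) \<in> carrier C" by force
      then have "x \<in> carrier N" "to_frac B (J +>\<^bsub>N\<^esub> x) \<in> carrier D"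
        unfolding carrier_C by simp_all
      then show "x \<in> pointwise_closure R N (to_frac R)"
        using iff unfolding D_def by simp
    qed
    show "pointwise_closure R N (to_frac R) \<subseteq> fst ` carrier C"
    proof
      fix x assume x: "x \<in> pointwise_closure R N (to_frac R)"
      then have xN: "x \<in> carrier N" by (rule N.pointwise_closure_carrier)
      then have "(x, to_frac B (J +>\<^bsub>N\<^esub> x)) \<in> carrier C"
        unfolding carrier_C D_def using iff[OF xN] in_B[OF xN] x by simp
      then show "x \<in> fst ` carrier C" by (rule image_eqI[rotated]) simp
    qed
  qed
  have "fst \<in> ring_hom C N"
    by (rule ring_hom_memI) (auto simp: carrier_C, auto simp: C_def fiber_product_def RDirProd_def DirProd_def monoid.defs)
  moreover have "inj_on fst (carrier C)" unfolding carrier_C by (auto simp: inj_on_def)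
  moreover have "is_seminormalization R (fst ` carrier C)"
    unfolding fst_C N_def by (rule R.is_seminormalization_pointwise_closure)
  ultimately have "ideal (conductor R) R \<and> ideal (to_frac R ` conductor R) N \<and>
      fst \<in> ring_hom C N \<and> inj_on fst (carrier C) \<and>
      subring (fst ` carrier C) N \<and> to_frac R ` carrier R \<subseteq> fst ` carrier C \<and>
      is_seminormalization R (fst ` carrier C)"
    using R.conductor_ideal R.conductor_image_ideal N.pointwise_closure_subring
      N.image_subset_pointwise_closure unfolding fst_C N_def by blast
  then show ?thesis
    unfolding Let_def C_def D_def \<phi>_def A_def B_def J_def N_def .
qed

end
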